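(* Let $X=\{X_t,\mathcal F_t;\ 0\le t\le 1\}$ be a real-valued adapted process on a probability space $(\Omega,\mathcal F,\mathbf P)$. Suppose there exist continuous functions $f,g:[0,1]\to\mathbb R$, non-zero (i.e. nowhere vanishing) on $[0,1]$, such that $$X_t=g(t)\int_0^t f(u)\,dW_u,\qquad 0\le t\le 1,$$ where $W$ is a standard Wiener process. Let $\xi_{n,k}$, $(n,k)\in\mathcal I$, be independent Gaussian random variables with law $\mathcal N(0,1)$, where $\mathcal I=\{(n,k): n\ge 0,\ k \text{ an integer},\ 0\le k<2^{n-1}\}$ (so for $n=0$ only $k=0$ occurs). Then there exists a family of continuous functions $\Psi_{n,k}:[0,1]\to\mathbb R$, $(n,k)\in\mathcal I$, given by explicit expressions in terms of $f$ and $g$, namely, with $h(t)=\int_0^t f(u)^2\,du$, $$\Psi_{0,0}(t)=\frac{g(t)\,h(t)}{\sqrt{h(1)}},$$ and, for $n\ge1$, with $l=l_{n,k}=2k\,2^{-n}$, $m=m_{n,k}=(2k+1)2^{-n}$, $r=r_{n,k}=2(k+1)2^{-n}$, $$\Psi_{n,k}(t)=\begin{cases}\sqrt{\dfrac{h(r)-h(m)}{(h(r)-h(l))(h(m)-h(l))}}\;g(t)\,\big(h(t)-h(l)\big), & l\le t<m,\\[3mm] \sqrt{\dfrac{h(m)-h(l)}{(h(r)-h(l))(h(r)-h(m))}}\;g(t)\,\big(h(r)-h(t)\big), & m\le t<r,\\[3mm] 0,&\text{otherwise,}\end{cases}$$ such that, setting $$X^N_t=\sum_{n=0}^N\ \sum_{0\le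 k<2^{n-1}}\Psi_{n,k}(t)\,\xi_{n,k},\qquad 0\le t\le1,\ N\ge0,$$ the following hold. 1. $\Psi_{0,0}$ is supported in $S_{0,0}=[0,1]$, and for $n\ge1$, $\Psi_{n,k}$ is supported in $S_{n,k}=[k\,2^{-n+1},(k+1)2^{-n+1}]$. 2. For every $N\ge0$ and every $t\in[0,1]$, the random variable $X^N_t$ has the same law as the conditional expectation $E\big(X_t\,\big|\,\sigma(X_{k/2^N}:0\le k\le 2^N)\big)$. 3. Almost surely, the path-wise limit $\overline X_t=\lim_{N\to\infty}X^N_t$ exists for all $t\in[0,1]$ and defines a continuous process $\overline X$, which is an exact representation of $X$, i.e. $\overline X$ has the same law as $X$. 4. $X^N$ converges in distribution to $X$ as $N\to\infty$.
   Context: The processes $X^N$ and $X$ have continuous sample paths and are regarded as random variables with values in $C[0,1]$, equipped with the uniform norm and the $\sigma$-field generated by cylinder sets. Convergence in distribution $X^N\to X$ means that $E\big(\phi(X^N)\big)\to E\big(\phi(X)\big)$ for every bounded continuous function $\phi:C[0,1]\to\mathbb R$; equivalently, the laws of $X^N$ on $C[0,1]$ converge weakly to the law of $X$. The process $\overline X$ having the same law as $X$ means that all finite-dimensional distributions of $\overline X$ and $X$ coincide. The variables $\xi_{n,k}$, and hence $X^N$ and $\overline X$, need not be constructed from $X$ or $W$. *)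

theory Defs
  imports "HOL-Probability.Probability"
begin

section \<open>Filtrations and the Wiener process on the unit interval\<close>

text \<open>Processes are indexed by \<^typ>\<open>real\<close>, but only their values at times in \<open>[0,1]\<close> are ever
  used or constrained.\<close>

definition filtration01 :: "'a measure \<Rightarrow> (real \<Rightarrow> 'a measure) \<Rightarrow> bool" where
  "filtration01 M F \<longleftrightarrow>
     (\<forall>t\<in>{0..1}. subalgebra M (F t)) \<and>
     (\<forall>s\<in>{0..1}. \<forall>t\<in>{0..1}. s \<le> t \<longrightarrow> sets (F s) \<subseteq> sets (F t))"

definition adapted01 :: "(real \<Rightarrow> 'a measure) \<Rightarrow> (real \<Rightarrow> 'a \<Rightarrow> real) \<Rightarrow> bool" where
  "adapted01 F X \<longleftrightarrow> (\<forall>t\<in>{0..1}. X t \<in> borel_measurable (F t))"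

text \<open>The second parameter of \<^const>\<open>normal_density\<close> is the standard deviation, hence the square
  root.\<close>

definition wiener_process01 :: "'a measure \<Rightarrow> (real \<Rightarrow> 'a \<Rightarrow> real) \<Rightarrow> bool" where
  "wiener_process01 M W \<longleftrightarrow>
     (\<forall>t\<in>{0..1}. W t \<in> borel_measurable M) \<and>
     (AE \<omega> in M. W 0 \<omega> = 0) \<and>
     (AE \<omega> in M. continuous_on {0..1} (\<lambda>t. W t \<omega>)) \<and>
     (\<forall>s t. 0 \<le> s \<and> s < t \<and> t \<le> 1 \<longrightarrow>
        distributed M lborel (\<lambda>\<omega>. W t \<omega> - W s \<omega>) (normal_density 0 (sqrt (t - s)))) \<and>
     (\<forall>(n::nat) (p :: nat \<Rightarrow> real). 0 \<le> p 0 \<and> (\<forall>i<n. p i \<le> p (Suc i)) \<and> p n \<le> 1 \<longrightarrow>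
        prob_space.indep_vars M (\<lambda>_. borel) (\<lambda>i \<omega>. W (p (Suc i)) \<omega> - W (p i) \<omega>) {..<n})"


section \<open>The Wiener integral of a deterministic function\<close>

text \<open>A deterministic step function on \<open>[0,t]\<close> is given by nodes \<open>p 0 \<le> \<dots> \<le> p n\<close> with
  \<open>p 0 = 0\<close>, \<open>p n = t\<close>, and by its values \<open>c i\<close> on \<open>(p i, p (i+1)]\<close>.\<close>

definition is_partition :: "real \<Rightarrow> nat \<Rightarrow> (nat \<Rightarrow> real) \<Rightarrow> bool" where
  "is_partition t n p \<longleftrightarrow> p 0 = 0 \<and> p n = t \<and> (\<forall>i<n. p i \<le> p (Suc i))"

definition step_fun :: "nat \<Rightarrow> (nat \<Rightarrow> real) \<Rightarrow> (nat \<Rightarrow> real) \<Rightarrow> real \<Rightarrow> real" where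
  "step_fun n p c u = (\<Sum>i<n. c i * indicator {p i<..p (Suc i)} u)"

definition step_integral ::
  "(real \<Rightarrow> 'a \<Rightarrow> real) \<Rightarrow> nat \<Rightarrow> (nat \<Rightarrow> real) \<Rightarrow> (nat \<Rightarrow> real) \<Rightarrow> 'a \<Rightarrow> real" where
  "step_integral W n p c \<omega> = (\<Sum>i<n. c i * (W (p (Suc i)) \<omega> - W (p i) \<omega>))"

text \<open>\<open>I\<close> is (a version of) the integral of \<open>f\<close> against \<open>W\<close> over \<open>[0,t]\<close>: the mean-square limit of
  the integrals of step functions converging to \<open>f\<close> in \<open>L\<^sup>2[0,t]\<close>. By the isometry for step
  functions the limit is unique up to null sets and independent of the approximating sequence.\<close>

definition is_wiener_integral ::
  "'a measure \<Rightarrow> (real \<Rightarrow> 'a \<Rightarrow> real) \<Rightarrow> (real \<Rightarrow> real) \<Rightarrow> real \<Rightarrow> ('a \<Rightarrow> real) \<Rightarrow> bool" where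
  "is_wiener_integral M W f t I \<longleftrightarrow>
     I \<in> borel_measurable M \<and>
     (\<exists>(n :: nat \<Rightarrow> nat) (p :: nat \<Rightarrow> nat \<Rightarrow> real) (c :: nat \<Rightarrow> nat \<Rightarrow> real).
        (\<forall>j. is_partition t (n j) (p j)) \<and>
        (\<lambda>j. \<integral>\<^sup>+u\<in>{0..t}. ennreal ((step_fun (n j) (p j) (c j) u - f u)\<^sup>2) \<partial>lborel) \<longlonglongrightarrow> 0 \<and>
        (\<lambda>j. \<integral>\<^sup>+\<omega>. ennreal ((step_integral W (n j) (p j) (c j) \<omega> - I \<omega>)\<^sup>2) \<partial>M) \<longlonglongrightarrow> 0)"


section \<open>Laws of continuous processes\<close>

definition same_fdd ::
  "'a measure \<Rightarrow> (real \<Rightarrow> 'a \<Rightarrow> real) \<Rightarrow> 'b measure \<Rightarrow> (real \<Rightarrow> 'b \<Rightarrow> real) \<Rightarrow> bool" where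
  "same_fdd M X Q Y \<longleftrightarrow>
     (\<forall>J. finite J \<and> J \<subseteq> {0..1} \<longrightarrow>
        distr M (Pi\<^sub>M J (\<lambda>_. borel)) (\<lambda>\<omega>. \<lambda>t\<in>J. X t \<omega>) =
        distr Q (Pi\<^sub>M J (\<lambda>_. borel)) (\<lambda>\<omega>. \<lambda>t\<in>J. Y t \<omega>))"

text \<open>\<open>C[0,1]\<close> with the uniform metric; its points are the continuous functions on \<open>[0,1]\<close>,
  represented as functions in \<open>extensional {0..1}\<close>.\<close>

definition C01 :: "(real \<Rightarrow> real) metric" where
  "C01 = cfunspace (top_of_set {0..1}) euclidean_metric"

text \<open>The trace on \<open>C[0,1]\<close> of the product \<open>\<sigma>\<close>-algebra is the one generated by cylinder sets.\<close>

definition C01_cylinder :: "(real \<Rightarrow> real) measure" where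
  "C01_cylinder = restrict_space (Pi\<^sub>M {0..1} (\<lambda>_. borel)) (mspace C01)"

definition sample_path :: "(real \<Rightarrow> 'a \<Rightarrow> real) \<Rightarrow> 'a \<Rightarrow> real \<Rightarrow> real" where
  "sample_path X \<omega> = (\<lambda>t\<in>{0..1}. X t \<omega>)"

definition converges_in_distribution_C01 ::
  "'b measure \<Rightarrow> (nat \<Rightarrow> real \<Rightarrow> 'b \<Rightarrow> real) \<Rightarrow> 'a measure \<Rightarrow> (real \<Rightarrow> 'a \<Rightarrow> real) \<Rightarrow> bool" where
  "converges_in_distribution_C01 Q Y M X \<longleftrightarrow>
     (\<forall>N. sample_path (Y N) \<in> measurable Q C01_cylinder) \<and>
     sample_path X \<in> measurable M C01_cylinder \<and>
     (\<forall>\<phi> :: (real \<Rightarrow> real) \<Rightarrow> real.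
        continuous_map (mtopology_of C01) euclideanreal \<phi> \<and> bounded (\<phi> ` mspace C01) \<longrightarrow>
        (\<lambda>N. \<integral>\<omega>. \<phi> (sample_path (Y N) \<omega>) \<partial>Q) \<longlonglongrightarrow> (\<integral>\<omega>. \<phi> (sample_path X \<omega>) \<partial>M))"

definition sigma_generated :: "'a measure \<Rightarrow> ('i \<Rightarrow> 'a \<Rightarrow> real) \<Rightarrow> 'i set \<Rightarrow> 'a measure" where
  "sigma_generated M Y K = sigma (space M) (\<Union>i\<in>K. {Y i -` A \<inter> space M | A. A \<in> sets borel})"


section \<open>The dyadic expansion\<close>

text \<open>The integer form of \<open>0 \<le> k < 2\<^sup>n\<^sup>-\<^sup>1\<close>; for \<open>n = 0\<close> it leaves exactly \<open>k = 0\<close>.\<close>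

definition dyadic_index :: "(nat \<times> nat) set" where
  "dyadic_index = {(n, k). 2 * k < 2 ^ n}"

definition left_pt :: "nat \<Rightarrow> nat \<Rightarrow> real" where
  "left_pt n k = 2 * real k / 2 ^ n"

definition mid_pt :: "nat \<Rightarrow> nat \<Rightarrow> real" where
  "mid_pt n k = (2 * real k + 1) / 2 ^ n"

definition right_pt :: "nat \<Rightarrow> nat \<Rightarrow> real" where
  "right_pt n k = 2 * (real k + 1) / 2 ^ n"

definition dyadic_support :: "nat \<Rightarrow> nat \<Rightarrow> real set" where
  "dyadic_support n k = (if n = 0 then {0..1} else {left_pt n k..right_pt n k})"

definition energy :: "(real \<Rightarrow> real) \<Rightarrow> real \<Rightarrow> real" where
  "energy f t = integral {0..t} (\<lambda>u. (f u)\<^sup>2)"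

definition explicit_Psi ::
  "(real \<Rightarrow> real) \<Rightarrow> (real \<Rightarrow> real) \<Rightarrow> nat \<Rightarrow> nat \<Rightarrow> real \<Rightarrow> real" where
  "explicit_Psi f g n k t =
     (let h = energy f; l = left_pt n k; m = mid_pt n k; r = right_pt n k in
      if n = 0 then g t * h t / sqrt (h 1)
      else if l \<le> t \<and> t < m then
        sqrt ((h r - h m) / ((h r - h l) * (h m - h l))) * g t * (h t - h l)
      else if m \<le> t \<and> t < r then
        sqrt ((h m - h l) / ((h r - h l) * (h r - h m))) * g t * (h r - h t)
      else 0)"

definition partial_expansion ::
  "(nat \<Rightarrow> nat \<Rightarrow> real \<Rightarrow> real) \<Rightarrow> (nat \<Rightarrow> nat \<Rightarrow> 'b \<Rightarrow> real) \<Rightarrow> nat \<Rightarrow> real \<Rightarrow> 'b \<Rightarrow> real" where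
  "partial_expansion \<Psi> \<xi> N t \<omega> =
     (\<Sum>n\<le>N. \<Sum>k | (n, k) \<in> dyadic_index. \<Psi> n k t * \<xi> n k \<omega>)"

end

theory Submission
  imports Defs
begin

text \<open>Put \<open>h = energy f\<close> and \<open>I\<^sub>t = X\<^sub>t / g t\<close>. The Wiener integral \<open>I\<close> is a Brownian motion run by the
  clock \<open>h\<close>: it is centred Gaussian with covariance \<open>h (min s t)\<close>. Dividing \<open>\<Psi>\<^sub>n\<^sub>,\<^sub>k\<close> by \<open>g\<close> leaves the
  classical Schauder tent functions of Levy's construction, seen through the same clock. The theorem
  therefore says that Levy's construction works for this time-changed Brownian motion.

  All assertions about laws are reduced to covariances. By the Cramer-Wold device (\<open>Cramer_Wold\<close>),
  the joint law of finitely many real random variables is determined by the characteristic functions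
  of their linear combinations; hence two centred Gaussian families with the same covariance have the
  same joint law (\<open>gaussian_family_distr_eq\<close>). Three computations feed this principle.

  First, \<open>wiener_integral_gaussian\<close> finds the covariance of \<open>I\<close> from the isometry for step functions
  and passage to mean-square limits. Second, \<open>kernel_formula\<close> evaluates the covariance of the partial
  sum of level \<open>N\<close>: away from the diagonal cells of the dyadic grid it already equals \<open>h (min s t)\<close>,
  and on a diagonal cell it is the covariance of the process obtained by interpolating \<open>I\<close> between
  grid points linearly in \<open>h\<close>. Third, \<open>conditional_expectation_law\<close> identifies this interpolation
  (multiplied by \<open>g\<close>) with the conditional expectation given the grid values: the residual is
  uncorrelated with the grid values, so reversing its sign does not change the joint law with them,
  and its integral over every event generated by the grid must vanish. Comparing variances gives
  the equality of the laws of the partial sum and of the conditional expectation.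

  For the convergence of the series, at most one tent function of each level \<open>n\<close> is nonzero at a given
  time and its height is \<open>O(2\<^sup>-\<^sup>n\<^sup>/\<^sup>2)\<close>, while the largest of the \<open>2\<^sup>n\<^sup>-\<^sup>1\<close> coefficients is at most
  \<open>2\<^sup>n\<^sup>/\<^sup>4\<close> plus an error which is controlled by fourth moments and, weighted with the heights, is
  almost surely summable (\<open>expansion_converges\<close>). So the series converges
  uniformly, almost surely, to a continuous process, whose covariance is the limit of the kernels,
  that is, the covariance of \<open>X\<close>. Convergence in distribution follows by dominated
  convergence once functionals of a path are known to depend only on the finite-dimensional laws
  (\<open>same_fdd_functional\<close>); Bernstein polynomials approximate a path uniformly by functions of finitely
  many of its values.\<close>


section \<open>The Cramer-Wold device\<close>

text \<open>Levy's uniqueness theorem for finite measures: after division by their common total mass, the two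
  measures with densities \<open>w\<close> and \<open>w'\<close> become probability measures, to which the theorem applies.
  The weights are what makes an induction over several coordinates possible.\<close>

lemma weighted_char_unique:
  fixes w Y :: "'a \<Rightarrow> real" and w' Y' :: "'b \<Rightarrow> real"
  assumes M: "prob_space M" and N: "prob_space N"
    and w [measurable]: "w \<in> borel_measurable M" and Y [measurable]: "Y \<in> borel_measurable M"
    and w' [measurable]: "w' \<in> borel_measurable N" and Y' [measurable]: "Y' \<in> borel_measurable N"
    and wb: "\<And>x. 0 \<le> w x" "\<And>x. w x \<le> K" and wb': "\<And>x. 0 \<le> w' x" "\<And>x. w' x \<le> K"
    and eq: "\<And>u. (CLINT x|M. w x * iexp (u * Y x)) = (CLINT x|N. w' x * iexp (u * Y' x))"
    and B [measurable]: "B \<in> sets borel"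
  shows "(LINT x|M. w x * indicator B (Y x)) = (LINT x|N. w' x * indicator B (Y' x))"
proof -
  interpret M: prob_space M by fact
  interpret N: prob_space N by fact
  define m where "m = (LINT x|M. w x)"
  have iw: "integrable M w" by (rule M.integrable_const_bound[where B=K]) (use wb in auto)
  have iw': "integrable N w'" by (rule N.integrable_const_bound[where B=K]) (use wb' in auto)
  have m': "m = (LINT x|N. w' x)"
    using eq[of 0] by (simp add: m_def)
  have m0: "0 \<le> m" unfolding m_def by (rule Bochner_Integration.integral_nonneg) (use wb in auto)
  show ?thesis
  proof (cases "m = 0")
    case True
    have "AE x in M. w x = 0" using integral_nonneg_eq_0_iff_AE[OF iw] True wb by (auto simp: m_def)
    then have 1: "(LINT x|M. w x * indicator B (Y x)) = 0"
      by (intro integral_eq_zero_AE) auto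
    have "AE x in N. w' x = 0" using integral_nonneg_eq_0_iff_AE[OF iw'] True wb' m' by auto
    then have 2: "(LINT x|N. w' x * indicator B (Y' x)) = 0"
      by (intro integral_eq_zero_AE) auto
    show ?thesis using 1 2 by simp
  next
    case False
    then have mp: "m > 0" using m0 by simp
    have key: "real_distribution (distr (density P (\<lambda>x. v x / m)) borel Z) \<and>
       (\<forall>u. char (distr (density P (\<lambda>x. v x / m)) borel Z) u = (CLINT x|P. v x * iexp (u * Z x)) / m) \<and>
       measure (distr (density P (\<lambda>x. v x / m)) borel Z) B = (LINT x|P. v x * indicator B (Z x)) / m"
      if P: "prob_space P" and v[measurable]: "v \<in> borel_measurable P" and Z[measurable]: "Z \<in> borel_measurable P"
        and vb: "\<And>x. 0 \<le> v x" "\<And>x. v x \<le> K" and vm: "(LINT x|P. v x) = m" for P :: "'c measure" and v Z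
    proof -
      interpret P: prob_space P by fact
      have iv: "integrable P v" by (rule P.integrable_const_bound[where B=K]) (use vb in auto)
      have "prob_space (density P (\<lambda>x. v x / m))"
      proof
        have "emeasure (density P (\<lambda>x. v x / m)) (space P) = (\<integral>\<^sup>+x. ennreal (v x / m) \<partial>P)"
          by (subst emeasure_density) (auto intro!: nn_integral_cong)
        also have "\<dots> = ennreal (LINT x|P. v x / m)"
          by (rule nn_integral_eq_integral) (use iv vb mp in auto)
        also have "\<dots> = 1" using vm mp by simp
        finally show "emeasure (density P (\<lambda>x. v x / m)) (space (density P (\<lambda>x. v x / m))) = 1" by simp
      qed
      then have D: "prob_space (distr (density P (\<lambda>x. v x / m)) borel Z)"
        by (rule prob_space.prob_space_distr) simp
      have 1: "real_distribution (distr (density P (\<lambda>x. v x / m)) borel Z)"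
        using D by (simp add: real_distribution_def real_distribution_axioms_def)
      have 2: "char (distr (density P (\<lambda>x. v x / m)) borel Z) u = (CLINT x|P. v x * iexp (u * Z x)) / m" for u
      proof -
        have "char (distr (density P (\<lambda>x. v x / m)) borel Z) u = (CLINT x|density P (\<lambda>x. v x / m). iexp (u * Z x))"
          unfolding char_def by (subst integral_distr) auto
        also have "\<dots> = (CLINT x|P. (v x / m) *\<^sub>R iexp (u * Z x))"
          by (subst integral_density) (use vb mp in auto)
        also have "\<dots> = (CLINT x|P. (v x * iexp (u * Z x)) / m)"
          by (intro Bochner_Integration.integral_cong) (auto simp: scaleR_conv_of_real)
        finally show ?thesis by simp
      qed
      have 3: "measure (distr (density P (\<lambda>x. v x / m)) borel Z) B = (LINT x|P. v x * indicator B (Z x)) / m"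
      proof -
        have "measure (distr (density P (\<lambda>x. v x / m)) borel Z) B = (LINT x|distr (density P (\<lambda>x. v x / m)) borel Z. indicator B x)"
          by simp
        also have "\<dots> = (LINT x|density P (\<lambda>x. v x / m). indicator B (Z x))"
          by (subst integral_distr) auto
        also have "\<dots> = (LINT x|P. (v x / m) *\<^sub>R indicator B (Z x))"
          by (subst integral_density) (use vb mp in auto)
        finally show ?thesis by simp
      qed
      show ?thesis using 1 2 3 by blast
    qed
    note kM = key[OF M w Y wb m_def[symmetric]] and kN = key[OF N w' Y' wb' m'[symmetric]]
    have "distr (density M (\<lambda>x. w x / m)) borel Y = distr (density N (\<lambda>x. w' x / m)) borel Y'"
      by (rule Levy_uniqueness) (use kM kN eq in auto)
    then have "(LINT x|M. w x * indicator B (Y x)) / m = (LINT x|N. w' x * indicator B (Y' x)) / m"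
      by (metis kM kN)
    then show ?thesis using mp by simp
  qed
qed


lemma iexp_add: "iexp (a + b) = iexp a * iexp b"
  by (simp add: exp_add algebra_simps)

text \<open>The nonnegative weights \<open>1 + cos S\<close> and \<open>1 + sin S\<close> carry the same information as the complex
  weight \<open>iexp S\<close>. The first two identities pass from complex to nonnegative weights and the third one
  passes back.\<close>

lemma trig_weights:
  fixes S Y V :: "'a \<Rightarrow> real"
  assumes P: "prob_space P"
    and S [measurable]: "S \<in> borel_measurable P" and Y [measurable]: "Y \<in> borel_measurable P"
    and V [measurable]: "V \<in> borel_measurable P" and Vb: "\<And>x. 0 \<le> V x" "\<And>x. V x \<le> 1"
  defines "I \<equiv> \<lambda>s u. CLINT x|P. iexp (s * S x + u * Y x) * V x"
  shows "(CLINT x|P. complex_of_real ((1 + cos (S x)) * V x) * iexp (u * Y x))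
           = I 0 u + (I 1 u + I (-1) u) / 2"
    and "(CLINT x|P. complex_of_real ((1 + sin (S x)) * V x) * iexp (u * Y x))
           = I 0 u + (I 1 u - I (-1) u) / (2 * \<i>)"
    and "B \<in> sets borel \<Longrightarrow> (CLINT x|P. iexp (S x) * complex_of_real (V x * indicator B (Y x))) =
       complex_of_real ((LINT x|P. (1 + cos (S x)) * V x * indicator B (Y x)) - (LINT x|P. V x * indicator B (Y x)))
       + \<i> * complex_of_real ((LINT x|P. (1 + sin (S x)) * V x * indicator B (Y x)) - (LINT x|P. V x * indicator B (Y x)))"
proof -
  interpret P: prob_space P by fact
  have [simp]: "norm (V x) \<le> 1" for x using Vb[of x] by auto
  have ii: "integrable P (\<lambda>x. iexp (s * S x + u * Y x) * complex_of_real (V x))" for s u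
    by (rule P.integrable_const_bound[where B=1]) (auto simp: norm_mult Vb)
  have c: "complex_of_real (cos a) = (iexp a + iexp (- a)) / 2"
      and s: "complex_of_real (sin a) = (iexp a - iexp (- a)) / (2 * \<i>)" for a
    by (simp_all add: cos_of_real[symmetric] sin_of_real[symmetric] cos_exp_eq sin_exp_eq)
  have c': "complex_of_real ((1 + cos a) * v) = (1 + (iexp a + iexp (- a)) / 2) * of_real v"
    and s': "complex_of_real ((1 + sin a) * v) = (1 + (iexp a - iexp (- a)) / (2 * \<i>)) * of_real v" for a v
    by (simp_all only: of_real_mult of_real_add of_real_1 c s)
  have z: "iexp (0 * a + b) = iexp b" "iexp (1 * a + b) = iexp a * iexp b"
      "iexp ((-1) * a + b) = iexp (- a) * iexp b" for a b
    by (simp_all only: iexp_add mult_zero_left mult_1 mult_minus1 add_0)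
  have alg: "((1 + (E + E') / 2) * v) * F = F * v + (E * F * v + E' * F * v) / 2"
      "((1 + (E - E') / (2 * \<i>)) * v) * F = F * v + (E * F * v - E' * F * v) / (2 * \<i>)"
      for E E' F v :: complex
    by (simp_all add: field_simps)
  show "(CLINT x|P. complex_of_real ((1 + cos (S x)) * V x) * iexp (u * Y x))
           = I 0 u + (I 1 u + I (-1) u) / 2"
  proof -
    have "(CLINT x|P. complex_of_real ((1 + cos (S x)) * V x) * iexp (u * Y x)) =
      (CLINT x|P. iexp (0 * S x + u * Y x) * V x + (iexp (1 * S x + u * Y x) * V x + iexp ((-1) * S x + u * Y x) * V x) / 2)"
      unfolding z c' alg by (rule refl)
    also have "\<dots> = I 0 u + (I 1 u + I (-1) u) / 2"
      unfolding I_def using ii[of 0 u] ii[of 1 u] ii[of "-1" u] by simp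
    finally show ?thesis .
  qed
  show "(CLINT x|P. complex_of_real ((1 + sin (S x)) * V x) * iexp (u * Y x))
           = I 0 u + (I 1 u - I (-1) u) / (2 * \<i>)"
  proof -
    have "(CLINT x|P. complex_of_real ((1 + sin (S x)) * V x) * iexp (u * Y x)) =
      (CLINT x|P. iexp (0 * S x + u * Y x) * V x + (iexp (1 * S x + u * Y x) * V x - iexp ((-1) * S x + u * Y x) * V x) / (2 * \<i>))"
      unfolding z s' alg by (rule refl)
    also have "\<dots> = I 0 u + (I 1 u - I (-1) u) / (2 * \<i>)"
      unfolding I_def using ii[of 0 u] ii[of 1 u] ii[of "-1" u] by simp
    finally show ?thesis .
  qed
  assume B [measurable]: "B \<in> sets borel"
  have bd: "\<bar>a\<bar> \<le> 1 \<Longrightarrow> \<bar>a * V x * indicator B (Y x)\<bar> \<le> 1" for a x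
    using Vb[of x] by (auto simp: abs_mult indicator_def mult_le_one)
  have i0: "integrable P (\<lambda>x. V x * indicator B (Y x))"
    by (rule P.integrable_const_bound[where B=1]) (use bd[of 1] in auto)
  have i1: "integrable P (\<lambda>x. cos (S x) * V x * indicator B (Y x))"
    by (rule P.integrable_const_bound[where B=1]) (use bd in auto)
  have i2: "integrable P (\<lambda>x. sin (S x) * V x * indicator B (Y x))"
    by (rule P.integrable_const_bound[where B=1]) (use bd in auto)
  have "(CLINT x|P. iexp (S x) * complex_of_real (V x * indicator B (Y x))) =
     (CLINT x|P. complex_of_real (cos (S x) * V x * indicator B (Y x)) + \<i> * complex_of_real (sin (S x) * V x * indicator B (Y x)))"
    by (intro Bochner_Integration.integral_cong) (auto simp: exp_Euler cos_of_real sin_of_real algebra_simps)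
  also have "\<dots> = complex_of_real (LINT x|P. cos (S x) * V x * indicator B (Y x)) + \<i> * complex_of_real (LINT x|P. sin (S x) * V x * indicator B (Y x))"
    using i1 i2 by (simp del: of_real_mult)
  finally show "(CLINT x|P. iexp (S x) * complex_of_real (V x * indicator B (Y x))) =
       complex_of_real ((LINT x|P. (1 + cos (S x)) * V x * indicator B (Y x)) - (LINT x|P. V x * indicator B (Y x)))
       + \<i> * complex_of_real ((LINT x|P. (1 + sin (S x)) * V x * indicator B (Y x)) - (LINT x|P. V x * indicator B (Y x)))"
    using i0 i1 i2 by (simp add: ring_distribs)
qed

text \<open>The coordinates are converted one by one from a factor of the characteristic function into an
  indicator. At each step the factors not involving the coordinate \<open>k\<close> form a weight, and the
  one-dimensional uniqueness theorem is applied to \<open>Y k\<close> under that weight.\<close>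

lemma char_determines_rectangles:
  fixes Y :: "'i \<Rightarrow> 'a \<Rightarrow> real" and Z :: "'i \<Rightarrow> 'b \<Rightarrow> real"
  assumes M: "prob_space M" and N: "prob_space N" and J: "finite J"
    and Y: "\<And>j. j \<in> J \<Longrightarrow> Y j \<in> borel_measurable M" and Z: "\<And>j. j \<in> J \<Longrightarrow> Z j \<in> borel_measurable N"
    and eq: "\<And>c. (CLINT x|M. iexp (\<Sum>j\<in>J. c j * Y j x)) = (CLINT x|N. iexp (\<Sum>j\<in>J. c j * Z j x))"
    and K: "K \<subseteq> J" and B: "\<And>j. j \<in> K \<Longrightarrow> B j \<in> sets borel"
  shows "(CLINT x|M. iexp (\<Sum>j\<in>J-K. c j * Y j x) * complex_of_real (\<Prod>j\<in>K. indicator (B j) (Y j x)))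
       = (CLINT x|N. iexp (\<Sum>j\<in>J-K. c j * Z j x) * complex_of_real (\<Prod>j\<in>K. indicator (B j) (Z j x)))"
  using finite_subset[OF K J] K B
proof (induction K arbitrary: c rule: finite_induct)
  case empty
  show ?case using eq[of c] by simp
next
  case (insert k K)
  define L where "L = J - insert k K"
  have L: "finite L" "L \<subseteq> J" "k \<notin> L" "J - K = insert k L" "k \<in> J" "K \<subseteq> J"
    using J insert by (auto simp: L_def)
  have B': "B k \<in> sets borel" "\<And>j. j \<in> K \<Longrightarrow> B j \<in> sets borel" using insert by auto
  define SM where "SM x = (\<Sum>j\<in>L. c j * Y j x)" for x
  define SN where "SN x = (\<Sum>j\<in>L. c j * Z j x)" for x
  define VM :: "'a \<Rightarrow> real" where "VM x = (\<Prod>j\<in>K. indicator (B j) (Y j x))" for x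
  define VN :: "'b \<Rightarrow> real" where "VN x = (\<Prod>j\<in>K. indicator (B j) (Z j x))" for x
  have [measurable]: "Y k \<in> borel_measurable M" "Z k \<in> borel_measurable N" using Y Z L by auto
  have [measurable]: "SM \<in> borel_measurable M" unfolding SM_def using Y L by (intro borel_measurable_sum) auto
  have [measurable]: "SN \<in> borel_measurable N" unfolding SN_def using Z L by (intro borel_measurable_sum) auto
  have [measurable]: "VM \<in> borel_measurable M" unfolding VM_def
    by (intro borel_measurable_prod measurable_compose[OF Y borel_measurable_indicator]) (use L B' in auto)
  have [measurable]: "VN \<in> borel_measurable N" unfolding VN_def
    by (intro borel_measurable_prod measurable_compose[OF Z borel_measurable_indicator]) (use L B' in auto)
  have VM: "0 \<le> VM x" "VM x \<le> 1" for x unfolding VM_def by (auto intro!: prod_nonneg prod_le_1)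
  have VN: "0 \<le> VN x" "VN x \<le> 1" for x unfolding VN_def by (auto intro!: prod_nonneg prod_le_1)
  have I: "(CLINT x|M. iexp (s * SM x + u * Y k x) * VM x) = (CLINT x|N. iexp (s * SN x + u * Z k x) * VN x)" for s u
  proof -
    have "(\<Sum>j\<in>J-K. (if j = k then u else s * c j) * Y j x) = s * SM x + u * Y k x" for x
    proof -
      have "(\<Sum>j\<in>L. (if j = k then u else s * c j) * Y j x) = s * SM x"
        unfolding SM_def sum_distrib_left by (rule sum.cong) (use L in \<open>auto simp: mult.assoc\<close>)
      then show ?thesis using L by simp
    qed
    moreover have "(\<Sum>j\<in>J-K. (if j = k then u else s * c j) * Z j x) = s * SN x + u * Z k x" for x
    proof -
      have "(\<Sum>j\<in>L. (if j = k then u else s * c j) * Z j x) = s * SN x"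
        unfolding SN_def sum_distrib_left by (rule sum.cong) (use L in \<open>auto simp: mult.assoc\<close>)
      then show ?thesis using L by simp
    qed
    ultimately show ?thesis
      using insert.IH[OF L(6) B'(2), of "\<lambda>j. if j = k then u else s * c j"]
      unfolding VM_def VN_def by (simp only:)
  qed
  note tM = trig_weights[OF M, of SM "Y k" VM] and tN = trig_weights[OF N, of SN "Z k" VN]
  have e0: "(LINT x|M. VM x * indicator (B k) (Y k x)) = (LINT x|N. VN x * indicator (B k) (Z k x))"
    by (rule weighted_char_unique[OF M N, where K=1])
       (use VM VN I[of 0] B' in \<open>auto simp: mult.commute\<close>)
  have b1: "0 \<le> (1 + a) * b" "(1 + a) * b \<le> 2" if "0 \<le> b" "b \<le> 1" "-1 \<le> a" "a \<le> 1" for a b :: real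
    using that mult_mono[of "1+a" 2 b 1] by auto
  have b2: "0 \<le> (1 + cos a) * VM x" "(1 + cos a) * VM x \<le> 2" "0 \<le> (1 + cos a) * VN y" "(1 + cos a) * VN y \<le> 2"
    "0 \<le> (1 + sin a) * VM x" "(1 + sin a) * VM x \<le> 2" "0 \<le> (1 + sin a) * VN y" "(1 + sin a) * VN y \<le> 2" for a x y
    by (intro b1 VM VN; simp)+
  have e1: "(LINT x|M. (1 + cos (SM x)) * VM x * indicator (B k) (Y k x)) = (LINT x|N. (1 + cos (SN x)) * VN x * indicator (B k) (Z k x))"
  proof (rule weighted_char_unique[OF M N, where K=2])
    fix u
    show "(CLINT x|M. complex_of_real ((1 + cos (SM x)) * VM x) * iexp (u * Y k x)) =
          (CLINT x|N. complex_of_real ((1 + cos (SN x)) * VN x) * iexp (u * Z k x))"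
      by (subst tM(1); (subst tN(1))?) (simp_all only: VM VN I, measurable)
  qed (use b2 B' in simp_all)
  have e2: "(LINT x|M. (1 + sin (SM x)) * VM x * indicator (B k) (Y k x)) = (LINT x|N. (1 + sin (SN x)) * VN x * indicator (B k) (Z k x))"
  proof (rule weighted_char_unique[OF M N, where K=2])
    fix u
    show "(CLINT x|M. complex_of_real ((1 + sin (SM x)) * VM x) * iexp (u * Y k x)) =
          (CLINT x|N. complex_of_real ((1 + sin (SN x)) * VN x) * iexp (u * Z k x))"
      by (subst tM(2); (subst tN(2))?) (simp_all only: VM VN I, measurable)
  qed (use b2 B' in simp_all)
  have "(CLINT x|M. iexp (SM x) * complex_of_real (VM x * indicator (B k) (Y k x))) =
        (CLINT x|N. iexp (SN x) * complex_of_real (VN x * indicator (B k) (Z k x)))"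
    by (subst tM(3); (subst tN(3))?) (simp_all add: VM VN B' e0 e1 e2)
  then show ?case
    using insert.hyps unfolding SM_def SN_def VM_def VN_def L_def by (simp add: mult.commute)
qed

theorem Cramer_Wold:
  fixes Y :: "'i \<Rightarrow> 'a \<Rightarrow> real" and Z :: "'i \<Rightarrow> 'b \<Rightarrow> real"
  assumes M: "prob_space M" and N: "prob_space N" and J: "finite J"
    and Y: "\<And>j. j \<in> J \<Longrightarrow> Y j \<in> borel_measurable M" and Z: "\<And>j. j \<in> J \<Longrightarrow> Z j \<in> borel_measurable N"
    and eq: "\<And>c. (CLINT x|M. iexp (\<Sum>j\<in>J. c j * Y j x)) = (CLINT x|N. iexp (\<Sum>j\<in>J. c j * Z j x))"
  shows "distr M (Pi\<^sub>M J (\<lambda>_. borel)) (\<lambda>x. \<lambda>j\<in>J. Y j x) = distr N (Pi\<^sub>M J (\<lambda>_. borel)) (\<lambda>x. \<lambda>j\<in>J. Z j x)"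
proof -
  interpret M: prob_space M by fact
  interpret N: prob_space N by fact
  have mY [measurable]: "(\<lambda>x. \<lambda>j\<in>J. Y j x) \<in> measurable M (Pi\<^sub>M J (\<lambda>_. borel))"
    by (rule measurable_restrict) (use Y in auto)
  have mZ [measurable]: "(\<lambda>x. \<lambda>j\<in>J. Z j x) \<in> measurable N (Pi\<^sub>M J (\<lambda>_. borel))"
    by (rule measurable_restrict) (use Z in auto)
  have rect: "emeasure (distr P (Pi\<^sub>M J (\<lambda>_. borel)) (\<lambda>x. \<lambda>j\<in>J. U j x)) (Pi\<^sub>E J A)
      = ennreal (Re (CLINT x|P. complex_of_real (\<Prod>j\<in>J. indicator (A j) (U j x))))"
    if P: "prob_space P" and m: "(\<lambda>x. \<lambda>j\<in>J. U j x) \<in> measurable P (Pi\<^sub>M J (\<lambda>_. borel))"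
      and A: "\<And>j. j \<in> J \<Longrightarrow> A j \<in> sets borel" for P :: "'c measure" and U and A :: "'i \<Rightarrow> real set"
  proof -
    interpret P: prob_space P by fact
    have S: "Pi\<^sub>E J A \<in> sets (Pi\<^sub>M J (\<lambda>_. borel))" using A J by (intro sets_PiM_I_finite) auto
    have "emeasure (distr P (Pi\<^sub>M J (\<lambda>_. borel)) (\<lambda>x. \<lambda>j\<in>J. U j x)) (Pi\<^sub>E J A)
       = emeasure P ((\<lambda>x. \<lambda>j\<in>J. U j x) -` Pi\<^sub>E J A \<inter> space P)"
      by (rule emeasure_distr[OF m S])
    also have "\<dots> = ennreal (LINT x|P. indicator ((\<lambda>x. \<lambda>j\<in>J. U j x) -` Pi\<^sub>E J A \<inter> space P) x)"
      using measurable_sets[OF m S] by (simp add: P.emeasure_eq_measure)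
    also have "(LINT x|P. indicator ((\<lambda>x. \<lambda>j\<in>J. U j x) -` Pi\<^sub>E J A \<inter> space P) x)
        = (LINT x|P. (\<Prod>j\<in>J. indicator (A j) (U j x) :: real))"
    proof (rule Bochner_Integration.integral_cong[OF refl])
      fix x assume "x \<in> space P"
      then show "indicator ((\<lambda>x. \<lambda>j\<in>J. U j x) -` Pi\<^sub>E J A \<inter> space P) x = (\<Prod>j\<in>J. indicator (A j) (U j x) :: real)"
        using J by (auto simp: indicator_def PiE_iff)
    qed
    also have "\<dots> = Re (CLINT x|P. complex_of_real (\<Prod>j\<in>J. indicator (A j) (U j x)))"
      by (simp only: integral_complex_of_real Re_complex_of_real)
    finally show ?thesis .
  qed
  show ?thesis
  proof (rule measure_eqI_PiM_finite[OF J])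
    fix A :: "'i \<Rightarrow> real set" assume A: "\<And>j. j \<in> J \<Longrightarrow> A j \<in> sets borel"
    have "(CLINT x|M. complex_of_real (\<Prod>j\<in>J. indicator (A j) (Y j x))) = (CLINT x|N. complex_of_real (\<Prod>j\<in>J. indicator (A j) (Z j x)))"
      using char_determines_rectangles[OF M N J Y Z eq, of J A] A by simp
    then show "emeasure (distr M (Pi\<^sub>M J (\<lambda>_. borel)) (\<lambda>x. \<lambda>j\<in>J. Y j x)) (Pi\<^sub>E J A) =
               emeasure (distr N (Pi\<^sub>M J (\<lambda>_. borel)) (\<lambda>x. \<lambda>j\<in>J. Z j x)) (Pi\<^sub>E J A)"
      by (subst rect[OF M mY A], simp) (subst rect[OF N mZ A], simp_all)
  next
    show "range (\<lambda>_::nat. Pi\<^sub>E J (\<lambda>_. UNIV)) \<subseteq> prod_algebra J (\<lambda>_. borel :: real measure)"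
      using J by (auto intro!: prod_algebraI_finite)
    show "(\<Union>i::nat. Pi\<^sub>E J (\<lambda>_. UNIV)) = space (Pi\<^sub>M J (\<lambda>_. borel :: real measure))"
      by (simp add: space_PiM)
    show "emeasure (distr M (Pi\<^sub>M J (\<lambda>_. borel)) (\<lambda>x. \<lambda>j\<in>J. Y j x)) (Pi\<^sub>E J (\<lambda>_. UNIV)) \<noteq> \<infinity>"
    proof -
      interpret D: prob_space "distr M (Pi\<^sub>M J (\<lambda>_. borel)) (\<lambda>x. \<lambda>j\<in>J. Y j x)"
        by (rule M.prob_space_distr) simp
      show ?thesis by simp
    qed
  qed simp_all
qed

section \<open>Centred Gaussian families\<close>

text \<open>The condition is meant for finite \<open>J\<close>. It says that every linear combination is \<open>N(0, v)\<close> with \<open>v\<close>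
  the value of the quadratic form \<open>C\<close>; evaluating the characteristic function at \<open>1\<close> is enough, since
  the coefficients \<open>c\<close> can absorb any other argument. Degenerate variances are included.\<close>

definition gaussian_family ::
  "'a measure \<Rightarrow> 'i set \<Rightarrow> ('i \<Rightarrow> 'a \<Rightarrow> real) \<Rightarrow> ('i \<Rightarrow> 'i \<Rightarrow> real) \<Rightarrow> bool" where
  "gaussian_family M J Y C \<longleftrightarrow>
     (\<forall>j\<in>J. Y j \<in> borel_measurable M) \<and>
     (\<forall>c. (CLINT x|M. iexp (\<Sum>j\<in>J. c j * Y j x)) =
          complex_of_real (exp (- (\<Sum>i\<in>J. \<Sum>j\<in>J. c i * c j * C i j) / 2)))"

lemma gaussian_familyD:
  assumes "gaussian_family M J Y C"
  shows "j \<in> J \<Longrightarrow> Y j \<in> borel_measurable M"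
    and "(CLINT x|M. iexp (\<Sum>j\<in>J. c j * Y j x)) =
          complex_of_real (exp (- (\<Sum>i\<in>J. \<Sum>j\<in>J. c i * c j * C i j) / 2))"
  using assms unfolding gaussian_family_def by blast+

lemma gaussian_family_cov_cong:
  assumes "gaussian_family M J Y C" and "\<And>i j. i \<in> J \<Longrightarrow> j \<in> J \<Longrightarrow> C i j = D i j"
  shows "gaussian_family M J Y D"
proof -
  have "(\<Sum>i\<in>J. \<Sum>j\<in>J. c i * c j * C i j) = (\<Sum>i\<in>J. \<Sum>j\<in>J. c i * c j * D i j)" for c
    using assms(2) by (intro sum.cong) auto
  then show ?thesis using assms(1) unfolding gaussian_family_def by simp
qed

lemma gaussian_family_AE_cong:
  assumes G: "gaussian_family M J Y C" and J: "finite J"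
    and Z: "\<And>j. j \<in> J \<Longrightarrow> Z j \<in> borel_measurable M"
    and eq: "\<And>j. j \<in> J \<Longrightarrow> AE x in M. Y j x = Z j x"
  shows "gaussian_family M J Z C"
proof -
  have Y: "\<And>j. j \<in> J \<Longrightarrow> Y j \<in> borel_measurable M" using gaussian_familyD[OF G] by blast
  have AE: "AE x in M. \<forall>j\<in>J. Y j x = Z j x" using eq J by (simp add: AE_finite_all)
  have "(CLINT x|M. iexp (\<Sum>j\<in>J. c j * Z j x)) = (CLINT x|M. iexp (\<Sum>j\<in>J. c j * Y j x))" for c
  proof (rule integral_cong_AE)
    have [measurable]: "(\<lambda>x. \<Sum>j\<in>J. c j * Y j x) \<in> borel_measurable M"
      using Y by (intro borel_measurable_sum borel_measurable_times) auto
    have [measurable]: "(\<lambda>x. \<Sum>j\<in>J. c j * Z j x) \<in> borel_measurable M"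
      using Z by (intro borel_measurable_sum borel_measurable_times) auto
    show "(\<lambda>x. iexp (\<Sum>j\<in>J. c j * Y j x)) \<in> borel_measurable M"
         "(\<lambda>x. iexp (\<Sum>j\<in>J. c j * Z j x)) \<in> borel_measurable M" by measurable
    show "AE x in M. iexp (\<Sum>j\<in>J. c j * Z j x) = iexp (\<Sum>j\<in>J. c j * Y j x)"
      using AE by eventually_elim (simp cong: sum.cong)
  qed
  then show ?thesis using G Z unfolding gaussian_family_def by simp
qed

lemma gaussian_family_linear:
  fixes A :: "'j \<Rightarrow> 'i \<Rightarrow> real"
  assumes G: "gaussian_family M T Y C" and T: "finite T" and J: "finite J"
  shows "gaussian_family M J (\<lambda>a x. \<Sum>j\<in>T. A a j * Y j x) (\<lambda>a b. \<Sum>i\<in>T. \<Sum>j\<in>T. A a i * A b j * C i j)"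
  unfolding gaussian_family_def
proof (intro conjI ballI allI)
  note Y = gaussian_familyD(1)[OF G]
  show "(\<lambda>x. \<Sum>j\<in>T. A a j * Y j x) \<in> borel_measurable M" for a
    using Y by (intro borel_measurable_sum borel_measurable_times) auto
  fix c :: "'j \<Rightarrow> real"
  define d where "d j = (\<Sum>a\<in>J. c a * A a j)" for j
  have 1: "(\<Sum>a\<in>J. c a * (\<Sum>j\<in>T. A a j * Y j x)) = (\<Sum>j\<in>T. d j * Y j x)" for x
    unfolding d_def sum_distrib_left sum_distrib_right
    by (subst sum.swap) (simp add: mult.assoc)
  have 2: "(\<Sum>i\<in>T. \<Sum>j\<in>T. d i * d j * C i j) =
      (\<Sum>a\<in>J. \<Sum>b\<in>J. c a * c b * (\<Sum>i\<in>T. \<Sum>j\<in>T. A a i * A b j * C i j))"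
  proof -
    have sw: "(\<Sum>i\<in>T. \<Sum>j\<in>T. \<Sum>a\<in>J. \<Sum>b\<in>J. F i j a b) = (\<Sum>a\<in>J. \<Sum>b\<in>J. \<Sum>i\<in>T. \<Sum>j\<in>T. F i j a b)"
      for F :: "'i \<Rightarrow> 'i \<Rightarrow> 'j \<Rightarrow> 'j \<Rightarrow> real"
    proof -
      have "(\<Sum>i\<in>T. \<Sum>j\<in>T. \<Sum>a\<in>J. \<Sum>b\<in>J. F i j a b) = (\<Sum>i\<in>T. \<Sum>a\<in>J. \<Sum>j\<in>T. \<Sum>b\<in>J. F i j a b)"
        by (intro sum.cong refl, rule sum.swap)
      also have "\<dots> = (\<Sum>a\<in>J. \<Sum>i\<in>T. \<Sum>j\<in>T. \<Sum>b\<in>J. F i j a b)" by (rule sum.swap)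
      also have "\<dots> = (\<Sum>a\<in>J. \<Sum>i\<in>T. \<Sum>b\<in>J. \<Sum>j\<in>T. F i j a b)"
        by (intro sum.cong refl, rule sum.swap)
      also have "\<dots> = (\<Sum>a\<in>J. \<Sum>b\<in>J. \<Sum>i\<in>T. \<Sum>j\<in>T. F i j a b)"
        by (intro sum.cong refl, rule sum.swap)
      finally show ?thesis .
    qed
    have "(\<Sum>i\<in>T. \<Sum>j\<in>T. d i * d j * C i j) =
       (\<Sum>i\<in>T. \<Sum>j\<in>T. \<Sum>a\<in>J. \<Sum>b\<in>J. c a * A a i * (c b * A b j) * C i j)"
      unfolding d_def sum_product by (simp only: sum_distrib_right)
    also have "\<dots> = (\<Sum>a\<in>J. \<Sum>b\<in>J. \<Sum>i\<in>T. \<Sum>j\<in>T. c a * A a i * (c b * A b j) * C i j)"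
      by (rule sw)
    also have "\<dots> = (\<Sum>a\<in>J. \<Sum>b\<in>J. c a * c b * (\<Sum>i\<in>T. \<Sum>j\<in>T. A a i * A b j * C i j))"
      unfolding sum_distrib_left by (intro sum.cong refl) (simp add: ac_simps)
    finally show ?thesis .
  qed
  show "(CLINT x|M. iexp (\<Sum>a\<in>J. c a * (\<Sum>j\<in>T. A a j * Y j x))) =
     complex_of_real (exp (- (\<Sum>a\<in>J. \<Sum>b\<in>J. c a * c b * (\<Sum>i\<in>T. \<Sum>j\<in>T. A a i * A b j * C i j)) / 2))"
    unfolding 1 2[symmetric] by (rule gaussian_familyD(2)[OF G])
qed

lemma gaussian_family_scale:
  assumes G: "gaussian_family M J Y C"
  shows "gaussian_family M J (\<lambda>j x. g j * Y j x) (\<lambda>i j. g i * g j * C i j)"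
  unfolding gaussian_family_def
proof (intro conjI ballI allI)
  show "(\<lambda>x. g j * Y j x) \<in> borel_measurable M" if "j \<in> J" for j
    using gaussian_familyD(1)[OF G that] by simp
  fix c :: "'b \<Rightarrow> real"
  show "(CLINT x|M. iexp (\<Sum>j\<in>J. c j * (g j * Y j x))) =
     complex_of_real (exp (- (\<Sum>i\<in>J. \<Sum>j\<in>J. c i * c j * (g i * g j * C i j)) / 2))"
    using gaussian_familyD(2)[OF G, of "\<lambda>j. c j * g j"] by (simp only: ac_simps)
qed

lemma gaussian_family_limit:
  assumes M: "prob_space M" and J: "finite J"
    and G: "\<And>n. gaussian_family M J (Y n) (C n)"
    and Z: "\<And>j. j \<in> J \<Longrightarrow> Z j \<in> borel_measurable M"
    and lim: "\<And>j. j \<in> J \<Longrightarrow> AE x in M. (\<lambda>n. Y n j x) \<longlonglongrightarrow> Z j x"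
    and C: "\<And>i j. i \<in> J \<Longrightarrow> j \<in> J \<Longrightarrow> (\<lambda>n. C n i j) \<longlonglongrightarrow> D i j"
  shows "gaussian_family M J Z D"
  unfolding gaussian_family_def
proof (intro conjI ballI allI)
  interpret prob_space M by fact
  note Y = gaussian_familyD(1)[OF G]
  show "Z j \<in> borel_measurable M" if "j \<in> J" for j by (rule Z[OF that])
  fix c :: "'b \<Rightarrow> real"
  have [measurable]: "(\<lambda>x. \<Sum>j\<in>J. c j * Y n j x) \<in> borel_measurable M" for n
    using Y by (intro borel_measurable_sum borel_measurable_times) auto
  have [measurable]: "(\<lambda>x. \<Sum>j\<in>J. c j * Z j x) \<in> borel_measurable M"
    using Z by (intro borel_measurable_sum borel_measurable_times) auto
  have AE: "AE x in M. \<forall>j\<in>J. (\<lambda>n. Y n j x) \<longlonglongrightarrow> Z j x" using lim J by (simp add: AE_finite_all)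
  have 1: "(\<lambda>n. CLINT x|M. iexp (\<Sum>j\<in>J. c j * Y n j x)) \<longlonglongrightarrow> (CLINT x|M. iexp (\<Sum>j\<in>J. c j * Z j x))"
  proof (rule integral_dominated_convergence[where w="\<lambda>_. 1"])
    show "AE x in M. (\<lambda>n. iexp (\<Sum>j\<in>J. c j * Y n j x)) \<longlonglongrightarrow> iexp (\<Sum>j\<in>J. c j * Z j x)"
      using AE by eventually_elim (intro tendsto_intros; blast)
  qed (auto simp del: of_real_sum)
  have 2: "(\<lambda>n. complex_of_real (exp (- (\<Sum>i\<in>J. \<Sum>j\<in>J. c i * c j * C n i j) / 2))) \<longlonglongrightarrow>
     complex_of_real (exp (- (\<Sum>i\<in>J. \<Sum>j\<in>J. c i * c j * D i j) / 2))"
    by (intro tendsto_intros C) auto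
  show "(CLINT x|M. iexp (\<Sum>j\<in>J. c j * Z j x)) =
     complex_of_real (exp (- (\<Sum>i\<in>J. \<Sum>j\<in>J. c i * c j * D i j) / 2))"
    by (rule LIMSEQ_unique[OF 1]) (use 2 in \<open>simp only: gaussian_familyD(2)[OF G]\<close>)
qed

text \<open>The covariance determines the law. All comparisons of laws below go through this lemma.\<close>

lemma gaussian_family_distr_eq:
  assumes M: "prob_space M" and N: "prob_space N" and J: "finite J"
    and Y: "gaussian_family M J Y C" and Z: "gaussian_family N J Z C"
  shows "distr M (Pi\<^sub>M J (\<lambda>_. borel)) (\<lambda>x. \<lambda>j\<in>J. Y j x) = distr N (Pi\<^sub>M J (\<lambda>_. borel)) (\<lambda>x. \<lambda>j\<in>J. Z j x)"
  by (rule Cramer_Wold[OF M N J])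
     (use gaussian_familyD[OF Y] gaussian_familyD[OF Z] in auto)

lemma gaussian_family_distr_eq1:
  assumes M: "prob_space M" and N: "prob_space N"
    and Y: "gaussian_family M {t} Y C" and Z: "gaussian_family N {t} Z C"
  shows "distr M borel (Y t) = distr N borel (Z t)"
proof -
  have *: "distr P borel (U t) = distr (distr P (Pi\<^sub>M {t} (\<lambda>_. borel)) (\<lambda>x. \<lambda>j\<in>{t}. U j x)) borel (\<lambda>y. y t)"
    if [measurable]: "U t \<in> borel_measurable P" for P :: "'z measure" and U
  proof -
    have "(\<lambda>x. \<lambda>j\<in>{t}. U j x) \<in> measurable P (Pi\<^sub>M {t} (\<lambda>_. borel))"
      by (rule measurable_restrict) simp
    then show ?thesis
      by (subst distr_distr) (auto simp: comp_def intro!: measurable_component_singleton)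
  qed
  show ?thesis
    using *[of Y M] *[of Z N] gaussian_familyD(1)[OF Y, of t] gaussian_familyD(1)[OF Z, of t]
      gaussian_family_distr_eq[OF M N _ Y Z] by simp
qed

lemma char_normal:
  assumes M: "prob_space M" and X: "distributed M lborel X (normal_density 0 s)" and s: "0 < s"
  shows "char (distr M borel X) u = complex_of_real (exp (- (u\<^sup>2 * s\<^sup>2) / 2))"
proof -
  interpret prob_space M by fact
  have [measurable]: "X \<in> borel_measurable M" using distributed_measurable[OF X] by simp
  have "distributed M lborel (\<lambda>x. X x / s) std_normal_density"
    using normal_standard_normal_convert[of s X 0] X s by simp
  then have "distr M lborel (\<lambda>x. X x / s) = std_normal_distribution"
    by (rule distributed_distr_eq_density)
  moreover have "distr M lborel (\<lambda>x. X x / s) = distr M borel (\<lambda>x. X x / s)"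
    by (rule distr_cong) auto
  ultimately have "char (distr M borel (\<lambda>x. X x / s)) (u * s) = complex_of_real (exp (- ((u * s)^2) / 2))"
    by (simp only: char_std_normal_distribution)
  moreover have "char (distr M borel (\<lambda>x. X x / s)) (u * s) = char (distr M borel X) u"
    unfolding char_def using s by (simp add: integral_distr)
  ultimately show ?thesis by (simp add: power_mult_distrib)
qed

lemma gaussian_family_indep:
  assumes M: "prob_space M" and J: "finite J"
    and ind: "prob_space.indep_vars M (\<lambda>_. borel) Y J"
    and ch: "\<And>j u. j \<in> J \<Longrightarrow> char (distr M borel (Y j)) u = complex_of_real (exp (- (u\<^sup>2 * v j) / 2))"
  shows "gaussian_family M J Y (\<lambda>i j. if i = j then v j else 0)"
  unfolding gaussian_family_def
proof (intro conjI ballI allI)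
  interpret prob_space M by fact
  show Y: "Y j \<in> borel_measurable M" if "j \<in> J" for j
    using ind that unfolding indep_vars_def by auto
  fix c :: "'b \<Rightarrow> real"
  have ind': "indep_vars (\<lambda>_. borel) (\<lambda>j x. c j * Y j x) J"
    using indep_vars_compose2[OF ind, of "\<lambda>j y. c j * y" "\<lambda>_. borel"] by simp
  have [measurable]: "(\<lambda>x. \<Sum>j\<in>J. c j * Y j x) \<in> borel_measurable M"
    using Y by (intro borel_measurable_sum borel_measurable_times) auto
  have "(CLINT x|M. iexp (\<Sum>j\<in>J. c j * Y j x)) = char (distr M borel (\<lambda>x. \<Sum>j\<in>J. c j * Y j x)) 1"
    unfolding char_def by (simp add: integral_distr del: of_real_sum)
  also have "\<dots> = (\<Prod>j\<in>J. char (distr M borel (\<lambda>x. c j * Y j x)) 1)"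
    by (rule char_distr_sum[OF ind'])
  also have "\<dots> = (\<Prod>j\<in>J. complex_of_real (exp (- ((c j)\<^sup>2 * v j) / 2)))"
  proof (rule prod.cong[OF refl])
    fix j assume j: "j \<in> J"
    have [measurable]: "Y j \<in> borel_measurable M" by (rule Y[OF j])
    have "char (distr M borel (\<lambda>x. c j * Y j x)) 1 = char (distr M borel (Y j)) (c j)"
      unfolding char_def by (simp add: integral_distr)
    then show "char (distr M borel (\<lambda>x. c j * Y j x)) 1 = complex_of_real (exp (- ((c j)\<^sup>2 * v j) / 2))"
      using ch[OF j] by simp
  qed
  also have "\<dots> = complex_of_real (exp (- (\<Sum>j\<in>J. (c j)\<^sup>2 * v j) / 2))"
    using J by (simp add: exp_sum[symmetric] sum_negf sum_divide_distrib flip: of_real_prod)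
  also have "(\<Sum>j\<in>J. (c j)\<^sup>2 * v j) = (\<Sum>i\<in>J. \<Sum>j\<in>J. c i * c j * (if i = j then v j else 0))"
    using J by (intro sum.cong refl) (simp add: power2_eq_square if_distrib cong: if_cong)
  finally show "(CLINT x|M. iexp (\<Sum>j\<in>J. c j * Y j x)) =
    complex_of_real (exp (- (\<Sum>i\<in>J. \<Sum>j\<in>J. c i * c j * (if i = j then v j else 0)) / 2))" .
qed

section \<open>Mean-square convergence\<close>

text \<open>Replaces the Cauchy-Schwarz inequality: from \<open>2 |u v| \<le> e u\<^sup>2 + v\<^sup>2 / e\<close> one gets bounds of this
  shape, and letting first \<open>n\<close> grow and then \<open>e\<close> shrink gives convergence.\<close>

lemma LIMSEQ_trade_off:
  fixes x d :: "nat \<Rightarrow> real"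
  assumes d: "d \<longlonglongrightarrow> 0" and "0 \<le> A"
    and b: "\<And>e n. 0 < e \<Longrightarrow> \<bar>x n - l\<bar> \<le> e * A + B e * d n"
  shows "x \<longlonglongrightarrow> l"
proof (rule LIMSEQ_I)
  fix r :: real assume r: "0 < r"
  define e where "e = r / (2 * (A + 1))"
  have e: "0 < e" "e * A < r / 2" using r \<open>0 \<le> A\<close> by (auto simp: e_def field_simps)
  have "(\<lambda>n. B e * d n) \<longlonglongrightarrow> 0" using tendsto_mult_right_zero[OF d, of "B e"] by simp
  from LIMSEQ_D[OF this, of "r/2"] r obtain no where no: "\<And>n. no \<le> n \<Longrightarrow> \<bar>B e * d n\<bar> < r / 2" by auto
  show "\<exists>no. \<forall>n\<ge>no. norm (x n - l) < r"
  proof (intro exI allI impI)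
    fix n assume n: "no \<le> n"
    have "norm (x n - l) \<le> e * A + B e * d n" using b[OF e(1), of n] by simp
    also have "\<dots> < r" using no[OF n] e by linarith
    finally show "norm (x n - l) < r" .
  qed
qed

text \<open>Stated with the nonnegative integral, so that no integrability has to be known beforehand; it is
  deduced for large indices in \<open>L2_tendsto_integrable_diff\<close>.\<close>

definition L2_tendsto :: "'a measure \<Rightarrow> (nat \<Rightarrow> 'a \<Rightarrow> real) \<Rightarrow> ('a \<Rightarrow> real) \<Rightarrow> bool" where
  "L2_tendsto P a b \<longleftrightarrow> (\<forall>n. a n \<in> borel_measurable P) \<and> b \<in> borel_measurable P \<and>
     (\<lambda>n. \<integral>\<^sup>+x. ennreal ((a n x - b x)\<^sup>2) \<partial>P) \<longlonglongrightarrow> 0"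

lemma L2_tendsto_add:
  assumes "L2_tendsto P a b" "L2_tendsto P a' b'"
  shows "L2_tendsto P (\<lambda>n x. a n x + a' n x) (\<lambda>x. b x + b' x)"
proof -
  have m [measurable]: "\<And>n. a n \<in> borel_measurable P" "\<And>n. a' n \<in> borel_measurable P"
    "b \<in> borel_measurable P" "b' \<in> borel_measurable P"
    and l: "(\<lambda>n. \<integral>\<^sup>+x. ennreal ((a n x - b x)\<^sup>2) \<partial>P) \<longlonglongrightarrow> 0"
       "(\<lambda>n. \<integral>\<^sup>+x. ennreal ((a' n x - b' x)\<^sup>2) \<partial>P) \<longlonglongrightarrow> 0"
    using assms unfolding L2_tendsto_def by auto
  have le: "(\<integral>\<^sup>+x. ennreal ((a n x + a' n x - (b x + b' x))\<^sup>2) \<partial>P) \<le>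
     2 * (\<integral>\<^sup>+x. ennreal ((a n x - b x)\<^sup>2) \<partial>P) + 2 * (\<integral>\<^sup>+x. ennreal ((a' n x - b' x)\<^sup>2) \<partial>P)" for n
  proof -
    have p: "(u + v)\<^sup>2 \<le> 2 * u\<^sup>2 + 2 * v\<^sup>2" for u v :: real
      using sum_squares_bound[of u v] by (simp add: power2_sum)
    have "(\<integral>\<^sup>+x. ennreal ((a n x + a' n x - (b x + b' x))\<^sup>2) \<partial>P) \<le>
      (\<integral>\<^sup>+x. 2 * ennreal ((a n x - b x)\<^sup>2) + 2 * ennreal ((a' n x - b' x)\<^sup>2) \<partial>P)"
    proof (rule nn_integral_mono)
      fix x
      have "ennreal ((a n x + a' n x - (b x + b' x))\<^sup>2) \<le> ennreal (2 * (a n x - b x)\<^sup>2 + 2 * (a' n x - b' x)\<^sup>2)"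
        using p[of "a n x - b x" "a' n x - b' x"] by (intro ennreal_leI) (simp add: algebra_simps)
      also have "\<dots> = 2 * ennreal ((a n x - b x)\<^sup>2) + 2 * ennreal ((a' n x - b' x)\<^sup>2)"
        by (simp add: ennreal_plus ennreal_mult)
      finally show "ennreal ((a n x + a' n x - (b x + b' x))\<^sup>2) \<le> 2 * ennreal ((a n x - b x)\<^sup>2) + 2 * ennreal ((a' n x - b' x)\<^sup>2)" .
    qed
    also have "\<dots> = 2 * (\<integral>\<^sup>+x. ennreal ((a n x - b x)\<^sup>2) \<partial>P) + 2 * (\<integral>\<^sup>+x. ennreal ((a' n x - b' x)\<^sup>2) \<partial>P)"
      by (simp add: nn_integral_add nn_integral_cmult)
    finally show ?thesis .
  qed
  have up: "(\<lambda>n. 2 * (\<integral>\<^sup>+x. ennreal ((a n x - b x)\<^sup>2) \<partial>P) + 2 * (\<integral>\<^sup>+x. ennreal ((a' n x - b' x)\<^sup>2) \<partial>P)) \<longlonglongrightarrow> 2 * 0 + 2 * 0"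
    by (rule tendsto_add[OF ennreal_tendsto_cmult[OF _ l(1)] ennreal_tendsto_cmult[OF _ l(2)]]) simp_all
  have "(\<lambda>n. \<integral>\<^sup>+x. ennreal ((a n x + a' n x - (b x + b' x))\<^sup>2) \<partial>P) \<longlonglongrightarrow> 0"
    by (rule tendsto_sandwich[OF always_eventually always_eventually tendsto_const up[unfolded mult_zero_right add_0]])
       (simp, intro allI le)
  then show ?thesis unfolding L2_tendsto_def by auto
qed

lemma L2_tendsto_cmult:
  assumes "L2_tendsto P a b"
  shows "L2_tendsto P (\<lambda>n x. c * a n x) (\<lambda>x. c * b x)"
proof -
  have m [measurable]: "\<And>n. a n \<in> borel_measurable P" "b \<in> borel_measurable P"
    and l: "(\<lambda>n. \<integral>\<^sup>+x. ennreal ((a n x - b x)\<^sup>2) \<partial>P) \<longlonglongrightarrow> 0"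
    using assms unfolding L2_tendsto_def by auto
  have eq: "(\<integral>\<^sup>+x. ennreal ((c * a n x - c * b x)\<^sup>2) \<partial>P) = ennreal (c\<^sup>2) * (\<integral>\<^sup>+x. ennreal ((a n x - b x)\<^sup>2) \<partial>P)" for n
    by (subst nn_integral_cmult[symmetric])
       (auto simp: ennreal_mult[symmetric] power_mult_distrib[symmetric] algebra_simps)
  have "(\<lambda>n. ennreal (c\<^sup>2) * (\<integral>\<^sup>+x. ennreal ((a n x - b x)\<^sup>2) \<partial>P)) \<longlonglongrightarrow> ennreal (c\<^sup>2) * 0"
    by (rule ennreal_tendsto_cmult[OF _ l]) simp
  then show ?thesis unfolding L2_tendsto_def by (simp add: eq)
qed

lemma L2_tendsto_integrable_diff:
  assumes "L2_tendsto P a b"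
  obtains n0 where "\<And>n. integrable P (\<lambda>x. (a (n + n0) x - b x)\<^sup>2)"
    and "(\<lambda>n. LINT x|P. (a (n + n0) x - b x)\<^sup>2) \<longlonglongrightarrow> 0"
proof -
  have m [measurable]: "\<And>n. a n \<in> borel_measurable P" "b \<in> borel_measurable P"
    and l: "(\<lambda>n. \<integral>\<^sup>+x. ennreal ((a n x - b x)\<^sup>2) \<partial>P) \<longlonglongrightarrow> 0"
    using assms unfolding L2_tendsto_def by auto
  have "eventually (\<lambda>n. (\<integral>\<^sup>+x. ennreal ((a n x - b x)\<^sup>2) \<partial>P) < 1) sequentially"
    using order_tendstoD(2)[OF l, of 1] by simp
  then obtain n0 where n0: "\<And>n. n0 \<le> n \<Longrightarrow> (\<integral>\<^sup>+x. ennreal ((a n x - b x)\<^sup>2) \<partial>P) < 1"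
    unfolding eventually_sequentially by auto
  have i: "integrable P (\<lambda>x. (a (n + n0) x - b x)\<^sup>2)" for n
  proof (rule integrableI_bounded)
    show "(\<integral>\<^sup>+x. ennreal (norm ((a (n + n0) x - b x)\<^sup>2)) \<partial>P) < \<infinity>"
      using n0[of "n + n0"] by (auto intro: less_trans)
  qed simp
  have "(\<lambda>n. \<integral>\<^sup>+x. ennreal ((a (n + n0) x - b x)\<^sup>2) \<partial>P) \<longlonglongrightarrow> 0"
    using l by (rule LIMSEQ_ignore_initial_segment)
  moreover have "(\<integral>\<^sup>+x. ennreal ((a (n + n0) x - b x)\<^sup>2) \<partial>P) = ennreal (LINT x|P. (a (n + n0) x - b x)\<^sup>2)" for n
    by (rule nn_integral_eq_integral[OF i]) simp
  ultimately have "(\<lambda>n. ennreal (LINT x|P. (a (n + n0) x - b x)\<^sup>2)) \<longlonglongrightarrow> ennreal 0" by simp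
  then have "(\<lambda>n. LINT x|P. (a (n + n0) x - b x)\<^sup>2) \<longlonglongrightarrow> 0"
    by (subst (asm) tendsto_ennreal_iff) auto
  with i show ?thesis using that by blast
qed

lemma L2_tendsto_integral_square:
  assumes L: "L2_tendsto P a b" and i: "\<And>n. integrable P (\<lambda>x. (a n x)\<^sup>2)"
  shows "(\<lambda>n. LINT x|P. (a n x)\<^sup>2) \<longlonglongrightarrow> (LINT x|P. (b x)\<^sup>2)"
proof -
  have m [measurable]: "\<And>n. a n \<in> borel_measurable P" "b \<in> borel_measurable P"
    using L unfolding L2_tendsto_def by auto
  obtain n0 where d: "\<And>n. integrable P (\<lambda>x. (a (n + n0) x - b x)\<^sup>2)"
    and l: "(\<lambda>n. LINT x|P. (a (n + n0) x - b x)\<^sup>2) \<longlonglongrightarrow> 0"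
    using L2_tendsto_integrable_diff[OF L] by blast
  have ib: "integrable P (\<lambda>x. (b x)\<^sup>2)"
  proof (rule Bochner_Integration.integrable_bound)
    show "integrable P (\<lambda>x. 2 * (a (0 + n0) x)\<^sup>2 + 2 * (a (0 + n0) x - b x)\<^sup>2)"
      using d[of 0] i[of "0 + n0"] by (intro Bochner_Integration.integrable_add integrable_mult_right) auto
    have "norm ((v)\<^sup>2) \<le> norm (2 * u\<^sup>2 + 2 * (u - v)\<^sup>2)" for u v :: real
      using zero_le_power2[of "2 * u - v"] by (simp add: power2_eq_square algebra_simps)
    then show "AE x in P. norm ((b x)\<^sup>2) \<le> norm (2 * (a (0 + n0) x)\<^sup>2 + 2 * (a (0 + n0) x - b x)\<^sup>2)"
      by blast
  qed simp
  have "(\<lambda>n. LINT x|P. (a (n + n0) x)\<^sup>2) \<longlonglongrightarrow> (LINT x|P. (b x)\<^sup>2)"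
  proof (rule LIMSEQ_trade_off[OF l, where A="LINT x|P. (b x)\<^sup>2" and B="\<lambda>e. 1 + 1 / e"])
    fix e :: real and n assume e: "0 < e"
    let ?a = "a (n + n0)"
    have pt: "\<bar>u\<^sup>2 - v\<^sup>2\<bar> \<le> e * v\<^sup>2 + (1 + 1 / e) * (u - v)\<^sup>2" for u v :: real
    proof -
      have "0 \<le> (\<bar>v\<bar> * e - \<bar>u - v\<bar>)\<^sup>2 / e" using e by simp
      also have "\<dots> = e * v\<^sup>2 + (u - v)\<^sup>2 / e - 2 * (\<bar>v\<bar> * \<bar>u - v\<bar>)"
        using e by (simp add: power2_diff power_mult_distrib field_simps power2_eq_square)
      finally have 1: "2 * \<bar>v * (u - v)\<bar> \<le> e * v\<^sup>2 + (u - v)\<^sup>2 / e" by (simp add: abs_mult)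
      have "u\<^sup>2 - v\<^sup>2 = (u - v)\<^sup>2 + 2 * (v * (u - v))" by (simp add: power2_eq_square algebra_simps)
      then have "\<bar>u\<^sup>2 - v\<^sup>2\<bar> \<le> (u - v)\<^sup>2 + 2 * \<bar>v * (u - v)\<bar>"
        using abs_triangle_ineq[of "(u - v)\<^sup>2" "2 * (v * (u - v))"] by (simp add: abs_mult)
      with 1 show ?thesis by (simp add: algebra_simps)
    qed
    have "\<bar>(LINT x|P. (?a x)\<^sup>2) - (LINT x|P. (b x)\<^sup>2)\<bar> = \<bar>LINT x|P. (?a x)\<^sup>2 - (b x)\<^sup>2\<bar>"
      using i ib by simp
    also have "\<dots> \<le> (LINT x|P. \<bar>(?a x)\<^sup>2 - (b x)\<^sup>2\<bar>)" by (rule integral_abs_bound)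
    also have "\<dots> \<le> (LINT x|P. e * (b x)\<^sup>2 + (1 + 1 / e) * (?a x - b x)\<^sup>2)"
      by (rule integral_mono[OF integrable_abs[OF Bochner_Integration.integrable_diff[OF i ib]]
            Bochner_Integration.integrable_add[OF integrable_mult_right[OF ib] integrable_mult_right[OF d]] pt])
    also have "\<dots> = e * (LINT x|P. (b x)\<^sup>2) + (1 + 1 / e) * (LINT x|P. (?a x - b x)\<^sup>2)"
      using ib d by (subst Bochner_Integration.integral_add) auto
    finally show "\<bar>(LINT x|P. (?a x)\<^sup>2) - (LINT x|P. (b x)\<^sup>2)\<bar> \<le> e * (LINT x|P. (b x)\<^sup>2) + (1 + 1 / e) * (LINT x|P. (?a x - b x)\<^sup>2)" .
  qed simp
  then show ?thesis by (rule LIMSEQ_offset)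
qed

lemma L2_tendsto_char:
  assumes P: "prob_space P" and L: "L2_tendsto P a b"
  shows "(\<lambda>n. CLINT x|P. iexp (a n x)) \<longlonglongrightarrow> (CLINT x|P. iexp (b x))"
proof -
  interpret prob_space P by fact
  have m [measurable]: "\<And>n. a n \<in> borel_measurable P" "b \<in> borel_measurable P"
    using L unfolding L2_tendsto_def by auto
  obtain n0 where d: "\<And>n. integrable P (\<lambda>x. (a (n + n0) x - b x)\<^sup>2)"
    and l: "(\<lambda>n. LINT x|P. (a (n + n0) x - b x)\<^sup>2) \<longlonglongrightarrow> 0"
    using L2_tendsto_integrable_diff[OF L] by blast
  have "(\<lambda>n. norm ((CLINT x|P. iexp (a (n + n0) x)) - (CLINT x|P. iexp (b x)))) \<longlonglongrightarrow> 0"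
  proof (rule LIMSEQ_trade_off[OF l, where A=1 and B="\<lambda>e. 1 / e"])
    fix e :: real and n assume e: "0 < e"
    let ?a = "a (n + n0)"
    have ie: "integrable P (\<lambda>x. iexp (c x))" if [measurable]: "c \<in> borel_measurable P" for c
      by (rule integrable_const_bound[where B=1]) auto
    have pt: "norm (iexp u - iexp v) \<le> e + 1 / e * (u - v)\<^sup>2" for u v :: real
    proof -
      have "norm (iexp u - iexp v) = norm (iexp v * (iexp (u - v) - 1))"
        by (simp only: right_diff_distrib iexp_add[symmetric] mult_1_right) simp
      also have "\<dots> \<le> \<bar>u - v\<bar>"
        using iexp_approx1[of "u - v" 0] by (simp add: norm_mult)
      also have "\<dots> \<le> e + 1 / e * (u - v)\<^sup>2"
      proof -
        have "0 \<le> (e - \<bar>u - v\<bar>)\<^sup>2 / e" using e by simp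
        also have "\<dots> = e + 1 / e * (u - v)\<^sup>2 - 2 * \<bar>u - v\<bar>"
          using e by (simp add: power2_diff field_simps power2_eq_square)
        finally have "2 * \<bar>u - v\<bar> \<le> e + 1 / e * (u - v)\<^sup>2" by linarith
        then show ?thesis by (rule order_trans[rotated]) simp
      qed
      finally show ?thesis .
    qed
    have "norm ((CLINT x|P. iexp (?a x)) - (CLINT x|P. iexp (b x))) = norm (CLINT x|P. iexp (?a x) - iexp (b x))"
      using ie[of ?a] ie[of b] by simp
    also have "\<dots> \<le> (LINT x|P. norm (iexp (?a x) - iexp (b x)))" by (rule integral_norm_bound)
    also have "\<dots> \<le> (LINT x|P. e + 1 / e * (?a x - b x)\<^sup>2)"
      by (rule integral_mono[OF integrable_norm[OF Bochner_Integration.integrable_diff[OF ie ie]]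
            Bochner_Integration.integrable_add[OF _ integrable_mult_right[OF d]] pt]) simp_all
    also have "\<dots> = e * 1 + 1 / e * (LINT x|P. (?a x - b x)\<^sup>2)"
      using d by (subst Bochner_Integration.integral_add) (auto simp: prob_space)
    finally show "\<bar>norm ((CLINT x|P. iexp (?a x)) - (CLINT x|P. iexp (b x))) - 0\<bar> \<le> e * 1 + 1 / e * (LINT x|P. (?a x - b x)\<^sup>2)"
      by simp
  qed simp
  then have "(\<lambda>n. CLINT x|P. iexp (a (n + n0) x)) \<longlonglongrightarrow> (CLINT x|P. iexp (b x))"
    using LIM_zero_iff tendsto_norm_zero_iff by blast
  then show ?thesis by (rule LIMSEQ_offset)
qed

section \<open>The Wiener integral as a Gaussian process\<close>

text \<open>Sorting the times writes each \<open>W t\<close> as a sum of independent increments, namely those whose left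
  end point lies below \<open>t\<close>. The covariance of \<open>W s\<close> and \<open>W t\<close> is then the total length of the
  increments common to both.\<close>

lemma wiener_gaussian:
  assumes M: "prob_space M" and W: "wiener_process01 M W" and T: "finite T" "T \<subseteq> {0..1}"
  shows "gaussian_family M T W (\<lambda>s t. min s t)"
proof -
  interpret prob_space M by fact
  define xs where "xs = sorted_list_of_set (insert 0 T)"
  define n where "n = length xs - 1"
  define p where "p i = xs ! i" for i
  have xs: "set xs = insert 0 T" "sorted_wrt (<) xs"
    unfolding xs_def using T(1) by (simp_all only: set_sorted_list_of_set finite_insert strict_sorted_list_of_set)
  have len: "length xs = Suc n" using xs(1) unfolding n_def by (cases xs) auto
  have mem: "p i \<in> {0..1}" if "i \<le> n" for i
    using nth_mem[of i xs] xs(1) T that len by (auto simp: p_def)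
  have ex: "\<exists>k\<le>n. t = p k" if "t \<in> insert 0 T" for t
    using that xs(1) len by (metis in_set_conv_nth less_Suc_eq_le p_def)
  have mono: "p i < p k" if "i < k" "k \<le> n" for i k
    using sorted_wrt_nth_less[OF xs(2) that(1)] that len by (simp add: p_def)
  have less: "p i < p k \<longleftrightarrow> i < k" if "i \<le> n" "k \<le> n" for i k
    using mono[of i k] mono[of k i] that by (cases i k rule: linorder_cases) auto
  have p0: "p 0 = 0"
  proof -
    obtain k where k: "k \<le> n" "0 = p k" using ex[of 0] by auto
    then have "\<not> 0 < k" using mono[of 0 k] mem[of 0] by auto
    then show ?thesis using k by simp
  qed
  define A :: "real \<Rightarrow> nat \<Rightarrow> real" where "A t i = (if p i < t then 1 else 0)" for t i
  have tele: "(\<Sum>i<n. A t i * (F (p (Suc i)) - F (p i))) = F t - F 0" if t: "t \<in> insert 0 T" for t and F :: "real \<Rightarrow> real"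
  proof -
    obtain k where k: "k \<le> n" "t = p k" using ex[OF t] by auto
    have "(\<Sum>i<n. A t i * (F (p (Suc i)) - F (p i))) = (\<Sum>i<n. if i < k then F (p (Suc i)) - F (p i) else 0)"
      using k less by (intro sum.cong) (auto simp: A_def)
    also have "\<dots> = (\<Sum>i\<in>{i\<in>{..<n}. i < k}. F (p (Suc i)) - F (p i))" by (rule sum.inter_filter[symmetric]) simp
    also have "{i\<in>{..<n}. i < k} = {..<k}" using k by auto
    also have "(\<Sum>i<k. F (p (Suc i)) - F (p i)) = F t - F 0"
      using k p0 sum_lessThan_telescope[of "\<lambda>i. F (p i)" k] by simp
    finally show ?thesis .
  qed
  let ?D = "\<lambda>i \<omega>. W (p (Suc i)) \<omega> - W (p i) \<omega>"
  have ind: "indep_vars (\<lambda>_. borel) ?D {..<n}"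
  proof -
    have "0 \<le> p 0 \<and> (\<forall>i<n. p i \<le> p (Suc i)) \<and> p n \<le> 1"
      using p0 mem[of n] by (auto intro!: less_imp_le[OF mono])
    then show ?thesis using W unfolding wiener_process01_def by blast
  qed
  have ch: "char (distr M borel (?D i)) u = complex_of_real (exp (- (u\<^sup>2 * (p (Suc i) - p i)) / 2))"
    if "i \<in> {..<n}" for i u
  proof -
    have lt: "0 \<le> p i" "p i < p (Suc i)" "p (Suc i) \<le> 1"
      using that mem[of i] mem[of "Suc i"] mono[of i "Suc i"] by auto
    then have "distributed M lborel (?D i) (normal_density 0 (sqrt (p (Suc i) - p i)))"
      using W unfolding wiener_process01_def by blast
    from char_normal[OF M this] show ?thesis using lt by simp
  qed
  have G: "gaussian_family M {..<n} ?D (\<lambda>i j. if i = j then p (Suc j) - p j else 0)"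
    by (rule gaussian_family_indep[OF M _ ind, where v="\<lambda>i. p (Suc i) - p i"]) (simp, rule ch)
  have G': "gaussian_family M T (\<lambda>t \<omega>. \<Sum>i<n. A t i * ?D i \<omega>)
       (\<lambda>s t. \<Sum>i<n. \<Sum>j<n. A s i * A t j * (if i = j then p (Suc j) - p j else 0))"
    by (rule gaussian_family_linear[OF G]) (use T in auto)
  have cov: "(\<Sum>i<n. \<Sum>j<n. A s i * A t j * (if i = j then p (Suc j) - p j else 0)) = min s t"
    if "s \<in> T" "t \<in> T" for s t
  proof -
    have "(\<Sum>i<n. \<Sum>j<n. A s i * A t j * (if i = j then p (Suc j) - p j else 0)) =
        (\<Sum>i<n. \<Sum>j<n. if i = j then A s i * A t i * (p (Suc i) - p i) else 0)"
      by (intro sum.cong refl) auto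
    also have "\<dots> = (\<Sum>i<n. A (min s t) i * (p (Suc i) - p i))"
      by (intro sum.cong refl) (simp add: A_def)
    also have "\<dots> = min s t" using tele[of "min s t" "\<lambda>x. x"] that by (auto simp: min_def)
    finally show ?thesis .
  qed
  show ?thesis
  proof (rule gaussian_family_AE_cong[OF gaussian_family_cov_cong[OF G' cov] T(1)])
    fix t assume t: "t \<in> T"
    then show "W t \<in> borel_measurable M" using W T unfolding wiener_process01_def by auto
    have "AE \<omega> in M. W 0 \<omega> = 0" using W unfolding wiener_process01_def by auto
    then show "AE \<omega> in M. (\<Sum>i<n. A t i * ?D i \<omega>) = W t \<omega>"
    proof eventually_elim
      fix \<omega> assume "W 0 \<omega> = 0"
      then show "(\<Sum>i<n. A t i * ?D i \<omega>) = W t \<omega>" using tele[of t "\<lambda>s. W s \<omega>"] t by simp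
    qed
  qed
qed

text \<open>Finite linear combinations of values of \<open>W\<close>, paired with their integrands. The integrand of \<open>W s\<close>
  is the indicator of \<open>(0, s]\<close>, and the isometry reads \<open>min s t = \<integral> 1\<^sub>(\<^sub>0\<^sub>,\<^sub>s\<^sub>] 1\<^sub>(\<^sub>0\<^sub>,\<^sub>t\<^sub>]\<close>.\<close>

definition wiener_simple :: "(real \<Rightarrow> 'a \<Rightarrow> real) \<Rightarrow> ('a \<Rightarrow> real) \<Rightarrow> (real \<Rightarrow> real) \<Rightarrow> bool" where
  "wiener_simple W Z \<phi> \<longleftrightarrow> (\<exists>T a. finite T \<and> T \<subseteq> {0..1} \<and>
     Z = (\<lambda>\<omega>. \<Sum>s\<in>T. a s * W s \<omega>) \<and> \<phi> = (\<lambda>u. \<Sum>s\<in>T. a s * indicator {0<..s} u))"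

lemma wiener_simple_zero: "wiener_simple W (\<lambda>_. 0) (\<lambda>_. 0)"
  unfolding wiener_simple_def by (rule exI[of _ "{}"]) auto

lemma wiener_simple_single: "s \<in> {0..1} \<Longrightarrow> wiener_simple W (W s) (indicator {0<..s})"
  unfolding wiener_simple_def by (intro exI[of _ "{s}"] exI[of _ "\<lambda>_. 1"]) auto

lemma wiener_simple_cmult:
  assumes "wiener_simple W Z \<phi>" shows "wiener_simple W (\<lambda>\<omega>. c * Z \<omega>) (\<lambda>u. c * \<phi> u)"
proof -
  obtain T a where T: "finite T" "T \<subseteq> {0..1}" and Z: "Z = (\<lambda>\<omega>. \<Sum>s\<in>T. a s * W s \<omega>)"
    and \<phi>: "\<phi> = (\<lambda>u. \<Sum>s\<in>T. a s * indicator {0<..s} u)" using assms unfolding wiener_simple_def by auto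
  show ?thesis unfolding wiener_simple_def Z \<phi> sum_distrib_left mult.assoc[symmetric]
    by (intro exI[of _ T] exI[of _ "\<lambda>s. c * a s"] conjI T refl)
qed

lemma wiener_simple_add:
  assumes "wiener_simple W Z \<phi>" "wiener_simple W Z' \<phi>'"
  shows "wiener_simple W (\<lambda>\<omega>. Z \<omega> + Z' \<omega>) (\<lambda>u. \<phi> u + \<phi>' u)"
proof -
  obtain T a where T: "finite T" "T \<subseteq> {0..1}" "Z = (\<lambda>\<omega>. \<Sum>s\<in>T. a s * W s \<omega>)"
    "\<phi> = (\<lambda>u. \<Sum>s\<in>T. a s * indicator {0<..s} u)" using assms(1) unfolding wiener_simple_def by auto
  obtain T' a' where T': "finite T'" "T' \<subseteq> {0..1}" "Z' = (\<lambda>\<omega>. \<Sum>s\<in>T'. a' s * W s \<omega>)"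
    "\<phi>' = (\<lambda>u. \<Sum>s\<in>T'. a' s * indicator {0<..s} u)" using assms(2) unfolding wiener_simple_def by auto
  define b where "b s = (if s \<in> T then a s else 0) + (if s \<in> T' then a' s else 0)" for s
  have "(\<Sum>s\<in>T \<union> T'. b s * F s) = (\<Sum>s\<in>T. a s * F s) + (\<Sum>s\<in>T'. a' s * F s)" for F :: "real \<Rightarrow> real"
  proof -
    have "(\<Sum>s\<in>T. a s * F s) = (\<Sum>s\<in>T \<union> T'. (if s \<in> T then a s else 0) * F s)"
      using T T' by (intro sum.mono_neutral_cong_left) auto
    moreover have "(\<Sum>s\<in>T'. a' s * F s) = (\<Sum>s\<in>T \<union> T'. (if s \<in> T' then a' s else 0) * F s)"
      using T T' by (intro sum.mono_neutral_cong_left) auto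
    ultimately show ?thesis by (simp add: b_def ring_distribs sum.distrib)
  qed
  then show ?thesis unfolding wiener_simple_def
    using T T' by (intro exI[of _ "T \<union> T'"] exI[of _ b]) auto
qed

lemma wiener_simple_sum:
  assumes "finite J" "\<And>j. j \<in> J \<Longrightarrow> wiener_simple W (Z j) (\<phi> j)"
  shows "wiener_simple W (\<lambda>\<omega>. \<Sum>j\<in>J. Z j \<omega>) (\<lambda>u. \<Sum>j\<in>J. \<phi> j u)"
  using assms by (induction J rule: finite_induct) (auto intro: wiener_simple_zero wiener_simple_add)

lemma wiener_simple_isometry:
  assumes M: "prob_space M" and W: "wiener_process01 M W" and S: "wiener_simple W Z \<phi>"
  shows "Z \<in> borel_measurable M" "\<phi> \<in> borel_measurable lborel" "integrable lborel (\<lambda>u. (\<phi> u)\<^sup>2)"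
    "(CLINT x|M. iexp (Z x)) = complex_of_real (exp (- (LINT u|lborel. (\<phi> u)\<^sup>2) / 2))"
proof -
  obtain T a where T: "finite T" "T \<subseteq> {0..1}" and Z: "Z = (\<lambda>\<omega>. \<Sum>s\<in>T. a s * W s \<omega>)"
    and \<phi>: "\<phi> = (\<lambda>u. \<Sum>s\<in>T. a s * indicator {0<..s} u)" using S unfolding wiener_simple_def by auto
  note G = wiener_gaussian[OF M W T]
  show "Z \<in> borel_measurable M" unfolding Z using gaussian_familyD(1)[OF G] by auto
  show "\<phi> \<in> borel_measurable lborel" unfolding \<phi> by auto
  have sq: "(\<phi> u)\<^sup>2 = (\<Sum>s\<in>T. \<Sum>t\<in>T. a s * a t * indicator {0<..min s t} u)" for u
    unfolding \<phi> power2_eq_square sum_product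
    by (intro sum.cong refl) (auto simp: indicator_def)
  have ii: "integrable lborel (indicator {0<..m} :: real \<Rightarrow> real)" for m
    by (rule integrable_real_indicator) (cases "0 \<le> m"; simp)+
  show "integrable lborel (\<lambda>u. (\<phi> u)\<^sup>2)"
    unfolding sq by (intro Bochner_Integration.integrable_sum integrable_mult_right ii)
  have "(LINT u|lborel. (\<phi> u)\<^sup>2) = (\<Sum>s\<in>T. \<Sum>t\<in>T. a s * a t * (LINT u|lborel. indicator {0<..min s t} u))"
  proof -
    have "(LINT u|lborel. (\<phi> u)\<^sup>2) = (\<Sum>s\<in>T. LINT u|lborel. (\<Sum>t\<in>T. a s * a t * indicator {0<..min s t} u))"
      unfolding sq by (rule Bochner_Integration.integral_sum) (intro Bochner_Integration.integrable_sum integrable_mult_right ii)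
    also have "\<dots> = (\<Sum>s\<in>T. \<Sum>t\<in>T. LINT u|lborel. a s * a t * indicator {0<..min s t} u)"
      by (intro sum.cong refl Bochner_Integration.integral_sum integrable_mult_right ii)
    finally show ?thesis by (simp only: Bochner_Integration.integral_mult_right_zero)
  qed
  also have "\<dots> = (\<Sum>s\<in>T. \<Sum>t\<in>T. a s * a t * min s t)"
    using T by (intro sum.cong refl) (auto simp: min_def subset_eq)
  finally show "(CLINT x|M. iexp (Z x)) = complex_of_real (exp (- (LINT u|lborel. (\<phi> u)\<^sup>2) / 2))"
    unfolding Z using gaussian_familyD(2)[OF G, of a] by simp
qed

text \<open>The closure of the graph of the elementary integral in \<open>L\<^sup>2 \<times> L\<^sup>2\<close>. It is a
  linear space that contains the integrals over \<open>[0, t]\<close> for all \<open>t\<close> at once, so it contains the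
  linear combinations that determine joint laws at several times.\<close>

definition wiener_pair :: "'a measure \<Rightarrow> (real \<Rightarrow> 'a \<Rightarrow> real) \<Rightarrow> ('a \<Rightarrow> real) \<Rightarrow> (real \<Rightarrow> real) \<Rightarrow> bool" where
  "wiener_pair M W Z \<phi> \<longleftrightarrow> (\<exists>Zs \<phi>s. (\<forall>n::nat. wiener_simple W (Zs n) (\<phi>s n)) \<and>
     L2_tendsto M Zs Z \<and> L2_tendsto lborel \<phi>s \<phi>)"

lemma wiener_pair_cmult:
  assumes "wiener_pair M W Z \<phi>" shows "wiener_pair M W (\<lambda>\<omega>. c * Z \<omega>) (\<lambda>u. c * \<phi> u)"
proof -
  obtain Zs \<phi>s where "\<And>n::nat. wiener_simple W (Zs n) (\<phi>s n)" "L2_tendsto M Zs Z" "L2_tendsto lborel \<phi>s \<phi>"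
    using assms unfolding wiener_pair_def by blast
  then show ?thesis unfolding wiener_pair_def
    by (intro exI[of _ "\<lambda>n \<omega>. c * Zs n \<omega>"] exI[of _ "\<lambda>n u. c * \<phi>s n u"])
       (auto intro: wiener_simple_cmult L2_tendsto_cmult)
qed

lemma wiener_pair_add:
  assumes "wiener_pair M W Z \<phi>" "wiener_pair M W Z' \<phi>'"
  shows "wiener_pair M W (\<lambda>\<omega>. Z \<omega> + Z' \<omega>) (\<lambda>u. \<phi> u + \<phi>' u)"
proof -
  obtain Zs \<phi>s where 1: "\<And>n::nat. wiener_simple W (Zs n) (\<phi>s n)" "L2_tendsto M Zs Z" "L2_tendsto lborel \<phi>s \<phi>"
    using assms(1) unfolding wiener_pair_def by blast
  obtain Zs' \<phi>s' where 2: "\<And>n::nat. wiener_simple W (Zs' n) (\<phi>s' n)" "L2_tendsto M Zs' Z'" "L2_tendsto lborel \<phi>s' \<phi>'"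
    using assms(2) unfolding wiener_pair_def by blast
  show ?thesis unfolding wiener_pair_def
    by (intro exI[of _ "\<lambda>n \<omega>. Zs n \<omega> + Zs' n \<omega>"] exI[of _ "\<lambda>n u. \<phi>s n u + \<phi>s' n u"])
       (use 1 2 in \<open>auto intro: wiener_simple_add L2_tendsto_add\<close>)
qed

lemma wiener_pair_sum:
  assumes "finite J" "\<And>j. j \<in> J \<Longrightarrow> wiener_pair M W (Z j) (\<phi> j)"
  shows "wiener_pair M W (\<lambda>\<omega>. \<Sum>j\<in>J. Z j \<omega>) (\<lambda>u. \<Sum>j\<in>J. \<phi> j u)"
  using assms
proof (induction J rule: finite_induct)
  case empty
  show ?case unfolding wiener_pair_def
    by (rule exI[of _ "\<lambda>_ _. 0"], rule exI[of _ "\<lambda>_ _. 0"]) (auto simp: L2_tendsto_def intro: wiener_simple_zero)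
qed (auto intro: wiener_pair_add)

text \<open>Both sides of the identity in \<open>wiener_simple_isometry\<close> are continuous under mean-square
  convergence.\<close>

lemma wiener_pair_char:
  assumes M: "prob_space M" and W: "wiener_process01 M W" and P: "wiener_pair M W Z \<phi>"
  shows "(CLINT x|M. iexp (Z x)) = complex_of_real (exp (- (LINT u|lborel. (\<phi> u)\<^sup>2) / 2))"
proof -
  obtain Zs \<phi>s where 1: "\<And>n::nat. wiener_simple W (Zs n) (\<phi>s n)" "L2_tendsto M Zs Z" "L2_tendsto lborel \<phi>s \<phi>"
    using P unfolding wiener_pair_def by blast
  have "(\<lambda>n. LINT u|lborel. (\<phi>s n u)\<^sup>2) \<longlonglongrightarrow> (LINT u|lborel. (\<phi> u)\<^sup>2)"
    by (rule L2_tendsto_integral_square[OF 1(3) wiener_simple_isometry(3)[OF M W 1(1)]])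
  then have "(\<lambda>n. complex_of_real (exp (- (LINT u|lborel. (\<phi>s n u)\<^sup>2) / 2))) \<longlonglongrightarrow>
     complex_of_real (exp (- (LINT u|lborel. (\<phi> u)\<^sup>2) / 2))"
    by (intro tendsto_intros) auto
  then have "(\<lambda>n. CLINT x|M. iexp (Zs n x)) \<longlonglongrightarrow> complex_of_real (exp (- (LINT u|lborel. (\<phi> u)\<^sup>2) / 2))"
    by (simp only: wiener_simple_isometry(4)[OF M W 1(1)])
  with L2_tendsto_char[OF M 1(2)] show ?thesis by (rule LIMSEQ_unique)
qed

lemma wiener_simple_step:
  assumes "is_partition t n p" "t \<le> 1"
  shows "wiener_simple W (step_integral W n p c) (step_fun n p c)"
proof -
  have p: "p 0 = 0" "p n = t" "\<And>i. i < n \<Longrightarrow> p i \<le> p (Suc i)" using assms unfolding is_partition_def by auto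
  have mono: "p i \<le> p j" if "i \<le> j" "j \<le> n" for i j
    using that(1,2)
  proof (induction j rule: dec_induct)
    case (step k)
    then show ?case using p(3)[of k] by simp
  qed simp
  have mem: "p i \<in> {0..1}" if "i \<le> n" for i using mono[of 0 i] mono[of i n] that p(1,2) assms(2) by auto
  have "wiener_simple W (\<lambda>\<omega>. \<Sum>i<n. c i * (W (p (Suc i)) \<omega> + (-1) * W (p i) \<omega>))
     (\<lambda>u. \<Sum>i<n. c i * (indicator {0<..p (Suc i)} u + (-1) * indicator {0<..p i} u))"
    by (intro wiener_simple_sum wiener_simple_cmult wiener_simple_add wiener_simple_single)
       (simp_all add: mem del: atLeastAtMost_iff)
  moreover have "(\<Sum>i<n. c i * (indicator {0<..p (Suc i)} u + (-1) * indicator {0<..p i} u)) = step_fun n p c u" for u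
    unfolding step_fun_def
  proof (intro sum.cong refl)
    fix i assume "i \<in> {..<n}"
    then have "0 \<le> p i" "p i \<le> p (Suc i)" using mem[of i] p(3)[of i] by auto
    then show "c i * (indicator {0<..p (Suc i)} u + (-1) * indicator {0<..p i} u) = c i * indicator {p i<..p (Suc i)} u"
      by (auto simp: indicator_def)
  qed
  ultimately show ?thesis by (simp add: step_integral_def[abs_def])
qed

text \<open>A step function over \<open>[0, t]\<close> vanishes outside \<open>(0, t]\<close>, so its distance to \<open>f\<close> on \<open>[0, t]\<close> bounds its
  distance to the truncation of \<open>f\<close> on the whole line.\<close>

lemma wiener_pair_integral:
  assumes M: "prob_space M" and W: "wiener_process01 M W" and f: "continuous_on {0..1} f"
    and t: "t \<in> {0..1}" and I: "is_wiener_integral M W f t I"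
  shows "wiener_pair M W I (\<lambda>u. f u * indicator {0<..t} u)"
proof -
  have "\<exists>(n :: nat \<Rightarrow> nat) p c. (\<forall>j. is_partition t (n j) (p j)) \<and>
      (\<lambda>j. \<integral>\<^sup>+u\<in>{0..t}. ennreal ((step_fun (n j) (p j) (c j) u - f u)\<^sup>2) \<partial>lborel) \<longlonglongrightarrow> 0 \<and>
      (\<lambda>j. \<integral>\<^sup>+\<omega>. ennreal ((step_integral W (n j) (p j) (c j) \<omega> - I \<omega>)\<^sup>2) \<partial>M) \<longlonglongrightarrow> 0"
    using I unfolding is_wiener_integral_def by (rule conjunct2)
  then obtain n :: "nat \<Rightarrow> nat" and p c where "\<forall>j. is_partition t (n j) (p j)"
    and l1: "(\<lambda>j. \<integral>\<^sup>+u\<in>{0..t}. ennreal ((step_fun (n j) (p j) (c j) u - f u)\<^sup>2) \<partial>lborel) \<longlonglongrightarrow> 0"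
    and l2: "(\<lambda>j. \<integral>\<^sup>+\<omega>. ennreal ((step_integral W (n j) (p j) (c j) \<omega> - I \<omega>)\<^sup>2) \<partial>M) \<longlonglongrightarrow> 0"
    by (elim exE conjE) (rule that)
  then have part: "is_partition t (n j) (p j)" for j by simp
  have Im: "I \<in> borel_measurable M"
    using I unfolding is_wiener_integral_def by (rule conjunct1)
  have S: "wiener_simple W (step_integral W (n j) (p j) (c j)) (step_fun (n j) (p j) (c j))" for j
    using wiener_simple_step[OF part] t by auto
  have fm: "(\<lambda>u. f u * indicator {0<..t} u) \<in> borel_measurable lborel"
  proof -
    have "continuous_on {0<..t} f" by (rule continuous_on_subset[OF f]) (use t in auto)
    then have "(\<lambda>u. indicator {0<..t} u *\<^sub>R f u) \<in> borel_measurable borel"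
      by (rule borel_measurable_continuous_on_indicator[rotated]) simp
    then show ?thesis by (simp add: mult.commute)
  qed
  have zero: "step_fun (n j) (p j) (c j) u = 0" if "u \<notin> {0<..t}" for j u
  proof -
    have q: "p j 0 = 0" "p j (n j) = t" "\<And>i. i < n j \<Longrightarrow> p j i \<le> p j (Suc i)" using part[of j] unfolding is_partition_def by auto
    have mono: "p j i \<le> p j k" if "i \<le> k" "k \<le> n j" for i k
      using that(1,2)
    proof (induction k rule: dec_induct)
      case (step k)
      then show ?case using q(3)[of k] by simp
    qed simp
    show ?thesis unfolding step_fun_def
    proof (rule sum.neutral, intro ballI)
      fix i assume "i \<in> {..<n j}"
      then have "0 \<le> p j i" "p j (Suc i) \<le> t" using mono[of 0 i] mono[of "Suc i" "n j"] q(1,2) by auto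
      then show "c j i * indicator {p j i<..p j (Suc i)} u = 0" using that by (auto simp: indicator_def)
    qed
  qed
  have le: "(\<integral>\<^sup>+u. ennreal ((step_fun (n j) (p j) (c j) u - f u * indicator {0<..t} u)\<^sup>2) \<partial>lborel) \<le>
     (\<integral>\<^sup>+u\<in>{0..t}. ennreal ((step_fun (n j) (p j) (c j) u - f u)\<^sup>2) \<partial>lborel)" for j
  proof (rule nn_integral_mono)
    fix u
    show "ennreal ((step_fun (n j) (p j) (c j) u - f u * indicator {0<..t} u)\<^sup>2) \<le>
      ennreal ((step_fun (n j) (p j) (c j) u - f u)\<^sup>2) * indicator {0..t} u"
      using zero[of u j] by (cases "u \<in> {0<..t}") auto
  qed
  have "L2_tendsto lborel (\<lambda>j. step_fun (n j) (p j) (c j)) (\<lambda>u. f u * indicator {0<..t} u)"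
    unfolding L2_tendsto_def
  proof (intro conjI allI)
    show "step_fun (n j) (p j) (c j) \<in> borel_measurable lborel" for j
      by (rule wiener_simple_isometry(2)[OF M W S])
    show "(\<lambda>j. \<integral>\<^sup>+u. ennreal ((step_fun (n j) (p j) (c j) u - f u * indicator {0<..t} u)\<^sup>2) \<partial>lborel) \<longlonglongrightarrow> 0"
      by (rule tendsto_sandwich[OF always_eventually always_eventually tendsto_const l1]) (simp, intro allI le)
  qed (rule fm)
  moreover have "L2_tendsto M (\<lambda>j. step_integral W (n j) (p j) (c j)) I"
    unfolding L2_tendsto_def using wiener_simple_isometry(1)[OF M W S] Im l2 by auto
  ultimately show ?thesis unfolding wiener_pair_def using S
    by (intro exI[of _ "\<lambda>j. step_integral W (n j) (p j) (c j)"] exI[of _ "\<lambda>j. step_fun (n j) (p j) (c j)"]) simp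
qed

lemma energy_eq:
  assumes f: "continuous_on {0..1} f" and t: "t \<in> {0..1}"
  shows "integrable lborel (\<lambda>u. (f u)\<^sup>2 * indicator {0<..t} u)"
    and "(LINT u|lborel. (f u)\<^sup>2 * indicator {0<..t} u) = energy f t"
proof -
  have c: "continuous_on {0..t} (\<lambda>u. (f u)\<^sup>2)"
    by (intro continuous_intros continuous_on_subset[OF f]) (use t in auto)
  have i: "set_integrable lborel {0..t} (\<lambda>u. (f u)\<^sup>2)" by (rule borel_integrable_atLeastAtMost'[OF c])
  have eq: "(f u)\<^sup>2 * indicator {0<..t} u = indicator {0<..t} u *\<^sub>R (f u)\<^sup>2" for u by simp
  have i': "set_integrable lborel {0<..t} (\<lambda>u. (f u)\<^sup>2)" by (rule set_integrable_subset[OF i]) auto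
  then show ii: "integrable lborel (\<lambda>u. (f u)\<^sup>2 * indicator {0<..t} u)"
    unfolding set_integrable_def eq .
  have "(LINT u|lborel. (f u)\<^sup>2 * indicator {0<..t} u) = (LINT u:{0..t}|lborel. (f u)\<^sup>2)"
    unfolding set_lebesgue_integral_def
  proof (rule integral_cong_AE)
    show "AE u in lborel. (f u)\<^sup>2 * indicator {0<..t} u = indicator {0..t} u *\<^sub>R (f u)\<^sup>2"
      using AE_lborel_singleton[of 0] by eventually_elim (auto simp: indicator_def)
  qed (use ii i in \<open>auto simp: set_integrable_def\<close>)
  also have "\<dots> = energy f t" unfolding energy_def by (rule set_borel_integral_eq_integral(2)[OF i])
  finally show "(LINT u|lborel. (f u)\<^sup>2 * indicator {0<..t} u) = energy f t" .
qed

lemma wiener_integral_gaussian: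
  assumes M: "prob_space M" and W: "wiener_process01 M W" and f: "continuous_on {0..1} f"
    and T: "finite T" "T \<subseteq> {0..1}" and I: "\<And>t. t \<in> T \<Longrightarrow> is_wiener_integral M W f t (I t)"
  shows "gaussian_family M T I (\<lambda>s t. energy f (min s t))"
  unfolding gaussian_family_def
proof (intro conjI ballI allI)
  show "I t \<in> borel_measurable M" if "t \<in> T" for t using I[OF that] unfolding is_wiener_integral_def by blast
  fix c :: "real \<Rightarrow> real"
  let ?\<phi> = "\<lambda>u. \<Sum>t\<in>T. c t * (f u * indicator {0<..t} u)"
  have "wiener_pair M W (\<lambda>\<omega>. \<Sum>t\<in>T. c t * I t \<omega>) ?\<phi>"
    by (intro wiener_pair_sum T wiener_pair_cmult wiener_pair_integral[OF M W f] I) (use T in auto)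
  from wiener_pair_char[OF M W this]
  have 1: "(CLINT x|M. iexp (\<Sum>t\<in>T. c t * I t x)) = complex_of_real (exp (- (LINT u|lborel. (?\<phi> u)\<^sup>2) / 2))" .
  have sq: "(?\<phi> u)\<^sup>2 = (\<Sum>s\<in>T. \<Sum>t\<in>T. c s * c t * ((f u)\<^sup>2 * indicator {0<..min s t} u))" for u
    unfolding power2_eq_square sum_product
    by (intro sum.cong refl) (auto simp: indicator_def)
  have mem: "min s t \<in> {0..1}" if "s \<in> T" "t \<in> T" for s t using that T by (auto simp: min_def)
  have "(LINT u|lborel. (?\<phi> u)\<^sup>2) = (\<Sum>s\<in>T. LINT u|lborel. (\<Sum>t\<in>T. c s * c t * ((f u)\<^sup>2 * indicator {0<..min s t} u)))"
    unfolding sq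
    by (rule Bochner_Integration.integral_sum)
       (intro Bochner_Integration.integrable_sum integrable_mult_right energy_eq(1)[OF f] mem)
  also have "\<dots> = (\<Sum>s\<in>T. \<Sum>t\<in>T. c s * c t * energy f (min s t))"
  proof (intro sum.cong refl)
    fix s assume s: "s \<in> T"
    have "(LINT u|lborel. (\<Sum>t\<in>T. c s * c t * ((f u)\<^sup>2 * indicator {0<..min s t} u)))
       = (\<Sum>t\<in>T. LINT u|lborel. c s * c t * ((f u)\<^sup>2 * indicator {0<..min s t} u))"
      by (intro Bochner_Integration.integral_sum integrable_mult_right energy_eq(1)[OF f] mem s)
    also have "\<dots> = (\<Sum>t\<in>T. c s * c t * energy f (min s t))"
      by (intro sum.cong refl) (simp only: Bochner_Integration.integral_mult_right_zero energy_eq(2)[OF f mem[OF s]])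
    finally show "(LINT u|lborel. (\<Sum>t\<in>T. c s * c t * ((f u)\<^sup>2 * indicator {0<..min s t} u))) =
        (\<Sum>t\<in>T. c s * c t * energy f (min s t))" .
  qed
  finally show "(CLINT x|M. iexp (\<Sum>t\<in>T. c t * I t x)) =
      complex_of_real (exp (- (\<Sum>s\<in>T. \<Sum>t\<in>T. c s * c t * energy f (min s t)) / 2))"
    using 1 by simp
qed

section \<open>The covariance kernel of the dyadic expansion\<close>

text \<open>The clock \<open>h = energy f\<close>: continuity of \<open>f\<close> gives the Lipschitz bound, and its not vanishing gives
  strict monotonicity. Only these properties of \<open>f\<close> enter the deterministic part.\<close>

locale time_change =
  fixes h :: "real \<Rightarrow> real" and C :: real
  assumes h_zero: "h 0 = 0"
    and h_less: "\<And>s t. 0 \<le> s \<Longrightarrow> s < t \<Longrightarrow> t \<le> 1 \<Longrightarrow> h s < h t"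
    and h_lipschitz: "\<And>s t. 0 \<le> s \<Longrightarrow> s \<le> t \<Longrightarrow> t \<le> 1 \<Longrightarrow> h t - h s \<le> C * (t - s)"
begin

lemma h_le: "0 \<le> s \<Longrightarrow> s \<le> t \<Longrightarrow> t \<le> 1 \<Longrightarrow> h s \<le> h t"
  using h_less[of s t] by (cases "s = t") auto

lemma C_nonneg: "0 \<le> C"
  using h_lipschitz[of 0 1] h_less[of 0 1] by simp

lemma h1_pos: "0 < h 1"
  using h_less[of 0 1] h_zero by simp

lemma h_continuous: "continuous_on {0..1} h"
proof -
  have "C-lipschitz_on {0..1} h"
  proof (rule lipschitz_onI)
    fix x y :: real assume "x \<in> {0..1}" "y \<in> {0..1}"
    then show "dist (h x) (h y) \<le> C * dist x y"
      using h_lipschitz[of x y] h_lipschitz[of y x] h_le[of x y] h_le[of y x] by (cases "x \<le> y") (auto simp: dist_real_def abs_if)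
  qed (rule C_nonneg)
  then show ?thesis by (rule lipschitz_on_continuous_on)
qed

definition rise :: "nat \<Rightarrow> nat \<Rightarrow> real" where
  "rise n k = (let l = left_pt n k; m = mid_pt n k; r = right_pt n k in
     sqrt ((h r - h m) / ((h r - h l) * (h m - h l))))"

definition fall :: "nat \<Rightarrow> nat \<Rightarrow> real" where
  "fall n k = (let l = left_pt n k; m = mid_pt n k; r = right_pt n k in
     sqrt ((h m - h l) / ((h r - h l) * (h r - h m))))"

text \<open>For \<open>n \<noteq> 0\<close> this is the tent \<open>\<Psi>\<^sub>n\<^sub>,\<^sub>k / g\<close>. Its rising and falling branches, which are affine in \<open>h\<close>, agree
  at the midpoint, so inside the support the tent is their minimum, and outside one of the
  branches is nonpositive. In this form continuity is immediate; \<open>explicit_Psi_eq\<close> recovers the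
  piecewise formula.\<close>

definition schauder :: "nat \<Rightarrow> nat \<Rightarrow> real \<Rightarrow> real" where
  "schauder n k t = (if n = 0 then h t / sqrt (h 1)
     else max 0 (min (rise n k * (h t - h (left_pt n k))) (fall n k * (h (right_pt n k) - h t))))"

lemma pts:
  assumes "(n, k) \<in> dyadic_index" "n \<noteq> 0"
  shows "0 \<le> left_pt n k" "left_pt n k < mid_pt n k" "mid_pt n k < right_pt n k" "right_pt n k \<le> 1"
    "mid_pt n k - left_pt n k = 1 / 2 ^ n"
proof -
  have "2 * k + 2 \<le> (2::nat) ^ n"
  proof -
    have "even ((2::nat) ^ n)" using assms by simp
    then obtain q where "(2::nat) ^ n = 2 * q" by (elim dvdE)
    then show ?thesis using assms by (auto simp: dyadic_index_def)
  qed
  then have "real (2 * k + 2) \<le> real (2 ^ n)" by (simp only: of_nat_le_iff)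
  then show "right_pt n k \<le> 1" by (simp add: right_pt_def field_simps)
  show "0 \<le> left_pt n k" "left_pt n k < mid_pt n k" "mid_pt n k < right_pt n k" "mid_pt n k - left_pt n k = 1 / 2 ^ n"
    by (auto simp: left_pt_def mid_pt_def right_pt_def divide_strict_right_mono diff_divide_distrib[symmetric])
qed

text \<open>With \<open>a\<close> and \<open>b\<close> the increments of the clock over the two halves of the support, these are the
  identities on which the induction for the kernel rests; the last two bound the height of the
  tent.\<close>

lemma rise_fall:
  assumes i: "(n, k) \<in> dyadic_index" "n \<noteq> 0"
  defines "a \<equiv> h (mid_pt n k) - h (left_pt n k)" and "b \<equiv> h (right_pt n k) - h (mid_pt n k)"
  shows "0 < a" "0 < b" "0 < rise n k" "0 < fall n k" "rise n k * rise n k = b / ((a + b) * a)"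
    "fall n k * fall n k = a / ((a + b) * b)" "rise n k * fall n k = 1 / (a + b)"
    "rise n k * a = fall n k * b" "rise n k * a \<le> sqrt a"
proof -
  note p = pts[OF i]
  show ab: "0 < a" "0 < b" using h_less[of "left_pt n k" "mid_pt n k"] h_less[of "mid_pt n k" "right_pt n k"] p
    by (auto simp: a_def b_def)
  have r: "rise n k = sqrt (b / ((a + b) * a))" and f: "fall n k = sqrt (a / ((a + b) * b))"
    by (simp_all add: rise_def fall_def Let_def a_def b_def)
  show "0 < rise n k" "0 < fall n k" using ab by (auto simp: r f)
  show "rise n k * rise n k = b / ((a + b) * a)" "fall n k * fall n k = a / ((a + b) * b)"
    using ab by (auto simp: r f)
  have "rise n k * fall n k = sqrt ((1 / (a + b))\<^sup>2)"
    unfolding r f real_sqrt_mult[symmetric] using ab by (simp add: power2_eq_square)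
  then show "rise n k * fall n k = 1 / (a + b)" using ab by simp
  have "rise n k * a = sqrt (b / ((a + b) * a) * a\<^sup>2)" unfolding r real_sqrt_mult using ab by simp
  also have "\<dots> = sqrt (a * b / (a + b))" using ab by (simp add: power2_eq_square)
  finally have 1: "rise n k * a = sqrt (a * b / (a + b))" .
  have "fall n k * b = sqrt (a / ((a + b) * b) * b\<^sup>2)" unfolding f real_sqrt_mult using ab by simp
  also have "\<dots> = sqrt (a * b / (a + b))" using ab by (simp add: power2_eq_square)
  finally show "rise n k * a = fall n k * b" using 1 by simp
  show "rise n k * a \<le> sqrt a" unfolding 1 using ab by (simp add: field_simps)
qed

lemma schauder_pieces:
  assumes i: "(n, k) \<in> dyadic_index" "n \<noteq> 0" and t: "t \<in> {0..1}"
  shows "t \<le> left_pt n k \<Longrightarrow> schauder n k t = 0"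
    and "right_pt n k \<le> t \<Longrightarrow> schauder n k t = 0"
    and "left_pt n k \<le> t \<Longrightarrow> t \<le> mid_pt n k \<Longrightarrow> schauder n k t = rise n k * (h t - h (left_pt n k))"
    and "mid_pt n k \<le> t \<Longrightarrow> t \<le> right_pt n k \<Longrightarrow> schauder n k t = fall n k * (h (right_pt n k) - h t)"
    and "0 \<le> schauder n k t" "schauder n k t \<le> sqrt (C / 2 ^ n)"
proof -
  let ?l = "left_pt n k" and ?m = "mid_pt n k" and ?r = "right_pt n k"
  note p = pts[OF i] and rf = rise_fall[OF i]
  have peak: "rise n k * (h ?m - h ?l) = fall n k * (h ?r - h ?m)" by (rule rf(8))
  show "schauder n k t = 0" if "t \<le> ?l"
  proof -
    have "h t \<le> h ?l" using h_le[of t ?l] that p t by auto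
    then have "rise n k * (h t - h ?l) \<le> 0" using rf(3) by (simp add: mult_le_0_iff)
    then show ?thesis using i by (simp add: schauder_def)
  qed
  show "schauder n k t = 0" if "?r \<le> t"
  proof -
    have "h ?r \<le> h t" using h_le[of ?r t] that p t by auto
    then have "fall n k * (h ?r - h t) \<le> 0" using rf(4) by (simp add: mult_le_0_iff)
    then show ?thesis using i by (simp add: schauder_def)
  qed
  show "schauder n k t = rise n k * (h t - h ?l)" if "?l \<le> t" "t \<le> ?m"
  proof -
    have "h ?l \<le> h t" "h t \<le> h ?m" using h_le[of ?l t] h_le[of t ?m] that p t by auto
    then have "0 \<le> rise n k * (h t - h ?l)" "rise n k * (h t - h ?l) \<le> rise n k * (h ?m - h ?l)"
      "fall n k * (h ?r - h ?m) \<le> fall n k * (h ?r - h t)"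
      using rf(3,4) by (auto intro!: mult_nonneg_nonneg mult_left_mono)
    then show ?thesis using i peak by (simp add: schauder_def)
  qed
  show "schauder n k t = fall n k * (h ?r - h t)" if "?m \<le> t" "t \<le> ?r"
  proof -
    have "h ?m \<le> h t" "h t \<le> h ?r" using h_le[of ?m t] h_le[of t ?r] that p t by auto
    then have "0 \<le> fall n k * (h ?r - h t)" "fall n k * (h ?r - h t) \<le> fall n k * (h ?r - h ?m)"
      "rise n k * (h ?m - h ?l) \<le> rise n k * (h t - h ?l)"
      using rf(3,4) by (auto intro!: mult_nonneg_nonneg mult_left_mono)
    then show ?thesis using i peak by (simp add: schauder_def)
  qed
  show "0 \<le> schauder n k t" using i by (simp add: schauder_def)
  have pk: "0 \<le> rise n k * (h ?m - h ?l)" using rf(1,3) by simp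
  have "schauder n k t \<le> rise n k * (h ?m - h ?l)"
  proof (cases "t \<le> ?m")
    case True
    have "rise n k * (h t - h ?l) \<le> rise n k * (h ?m - h ?l)"
      using h_le[of t ?m] True p t rf(3) by (intro mult_left_mono) auto
    then show ?thesis using i pk by (auto simp: schauder_def min_le_iff_disj)
  next
    case False
    have "fall n k * (h ?r - h t) \<le> fall n k * (h ?r - h ?m)"
      using h_le[of ?m t] False p t rf(4) by (intro mult_left_mono) auto
    then show ?thesis using i pk peak by (auto simp: schauder_def min_le_iff_disj)
  qed
  also have "\<dots> \<le> sqrt (h ?m - h ?l)" by (rule rf(9))
  also have "\<dots> \<le> sqrt (C / 2 ^ n)"
    using h_lipschitz[of ?l ?m] p by simp
  finally show "schauder n k t \<le> sqrt (C / 2 ^ n)" .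
qed

lemma schauder_continuous: "continuous_on {0..1} (schauder n k)"
proof (cases "n = 0")
  case True
  then show ?thesis unfolding schauder_def using h_continuous h1_pos by (auto intro!: continuous_intros)
next
  case False
  then show ?thesis unfolding schauder_def using h_continuous by (auto intro!: continuous_intros)
qed

definition kernel :: "nat \<Rightarrow> real \<Rightarrow> real \<Rightarrow> real" where
  "kernel N s t = (\<Sum>n\<le>N. \<Sum>k | (n, k) \<in> dyadic_index. schauder n k s * schauder n k t)"

lemma dyadic_Suc: "{k. (Suc N, k) \<in> dyadic_index} = {..<2 ^ N}"
  by (auto simp: dyadic_index_def)

lemma pts_Suc: "left_pt (Suc N) k = real k / 2 ^ N" "right_pt (Suc N) k = (real k + 1) / 2 ^ N"
  by (simp_all add: left_pt_def right_pt_def del: distrib_left_numeral)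

text \<open>The supports of the tents of one level overlap only at end points, where the tents vanish.\<close>

lemma level_sum_cell:
  assumes j: "j < 2 ^ N" and s: "s \<in> {real j / 2 ^ N..(real j + 1) / 2 ^ N}" and s1: "s \<in> {0..1}"
  shows "(\<Sum>k | (Suc N, k) \<in> dyadic_index. schauder (Suc N) k s * y k) =
      schauder (Suc N) j s * y j"
proof -
  have "schauder (Suc N) k s = 0" if k: "k < 2 ^ N" "k \<noteq> j" for k
  proof (cases "k < j")
    case True
    then have "(real k + 1) / 2 ^ N \<le> real j / 2 ^ N" by (intro divide_right_mono) auto
    then show ?thesis using k s s1 by (intro schauder_pieces(2)) (auto simp: dyadic_Suc[of N, symmetric] pts_Suc dyadic_index_def)
  next
    case False
    then have "(real j + 1) / 2 ^ N \<le> real k / 2 ^ N" using k by (intro divide_right_mono) auto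
    then show ?thesis using k s s1 by (intro schauder_pieces(1)) (auto simp: pts_Suc dyadic_index_def)
  qed
  then have "(\<Sum>k\<in>{..<2 ^ N}. schauder (Suc N) k s * y k) =
     (\<Sum>k\<in>{j}. schauder (Suc N) k s * y k)"
    using j by (intro sum.mono_neutral_right) auto
  then show ?thesis by (simp add: dyadic_Suc)
qed

lemma level_sum_separated:
  assumes "j \<le> 2 ^ N" and "0 \<le> s" "s \<le> real j / 2 ^ N" "real j / 2 ^ N \<le> t" "t \<le> 1"
  shows "(\<Sum>k | (Suc N, k) \<in> dyadic_index. schauder (Suc N) k s * schauder (Suc N) k t) = 0"
  unfolding dyadic_Suc
proof (rule sum.neutral, rule ballI)
  fix k assume k: "k \<in> {..<(2::nat) ^ N}"
  have st: "s \<in> {0..1}" "t \<in> {0..1}" using assms by auto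
  show "schauder (Suc N) k s * schauder (Suc N) k t = 0"
  proof (cases "k < j")
    case True
    then have "(real k + 1) / 2 ^ N \<le> real j / 2 ^ N" by (intro divide_right_mono) auto
    then have "schauder (Suc N) k t = 0"
      using k st assms by (intro schauder_pieces(2)) (auto simp: pts_Suc dyadic_index_def)
    then show ?thesis by simp
  next
    case False
    then have "real j / 2 ^ N \<le> real k / 2 ^ N" by (intro divide_right_mono) auto
    then have "schauder (Suc N) k s = 0"
      using k st assms by (intro schauder_pieces(1)) (auto simp: pts_Suc dyadic_index_def)
    then show ?thesis by simp
  qed
qed

text \<open>By induction on \<open>N\<close>. Refining a cell adds the product of one tent with itself. This corrects the
  kernel of the interpolated process on the cell into the kernels on its two halves, and restores the
  exact covariance \<open>h s\<close> for two times separated by the new midpoint; times already separated by the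
  coarser grid are not affected, since no tent of the new level is nonzero at both of them.\<close>

lemma kernel_formula:
  shows kernel_cell: "\<And>j s t. j < 2 ^ N \<Longrightarrow> s \<in> {real j / 2 ^ N..(real j + 1) / 2 ^ N} \<Longrightarrow>
      t \<in> {real j / 2 ^ N..(real j + 1) / 2 ^ N} \<Longrightarrow>
      kernel N s t = h (real j / 2 ^ N) + (h s - h (real j / 2 ^ N)) * (h t - h (real j / 2 ^ N)) /
         (h ((real j + 1) / 2 ^ N) - h (real j / 2 ^ N))"
    and kernel_separated: "\<And>j s t. j \<le> 2 ^ N \<Longrightarrow> 0 \<le> s \<Longrightarrow> s \<le> real j / 2 ^ N \<Longrightarrow> real j / 2 ^ N \<le> t \<Longrightarrow> t \<le> 1 \<Longrightarrow>
      kernel N s t = h s"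
proof (induction N)
  case 0
  have k0: "kernel 0 s t = h s * h t / h 1" for s t
  proof -
    have "{k. (0, k) \<in> dyadic_index} = {0}" by (auto simp: dyadic_index_def)
    then show ?thesis using h1_pos by (simp add: kernel_def schauder_def)
  qed
  { case 1 then show ?case by (simp add: k0 h_zero) }
  { case 2
    then have "j = 0 \<or> j = 1" by auto
    with 2 show ?case using h1_pos h_zero by (auto simp: k0) }
next
  case (Suc N)
  have K: "kernel (Suc N) s t = kernel N s t + (\<Sum>k | (Suc N, k) \<in> dyadic_index. schauder (Suc N) k s * schauder (Suc N) k t)" for s t
    by (simp add: kernel_def)
  have cell: "kernel (Suc N) s t = h l + (h s - h l) * (h t - h l) / (h r - h l) + schauder (Suc N) j s * schauder (Suc N) j t"
    if "j < 2 ^ N" "s \<in> {l..r}" "t \<in> {l..r}" "l = left_pt (Suc N) j" "r = right_pt (Suc N) j" for j s t l r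
  proof -
    have "r \<le> 1" "0 \<le> l" using pts[of "Suc N" j] that by (auto simp: dyadic_index_def)
    then have "s \<in> {0..1}" using that by auto
    then show ?thesis
      unfolding K using level_sum_cell[of j N s "\<lambda>k. schauder (Suc N) k t"] Suc.IH(1)[of j s t] that by (simp add: pts_Suc)
  qed
  { case (1 j' s t)
    define j where "j = j' div 2"
    define l m r where "l = left_pt (Suc N) j" and "m = mid_pt (Suc N) j" and "r = right_pt (Suc N) j"
    have j: "j < 2 ^ N" using 1(1) by (auto simp: j_def)
    then have i: "(Suc N, j) \<in> dyadic_index" by (auto simp: dyadic_index_def)
    note p = pts[OF i, folded l_def m_def r_def, simplified]
    note rf = rise_fall[OF i, folded l_def m_def r_def, simplified]
    note sp = schauder_pieces[OF i, folded l_def m_def r_def, simplified]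
    define a b where "a = h m - h l" and "b = h r - h m"
    note rf' = rf[folded a_def b_def]
    have ab: "h m = h l + a" "h r = h l + a + b" by (simp_all add: a_def b_def)
    have pos: "0 < a" "0 < b" "a + b \<noteq> 0" using rf(1,2) by (simp_all add: a_def b_def)
    show ?case
    proof (cases "even j'")
      case True
      then have "j' = 2 * j" by (simp add: j_def)
      then have e: "real j' / 2 ^ Suc N = l" "(real j' + 1) / 2 ^ Suc N = m"
        by (simp_all add: l_def m_def left_pt_def mid_pt_def)
      have "kernel (Suc N) s t = h l + (h s - h l) * (h t - h l) / (h r - h l) + (rise (Suc N) j * rise (Suc N) j) * ((h s - h l) * (h t - h l))"
        using cell[OF j _ _ l_def r_def, of s t] sp(3)[of s] sp(3)[of t] 1(2,3) p unfolding e by (simp add: ac_simps)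
      also have "\<dots> = h l + (h s - h l) * (h t - h l) / (h m - h l)"
      proof -
        have "x / (a + b) + b / ((a + b) * a) * x = x / a" for x
          using pos by (simp add: divide_simps) (simp add: algebra_simps)
        then show ?thesis unfolding rf'(5) ab by (simp add: add.assoc)
      qed
      finally show ?thesis unfolding e .
    next
      case False
      then have "j' = 2 * j + 1" by (simp add: j_def)
      then have e: "real j' / 2 ^ Suc N = m" "(real j' + 1) / 2 ^ Suc N = r"
        by (simp_all add: r_def m_def right_pt_def mid_pt_def)
      have "kernel (Suc N) s t = h l + (h s - h l) * (h t - h l) / (h r - h l) + (fall (Suc N) j * fall (Suc N) j) * ((h r - h s) * (h r - h t))"
        using cell[OF j _ _ l_def r_def, of s t] sp(4)[of s] sp(4)[of t] 1(2,3) p unfolding e by (simp add: ac_simps)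
      also have "\<dots> = h m + (h s - h m) * (h t - h m) / (h r - h m)"
      proof -
        have "(a + x) * (a + y) / (a + b) + a / ((a + b) * b) * ((b - x) * (b - y)) = a + x * y / b" for x y
          using pos by (simp add: divide_simps) (simp add: algebra_simps)
        from this[of "h s - h m" "h t - h m"] show ?thesis unfolding rf'(6) ab by (simp add: algebra_simps)
      qed
      finally show ?thesis unfolding e .
    qed }
  { case (2 j' s t)
    show ?case
    proof (cases "even j'")
      case True
      then obtain j where j: "j' = 2 * j" by (auto elim: evenE)
      then have e: "real j' / 2 ^ Suc N = real j / 2 ^ N" and le: "j \<le> 2 ^ N" using 2(1) by auto
      show ?thesis
        unfolding K using Suc.IH(2)[OF le] level_sum_separated[OF le] 2 unfolding e by simp
    next
      case False
      then obtain j where j': "j' = 2 * j + 1" by (auto elim: oddE)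
      define l m r where "l = left_pt (Suc N) j" and "m = mid_pt (Suc N) j" and "r = right_pt (Suc N) j"
      have j: "j < 2 ^ N" using 2(1) j' by auto
      then have i: "(Suc N, j) \<in> dyadic_index" by (auto simp: dyadic_index_def)
      note p = pts[OF i, folded l_def m_def r_def, simplified]
      note rf = rise_fall[OF i, folded l_def m_def r_def, simplified]
      note sp = schauder_pieces[OF i, folded l_def m_def r_def, simplified]
      have e: "real j' / 2 ^ Suc N = m" using j' by (simp add: m_def mid_pt_def)
      have st: "s \<le> m" "m \<le> t" using 2 unfolding e by auto
      have lr: "l = real j / 2 ^ N" "r = real (Suc j) / 2 ^ N" by (simp_all add: l_def r_def pts_Suc add.commute)
      consider "s \<le> l" | "r \<le> t" | "l \<le> s" "t \<le> r" by linarith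
      then show ?thesis
      proof cases
        assume "s \<le> l"
        then show ?thesis
          unfolding K using Suc.IH(2)[of j s t] level_sum_separated[of j N s t] 2 p st j by (simp add: lr)
      next
        assume "r \<le> t"
        then show ?thesis
          unfolding K using Suc.IH(2)[of "Suc j" s t] level_sum_separated[of "Suc j" N s t] 2 p st j by (simp add: lr)
      next
        assume *: "l \<le> s" "t \<le> r"
        have "kernel (Suc N) s t = h l + (h s - h l) * (h t - h l) / (h r - h l) + (rise (Suc N) j * fall (Suc N) j) * ((h s - h l) * (h r - h t))"
          using cell[OF j _ _ l_def r_def, of s t] sp(3)[of s] sp(4)[of t] * 2 st p by (simp add: ac_simps)
        also have "\<dots> = h s"
        proof -
          have pos: "0 < h r - h l" using rf(1,2) by simp
          have "(h s - h l) * (h t - h l) / (h r - h l) + 1 / (h r - h l) * ((h s - h l) * (h r - h t)) = (h s - h l) * (h r - h l) / (h r - h l)"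
            unfolding times_divide_eq_left mult_1 add_divide_distrib[symmetric] by (simp add: algebra_simps)
          then show ?thesis using pos rf(7) by simp
        qed
        finally show ?thesis .
      qed
    qed }
qed

lemma kernel_commute: "kernel N s t = kernel N t s"
  by (simp add: kernel_def mult.commute)

lemma dyadic_cell:
  fixes t :: real
  assumes "t \<in> {0..1}"
  obtains j where "j < (2::nat) ^ N" "t \<in> {real j / 2 ^ N..(real j + 1) / 2 ^ N}"
proof (cases "t = 1")
  case True
  show ?thesis
    by (rule that[of "2 ^ N - 1"]) (auto simp: True of_nat_diff field_simps)
next
  case False
  define j where "j = nat \<lfloor>t * 2 ^ N\<rfloor>"
  have t: "0 \<le> t" "t < 1" using assms False by auto
  have r: "real j = \<lfloor>t * 2 ^ N\<rfloor>" using t by (simp add: j_def)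
  have b: "real j \<le> t * 2 ^ N" "t * 2 ^ N < real j + 1" unfolding r by linarith+
  have "t * 2 ^ N < 1 * 2 ^ N" using t by (intro mult_strict_right_mono) auto
  then have "real j < 2 ^ N" using b by linarith
  then have "j < 2 ^ N" by simp
  then show ?thesis by (rule that) (use b in \<open>auto simp: field_simps\<close>)
qed

text \<open>At a given time at most one tent per level is nonzero, so a sum over a level is dominated by one of its
  coefficients.\<close>

lemma level_bound:
  assumes t: "t \<in> {0..1}"
  obtains j where "(n, j) \<in> dyadic_index"
    "\<bar>\<Sum>k | (n, k) \<in> dyadic_index. schauder n k t * y k\<bar> \<le> sqrt (C / 2 ^ n) * \<bar>y j\<bar>"
proof (cases n)
  case 0
  have "h t \<le> h 1" "0 \<le> h t" using h_le[of t 1] h_le[of 0 t] h_zero t by auto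
  then have "\<bar>schauder 0 0 t\<bar> \<le> h 1 / sqrt (h 1)" using h1_pos by (auto simp: schauder_def intro!: divide_right_mono)
  also have "\<dots> = sqrt (h 1)" by (rule real_div_sqrt) (use h1_pos in simp)
  also have "\<dots> \<le> sqrt C" using h_lipschitz[of 0 1] h_zero by simp
  finally have b: "\<bar>schauder 0 0 t\<bar> \<le> sqrt C" .
  have "{k. (0, k) \<in> dyadic_index} = {0}" by (auto simp: dyadic_index_def)
  then show ?thesis
    by (intro that[of 0]) (use b 0 in \<open>auto simp: abs_mult dyadic_index_def intro!: mult_right_mono\<close>)
next
  case (Suc N)
  obtain j where j: "j < (2::nat) ^ N" "t \<in> {real j / 2 ^ N..(real j + 1) / 2 ^ N}"
    by (rule dyadic_cell[OF t])
  then have i: "(Suc N, j) \<in> dyadic_index" by (auto simp: dyadic_index_def)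
  show ?thesis
    by (rule that[of j]) (use schauder_pieces(5,6)[OF i _ t] i j t in \<open>auto simp: Suc level_sum_cell abs_mult intro!: mult_right_mono\<close>)
qed

text \<open>The kernel lies between the clock at the left end of the cell of \<open>min s t\<close> and \<open>h (min s t)\<close>,
  and the cells shrink.\<close>

lemma kernel_tendsto:
  assumes "s \<in> {0..1}" "t \<in> {0..1}"
  shows "(\<lambda>N. kernel N s t) \<longlonglongrightarrow> h (min s t)"
proof -
  have main: "\<bar>kernel N s t - h s\<bar> \<le> C * (1 / 2) ^ N" if "0 \<le> s" "s \<le> t" "t \<le> 1" for s t N
  proof -
    have "s \<in> {0..1}" using that by simp
    then obtain j where j: "j < (2::nat) ^ N" and sc: "s \<in> {real j / 2 ^ N..(real j + 1) / 2 ^ N}"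
      by (rule dyadic_cell)
    define l r where "l = real j / 2 ^ N" and "r = (real j + 1) / 2 ^ N"
    have "real (Suc j) \<le> real (2 ^ N)" using j by (simp only: of_nat_le_iff Suc_le_eq)
    then have r1: "r \<le> 1" by (simp add: r_def field_simps)
    have lr: "0 \<le> l" "l < r" "r - l = (1/2) ^ N"
      by (auto simp: l_def r_def divide_strict_right_mono diff_divide_distrib[symmetric] power_one_over)
    have "l \<le> s" "s \<le> r" using sc by (auto simp: l_def r_def)
    then have hs: "h l \<le> h s" "h s \<le> h r" "h l < h r"
      using h_le[of l s] h_le[of s r] h_less[of l r] lr r1 that by simp_all
    have "h s - h l \<le> C * (s - l)" using h_lipschitz[of l s] sc lr that by (auto simp: l_def)
    also have "\<dots> \<le> C * (1/2) ^ N" using sc lr by (intro mult_left_mono C_nonneg) (auto simp: l_def r_def)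
    finally have d: "h s - h l \<le> C * (1 / 2) ^ N" .
    show ?thesis
    proof (cases "t \<le> r")
      case True
      then have k: "kernel N s t = h l + (h s - h l) * (h t - h l) / (h r - h l)"
        using kernel_cell[OF j sc, of t] sc that by (auto simp: l_def r_def)
      have ht: "h l \<le> h t" "h t \<le> h r" using h_le[of l t] h_le[of t r] sc lr that r1 True by (auto simp: l_def)
      have "(h s - h l) * (h t - h l) \<le> (h s - h l) * (h r - h l)"
        using hs ht by (intro mult_left_mono) auto
      then have "(h s - h l) * (h t - h l) / (h r - h l) \<le> h s - h l"
        using hs by (simp add: field_simps)
      moreover have "0 \<le> (h s - h l) * (h t - h l) / (h r - h l)"
        using hs ht by auto
      ultimately show ?thesis using d unfolding k by simp
    next
      case False
      then have "kernel N s t = h s"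
        using sc j that by (intro kernel_separated[of "Suc j"]) (auto simp: r_def add.commute)
      then show ?thesis using C_nonneg by simp
    qed
  qed
  have lim: "(\<lambda>N. C * (1 / 2) ^ N) \<longlonglongrightarrow> 0"
    by (intro tendsto_mult_right_zero LIMSEQ_power_zero) simp
  have "\<bar>kernel N s t - h (min s t)\<bar> \<le> C * (1 / 2) ^ N" for N
    using main[of s t N] main[of t s N] assms by (cases "s \<le> t") (auto simp: min_def kernel_commute)
  then have "(\<lambda>N. kernel N s t - h (min s t)) \<longlonglongrightarrow> 0"
    by (intro Lim_null_comparison[OF always_eventually lim]) auto
  then show ?thesis by (simp add: LIM_zero_iff)
qed

end

lemma explicit_Psi_eq:
  assumes "time_change (energy f) C" and i: "(n, k) \<in> dyadic_index" and t: "t \<in> {0..1}"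
  shows "explicit_Psi f g n k t = g t * time_change.schauder (energy f) n k t"
proof (cases "n = 0")
  interpret time_change "energy f" C by fact
  case True
  then show ?thesis by (simp add: explicit_Psi_def schauder_def Let_def)
next
  interpret time_change "energy f" C by fact
  case False
  note sp = schauder_pieces[OF i False t]
  note p = pts[OF i False]
  consider "t < left_pt n k" | "left_pt n k \<le> t" "t < mid_pt n k" | "mid_pt n k \<le> t" "t < right_pt n k" | "right_pt n k \<le> t"
    by linarith
  then show ?thesis
    using False sp p by cases (simp_all add: explicit_Psi_def Let_def rise_def fall_def)
qed

lemma energy_time_change:
  assumes f: "continuous_on {0..1} f" "\<forall>t\<in>{0..1}. f t \<noteq> 0"
  shows "\<exists>C. time_change (energy f) C"
proof -
  have c2: "continuous_on {0..1} (\<lambda>u. (f u)\<^sup>2)" by (intro continuous_intros f)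
  obtain x where x: "x \<in> {0..1}" "\<And>u. u \<in> {0..1} \<Longrightarrow> (f x)\<^sup>2 \<le> (f u)\<^sup>2"
    using continuous_attains_inf[OF _ _ c2] by auto
  obtain y where y: "y \<in> {0..1}" "\<And>u. u \<in> {0..1} \<Longrightarrow> (f u)\<^sup>2 \<le> (f y)\<^sup>2"
    using continuous_attains_sup[OF _ _ c2] by auto
  have int: "(\<lambda>u. (f u)\<^sup>2) integrable_on {s..t}" if "0 \<le> s" "t \<le> 1" for s t
    by (rule integrable_continuous_real, rule continuous_on_subset[OF c2]) (use that in auto)
  have diff: "energy f t - energy f s = integral {s..t} (\<lambda>u. (f u)\<^sup>2)" if "0 \<le> s" "s \<le> t" "t \<le> 1" for s t
    using Henstock_Kurzweil_Integration.integral_combine[OF that(1,2) int[of 0 t]] that by (simp add: energy_def)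
  have bounds: "(f x)\<^sup>2 * (t - s) \<le> energy f t - energy f s \<and> energy f t - energy f s \<le> (f y)\<^sup>2 * (t - s)"
    if st: "0 \<le> s" "s \<le> t" "t \<le> 1" for s t
  proof -
    have "integral {s..t} (\<lambda>u. (f x)\<^sup>2) \<le> integral {s..t} (\<lambda>u. (f u)\<^sup>2)"
      using st by (intro integral_le int) (auto intro!: x(2))
    moreover have "integral {s..t} (\<lambda>u. (f u)\<^sup>2) \<le> integral {s..t} (\<lambda>u. (f y)\<^sup>2)"
      using st by (intro integral_le int) (auto intro!: y(2))
    ultimately show ?thesis using st by (simp add: diff mult.commute)
  qed
  have "time_change (energy f) ((f y)\<^sup>2)"
  proof
    show "energy f 0 = 0" by (simp add: energy_def)
    fix s t :: real
    { assume st: "0 \<le> s" "s < t" "t \<le> 1"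
      have "0 < (f x)\<^sup>2 * (t - s)" using f(2) x(1) st by simp
      then show "energy f s < energy f t" using bounds[of s t] st by linarith }
    { assume "0 \<le> s" "s \<le> t" "t \<le> 1"
      then show "energy f t - energy f s \<le> (f y)\<^sup>2 * (t - s)" using bounds by blast }
  qed
  then show ?thesis by blast
qed

section \<open>The random series\<close>

lemma nn_integral_fourth_moment:
  assumes "distributed Q lborel X std_normal_density"
  shows "(\<integral>\<^sup>+x. ennreal (X x ^ 4) \<partial>Q) = 3"
proof -
  have "(\<integral>\<^sup>+x. ennreal (X x ^ 4) \<partial>Q) = (\<integral>\<^sup>+x. ennreal (std_normal_density x) * ennreal (x ^ 4) \<partial>lborel)"
    by (rule distributed_nn_integral[OF assms, symmetric]) simp
  also have "\<dots> = (\<integral>\<^sup>+x. ennreal (std_normal_density x * x ^ (2 * 2)) \<partial>lborel)"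
    by (intro nn_integral_cong) (simp add: ennreal_mult)
  also have "\<dots> = ennreal (LINT x|lborel. std_normal_density x * x ^ (2 * 2))"
    by (rule nn_integral_eq_integral) (use integrable_std_normal_moment[of "2*2"] in auto)
  also have "(LINT x|lborel. std_normal_density x * x ^ (2 * 2)) = 3"
    by (subst integral_std_normal_moment_even) (simp add: fact_numeral)
  finally show ?thesis by simp
qed

locale gaussian_coefficients = prob_space Q for Q :: "'b measure" +
  fixes \<xi> :: "nat \<Rightarrow> nat \<Rightarrow> 'b \<Rightarrow> real"
  assumes normal: "(n, k) \<in> dyadic_index \<Longrightarrow> distributed Q lborel (\<xi> n k) std_normal_density"
    and indep: "indep_vars (\<lambda>_. borel) (\<lambda>(n, k). \<xi> n k) dyadic_index"
begin

lemma measurable_xi: "(n, k) \<in> dyadic_index \<Longrightarrow> \<xi> n k \<in> borel_measurable Q"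
  using distributed_measurable[OF normal] by simp

lemma finite_level: "finite {k. (n, k) \<in> dyadic_index}"
  by (rule finite_subset[of _ "{..2 ^ n}"]) (auto simp: dyadic_index_def)

lemma card_level: "card {k. (n, k) \<in> dyadic_index} \<le> 2 ^ n"
proof -
  have "card {k. (n, k) \<in> dyadic_index} \<le> card {..<(2::nat) ^ n}"
    by (intro card_mono) (auto simp: dyadic_index_def)
  then show ?thesis by simp
qed

lemma coefficients_gaussian:
  assumes "finite J" "J \<subseteq> dyadic_index"
  shows "gaussian_family Q J (\<lambda>(n, k). \<xi> n k) (\<lambda>p q. if p = q then 1 else 0)"
proof (rule gaussian_family_indep[OF prob_space_axioms assms(1), where v="\<lambda>_. 1"])
  show "indep_vars (\<lambda>_. borel) (\<lambda>(n, k). \<xi> n k) J" by (rule indep_vars_subset[OF indep assms(2)])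
  fix p u assume "p \<in> J"
  then have "distributed Q lborel (\<lambda>x. (case p of (n, k) \<Rightarrow> \<xi> n k) x) std_normal_density"
    using assms normal by (cases p) auto
  from char_normal[OF prob_space_axioms this]
  show "char (distr Q borel (case p of (n, k) \<Rightarrow> \<xi> n k)) u = complex_of_real (exp (- (u\<^sup>2 * 1) / 2))"
    by simp
qed

lemma partial_expansion_gaussian:
  assumes J: "finite J"
  shows "gaussian_family Q J (partial_expansion \<Psi> \<xi> N)
     (\<lambda>s t. \<Sum>n\<le>N. \<Sum>k | (n, k) \<in> dyadic_index. \<Psi> n k s * \<Psi> n k t)"
proof -
  define I where "I = (SIGMA n:{..N}. {k. (n, k) \<in> dyadic_index})"
  have I: "finite I" "I \<subseteq> dyadic_index" unfolding I_def using finite_level by auto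
  define A where "A t p = \<Psi> (fst p) (snd p) t" for t and p :: "nat \<times> nat"
  have sum: "(\<Sum>p\<in>I. F (fst p) (snd p)) = (\<Sum>n\<le>N. \<Sum>k | (n, k) \<in> dyadic_index. F n k)" for F :: "nat \<Rightarrow> nat \<Rightarrow> real"
    unfolding I_def by (subst sum.Sigma) (auto simp: finite_level split_def)
  have Y: "(\<lambda>t x. \<Sum>p\<in>I. A t p * (case p of (n, k) \<Rightarrow> \<xi> n k) x) = partial_expansion \<Psi> \<xi> N"
    using sum[of "\<lambda>n k. \<Psi> n k t * \<xi> n k x" for t x]
    by (intro ext) (simp add: A_def partial_expansion_def split_def)
  have C: "(\<Sum>p\<in>I. \<Sum>q\<in>I. A s p * A t q * (if p = q then 1 else 0)) =
      (\<Sum>n\<le>N. \<Sum>k | (n, k) \<in> dyadic_index. \<Psi> n k s * \<Psi> n k t)" for s t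
  proof -
    have "(\<Sum>p\<in>I. \<Sum>q\<in>I. A s p * A t q * (if p = q then 1 else 0)) =
       (\<Sum>p\<in>I. \<Sum>q\<in>I. if p = q then A s p * A t p else 0)"
      by (intro sum.cong refl) auto
    also have "\<dots> = (\<Sum>p\<in>I. A s p * A t p)" using I by simp
    finally show ?thesis using sum[of "\<lambda>n k. \<Psi> n k s * \<Psi> n k t"] by (simp add: A_def)
  qed
  show ?thesis
    using gaussian_family_linear[OF coefficients_gaussian[OF I] I(1) J, of A] unfolding Y C .
qed

text \<open>Level \<open>n\<close> has at most \<open>2\<^sup>n = q\<^sup>4\<^sup>n\<close> coefficients, each with fourth moment \<open>3\<close>, so the expectation of \<open>c n\<close> is
  at most \<open>3 q\<^sup>-\<^sup>n\<close>. A series of nonnegative variables with summable expectations is almost surely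
  finite.\<close>

lemma fourth_powers_summable:
  fixes q :: real
  assumes q: "1 < q" "q ^ 4 = 2"
  defines "c n \<omega> \<equiv> (1 / q) ^ (5 * n) * (\<Sum>k | (n, k) \<in> dyadic_index. \<xi> n k \<omega> ^ 4)"
  shows "\<And>n. c n \<in> borel_measurable Q" "AE \<omega> in Q. (\<Sum>n. ennreal (c n \<omega>)) \<noteq> \<infinity>"
proof -
  show c [measurable]: "c n \<in> borel_measurable Q" for n
    unfolding c_def using measurable_xi by (intro borel_measurable_times borel_measurable_sum borel_measurable_power) auto
  have le: "(\<integral>\<^sup>+\<omega>. ennreal (c n \<omega>) \<partial>Q) \<le> ennreal (3 * (1 / q) ^ n)" for n
  proof -
    have "(\<integral>\<^sup>+\<omega>. ennreal (c n \<omega>) \<partial>Q) = (\<integral>\<^sup>+\<omega>. ennreal ((1 / q) ^ (5 * n)) * (\<Sum>k | (n, k) \<in> dyadic_index. ennreal (\<xi> n k \<omega> ^ 4)) \<partial>Q)"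
      unfolding c_def using q by (intro nn_integral_cong) (simp add: ennreal_mult sum_nonneg)
    also have "\<dots> = ennreal ((1 / q) ^ (5 * n)) * (\<Sum>k | (n, k) \<in> dyadic_index. (\<integral>\<^sup>+\<omega>. ennreal (\<xi> n k \<omega> ^ 4) \<partial>Q))"
      by (subst nn_integral_cmult, use measurable_xi in \<open>force simp del: sum_ennreal\<close>)
         (subst nn_integral_sum, use measurable_xi in auto)
    also have "\<dots> = ennreal ((1 / q) ^ (5 * n)) * (\<Sum>k | (n, k) \<in> dyadic_index. 3)"
      by (intro arg_cong2[where f="(*)"] sum.cong refl nn_integral_fourth_moment normal) auto
    also have "\<dots> = ennreal ((1 / q) ^ (5 * n) * (3 * real (card {k. (n, k) \<in> dyadic_index})))"
      using q by (simp add: ennreal_mult ennreal_of_nat_eq_real_of_nat mult.commute)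
    also have "\<dots> \<le> ennreal ((1 / q) ^ (5 * n) * (3 * 2 ^ n))"
    proof -
      have "real (card {k. (n, k) \<in> dyadic_index}) \<le> real (2 ^ n)" using card_level[of n] by (simp only: of_nat_le_iff)
      then show ?thesis using q by (intro ennreal_leI mult_left_mono) auto
    qed
    also have "(1 / q) ^ (5 * n) * (3 * 2 ^ n) = 3 * (1 / q) ^ n"
    proof -
      have "(2::real) ^ n = q ^ (4 * n)" unfolding q(2)[symmetric] by (simp add: power_mult)
      then show ?thesis using q by (simp add: power_one_over power_add[symmetric] field_simps)
    qed
    finally show ?thesis .
  qed
  have sm: "summable (\<lambda>n. 3 * (1 / q) ^ n)" using q by (intro summable_mult summable_geometric) auto
  have "(\<integral>\<^sup>+\<omega>. (\<Sum>n. ennreal (c n \<omega>)) \<partial>Q) = (\<Sum>n. \<integral>\<^sup>+\<omega>. ennreal (c n \<omega>) \<partial>Q)"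
    by (rule nn_integral_suminf) simp
  also have "\<dots> \<le> (\<Sum>n. ennreal (3 * (1 / q) ^ n))" by (intro suminf_le le) auto
  also have "\<dots> = ennreal (\<Sum>n. 3 * (1 / q) ^ n)" using q by (intro suminf_ennreal2 sm) auto
  finally have "(\<integral>\<^sup>+\<omega>. (\<Sum>n. ennreal (c n \<omega>)) \<partial>Q) \<noteq> \<infinity>" by (auto simp: top_unique)
  then show "AE \<omega> in Q. (\<Sum>n. ennreal (c n \<omega>)) \<noteq> \<infinity>"
    by (intro nn_integral_PInf_AE) auto
qed

end

locale gaussian_expansion = gaussian_coefficients Q \<xi> + time_change h C
  for Q :: "'b measure" and \<xi> and h C +
  fixes g :: "real \<Rightarrow> real"
  assumes g_cont: "continuous_on {0..1} g"
begin

abbreviation \<Psi> :: "nat \<Rightarrow> nat \<Rightarrow> real \<Rightarrow> real" where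
  "\<Psi> n k t \<equiv> g t * schauder n k t"

lemma expansion_gaussian:
  assumes "finite J"
  shows "gaussian_family Q J (partial_expansion \<Psi> \<xi> N) (\<lambda>s t. g s * g t * kernel N s t)"
  by (rule gaussian_family_cov_cong[OF partial_expansion_gaussian[OF assms]])
     (simp add: kernel_def sum_distrib_left ac_simps)

lemma expansion_measurable: "partial_expansion \<Psi> \<xi> N t \<in> borel_measurable Q"
  using gaussian_familyD(1)[OF expansion_gaussian[of "{t}" N]] by simp

lemma expansion_continuous: "continuous_on {0..1} (\<lambda>t. partial_expansion \<Psi> \<xi> N t \<omega>)"
  unfolding partial_expansion_def
  by (intro continuous_on_sum continuous_on_mult continuous_on_const g_cont schauder_continuous)

text \<open>Uniform bounds for the levels come from \<open>|x| \<le> a + x\<^sup>4 / a\<^sup>3\<close> with \<open>a = q\<^sup>n\<close> and \<open>q\<^sup>4 = 2\<close>: bounding the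
  largest coefficient by \<open>q\<^sup>n\<close> plus a multiple of the sum of the fourth powers and using the height
  \<open>O(q\<^sup>-\<^sup>2\<^sup>n)\<close> of the tents leaves a geometric series plus the series of \<open>fourth_powers_summable\<close>.\<close>

lemma expansion_converges:
  obtains Xbar where "\<And>t. t \<in> {0..1} \<Longrightarrow> Xbar t \<in> borel_measurable Q"
    and "\<And>\<omega>. continuous_on {0..1} (\<lambda>t. Xbar t \<omega>)"
    and "AE \<omega> in Q. uniform_limit {0..1} (\<lambda>N t. partial_expansion \<Psi> \<xi> N t \<omega>) (\<lambda>t. Xbar t \<omega>) sequentially"
proof -
  define q :: real where "q = sqrt (sqrt 2)"
  have q2: "q ^ 2 = sqrt 2" by (simp add: q_def)
  have "q ^ 4 = (q ^ 2) ^ 2" by (simp add: power_mult[symmetric])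
  then have q: "1 < q" "q ^ 4 = 2" by (simp_all add: q2) (simp add: q_def)
  define c where "c n \<omega> = (1 / q) ^ (5 * n) * (\<Sum>k | (n, k) \<in> dyadic_index. \<xi> n k \<omega> ^ 4)" for n \<omega>
  note c = fourth_powers_summable[OF q, folded c_def]
  have c0: "0 \<le> c n \<omega>" for n \<omega> unfolding c_def using q by (intro mult_nonneg_nonneg sum_nonneg) auto
  have "\<exists>G. \<forall>t\<in>{0..1}. \<bar>g t\<bar> \<le> G"
    using compact_imp_bounded[OF compact_continuous_image[OF g_cont compact_Icc]]
    by (simp add: bounded_iff)
  then obtain G where G: "\<And>t. t \<in> {0..1} \<Longrightarrow> \<bar>g t\<bar> \<le> G" by blast
  define Lv where "Lv n t \<omega> = (\<Sum>k | (n, k) \<in> dyadic_index. \<Psi> n k t * \<xi> n k \<omega>)" for n t \<omega>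
  have bound: "\<bar>Lv n t \<omega>\<bar> \<le> G * sqrt C * ((1 / q) ^ n + c n \<omega>)" if t: "t \<in> {0..1}" for n t \<omega>
  proof -
    obtain j where j: "(n, j) \<in> dyadic_index"
      "\<bar>\<Sum>k | (n, k) \<in> dyadic_index. schauder n k t * \<xi> n k \<omega>\<bar> \<le> sqrt (C / 2 ^ n) * \<bar>\<xi> n j \<omega>\<bar>"
      by (rule level_bound[OF t])
    let ?x = "\<bar>\<xi> n j \<omega>\<bar>"
    have young: "?x \<le> a + ?x ^ 4 / a ^ 3" if "0 < a" for a :: real
    proof (cases "?x \<le> a")
      case True
      then show ?thesis using that by (simp add: add_increasing2)
    next
      case False
      then have "?x * a ^ 3 \<le> ?x * ?x ^ 3" using that by (intro mult_left_mono power_mono) auto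
      then have "?x \<le> ?x ^ 4 / a ^ 3" using that by (simp add: field_simps power_numeral_reduce)
      then show ?thesis using that by simp
    qed
    have "?x ^ 4 \<le> (\<Sum>k | (n, k) \<in> dyadic_index. \<xi> n k \<omega> ^ 4)"
      using member_le_sum[of j "{k. (n, k) \<in> dyadic_index}" "\<lambda>k. \<xi> n k \<omega> ^ 4"] j finite_level
      by (simp add: power_even_abs)
    then have "?x ^ 4 / (q ^ n) ^ 3 \<le> (\<Sum>k | (n, k) \<in> dyadic_index. \<xi> n k \<omega> ^ 4) / (q ^ n) ^ 3"
      using q by (intro divide_right_mono) auto
    then have x: "?x \<le> q ^ n + (\<Sum>k | (n, k) \<in> dyadic_index. \<xi> n k \<omega> ^ 4) / (q ^ n) ^ 3"
      using young[of "q ^ n"] q by simp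
    have s: "sqrt (C / 2 ^ n) = sqrt C * (1 / q) ^ (2 * n)"
      by (simp add: real_sqrt_divide real_sqrt_power power_mult q2 power_one_over)
    have e: "(1 / q) ^ (2 * n) * (q ^ n + S / (q ^ n) ^ 3) = (1 / q) ^ n + (1 / q) ^ (5 * n) * S" for S
    proof -
      have "q ^ (2 * n) = q ^ n * q ^ n" by (simp add: mult_2 power_add)
      moreover have "q ^ (5 * n) = q ^ n * q ^ n * (q ^ n) ^ 3"
        by (simp add: power_add[symmetric] power_mult[symmetric])
      ultimately show ?thesis using q by (simp add: power_one_over field_simps)
    qed
    have "\<bar>Lv n t \<omega>\<bar> = \<bar>g t\<bar> * \<bar>\<Sum>k | (n, k) \<in> dyadic_index. schauder n k t * \<xi> n k \<omega>\<bar>"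
      by (simp add: Lv_def sum_distrib_left mult.assoc flip: abs_mult)
    also have "\<dots> \<le> G * (sqrt (C / 2 ^ n) * ?x)"
      using G[OF t] j(2) by (intro mult_mono) auto
    also have "\<dots> \<le> G * (sqrt C * (1 / q) ^ (2 * n) * (q ^ n + (\<Sum>k | (n, k) \<in> dyadic_index. \<xi> n k \<omega> ^ 4) / (q ^ n) ^ 3))"
      unfolding s using G[OF t] x q C_nonneg by (intro mult_left_mono) auto
    also have "\<dots> = G * sqrt C * ((1 / q) ^ n + c n \<omega>)"
      unfolding mult.assoc e c_def ..
    finally show ?thesis .
  qed
  \<comment> \<open>On the exceptional null set the limit is set to zero, so that all its paths are continuous.\<close>
  define good where "good = {\<omega> \<in> space Q. (\<Sum>n. ennreal (c n \<omega>)) \<noteq> \<infinity>}"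
  have [measurable]: "c n \<in> borel_measurable Q" for n by (rule c(1))
  have good [measurable]: "good \<in> sets Q" unfolding good_def by measurable
  define Xbar where "Xbar t \<omega> = (if \<omega> \<in> good then (\<Sum>n. Lv n t \<omega>) else 0)" for t \<omega>
  have lim: "uniform_limit {0..1} (\<lambda>N t. partial_expansion \<Psi> \<xi> N t \<omega>) (\<lambda>t. Xbar t \<omega>) sequentially"
    if w: "\<omega> \<in> good" for \<omega>
  proof -
    have "summable (\<lambda>n. c n \<omega>)"
      using w by (intro summable_suminf_not_top c0) (auto simp: good_def)
    then have "summable (\<lambda>n. G * sqrt C * ((1 / q) ^ n + c n \<omega>))"
      using q by (intro summable_mult summable_add summable_geometric) auto
    then have "uniform_limit {0..1} (\<lambda>N t. \<Sum>n<N. Lv n t \<omega>) (\<lambda>t. \<Sum>n. Lv n t \<omega>) sequentially"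
      by (rule Weierstrass_m_test[rotated]) (use bound in auto)
    from filterlim_compose[OF this filterlim_Suc]
    have "uniform_limit {0..1} (\<lambda>N t. \<Sum>n<Suc N. Lv n t \<omega>) (\<lambda>t. \<Sum>n. Lv n t \<omega>) sequentially" .
    then show ?thesis
      using w by (simp add: Xbar_def partial_expansion_def Lv_def lessThan_Suc_atMost)
  qed
  show ?thesis
  proof (rule that)
    show "Xbar t \<in> borel_measurable Q" if t: "t \<in> {0..1}" for t
    proof -
      have [measurable]: "Lv n t \<in> borel_measurable Q" for n
        unfolding Lv_def using measurable_xi by (intro borel_measurable_sum borel_measurable_times) auto
      show ?thesis unfolding Xbar_def by measurable
    qed
    show "continuous_on {0..1} (\<lambda>t. Xbar t \<omega>)" for \<omega>
    proof (cases "\<omega> \<in> good")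
      case True
      show ?thesis
        by (rule uniform_limit_theorem[OF _ lim[OF True]]) (auto intro!: always_eventually expansion_continuous)
    qed (simp add: Xbar_def)
    show "AE \<omega> in Q. uniform_limit {0..1} (\<lambda>N t. partial_expansion \<Psi> \<xi> N t \<omega>) (\<lambda>t. Xbar t \<omega>) sequentially"
      using c(2) AE_space by eventually_elim (rule lim, simp add: good_def)
  qed
qed

lemma limit_gaussian:
  assumes J: "finite J" "J \<subseteq> {0..1}"
    and m: "\<And>t. t \<in> {0..1} \<Longrightarrow> Xbar t \<in> borel_measurable Q"
    and lim: "AE \<omega> in Q. uniform_limit {0..1} (\<lambda>N t. partial_expansion \<Psi> \<xi> N t \<omega>) (\<lambda>t. Xbar t \<omega>) sequentially"
  shows "gaussian_family Q J Xbar (\<lambda>s t. g s * g t * h (min s t))"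
proof (rule gaussian_family_limit[OF prob_space_axioms J(1) expansion_gaussian[OF J(1)]])
  fix t assume t: "t \<in> J"
  then show "Xbar t \<in> borel_measurable Q" using J by (intro m) auto
  show "AE x in Q. (\<lambda>n. partial_expansion \<Psi> \<xi> n t x) \<longlonglongrightarrow> Xbar t x"
    using lim
  proof eventually_elim
    case (elim x)
    show ?case by (rule tendsto_uniform_limitI[OF elim]) (use t J in auto)
  qed
next
  fix s t assume "s \<in> J" "t \<in> J"
  then show "(\<lambda>n. g s * g t * kernel n s t) \<longlonglongrightarrow> g s * g t * h (min s t)"
    using J by (intro tendsto_mult_left kernel_tendsto) auto
qed

end

section \<open>Functionals of continuous paths\<close>

text \<open>On the compact interval the boundedness demanded of members of \<open>C01\<close> is automatic.\<close>

lemma mem_C01: "x \<in> mspace C01 \<longleftrightarrow> x \<in> extensional {0..1} \<and> continuous_on {0..1} x"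
proof -
  have "Met_TC.mbounded (x ` {0..1})" if "continuous_on {0..1} x"
  proof -
    have "bounded (x ` {0..1})"
      by (rule compact_imp_bounded[OF compact_continuous_image[OF that compact_Icc]])
    then show ?thesis by simp
  qed
  then show ?thesis unfolding C01_def by auto
qed

lemma C01_tendsto:
  assumes \<phi>: "continuous_map (mtopology_of C01) euclideanreal \<phi>"
    and x: "\<And>n. x n \<in> mspace C01" "y \<in> mspace C01"
    and lim: "uniform_limit {0..1} x y sequentially"
  shows "(\<lambda>n. \<phi> (x n)) \<longlonglongrightarrow> \<phi> y"
proof -
  interpret Metric_space "mspace C01" "mdist C01" by simp
  have "limitin (mtopology_of C01) x y sequentially"
    unfolding mtopology_of_def limitin_metric
  proof (intro conjI allI impI)
    fix e :: real assume e: "0 < e"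
    have "\<forall>\<^sub>F n in sequentially. \<forall>t\<in>{0..1}. dist (x n t) (y t) < e / 2"
      by (rule lim[unfolded uniform_limit_iff, rule_format, OF half_gt_zero[OF e]])
    then show "\<forall>\<^sub>F n in sequentially. x n \<in> mspace C01 \<and> mdist C01 (x n) y < e"
    proof eventually_elim
      case (elim n)
      have "mdist C01 (x n) y \<le> e / 2"
        unfolding C01_def by (rule mdist_cfunspace_le) (use elim e in \<open>auto intro: less_imp_le\<close>)
      then show ?case using x e by simp
    qed
  qed (rule x)
  from continuous_map_limit[OF \<phi> this] show ?thesis by (simp add: comp_def)
qed

text \<open>The Bernstein polynomial with coefficients \<open>a\<close>. It replaces a path by one that depends on finitely
  many values only, through a continuous map from \<open>nat \<Rightarrow> real\<close> into \<open>C01\<close>.\<close>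

definition bernstein_path :: "nat \<Rightarrow> (nat \<Rightarrow> real) \<Rightarrow> real \<Rightarrow> real" where
  "bernstein_path n a = (\<lambda>t\<in>{0..1}. \<Sum>k\<le>n. a k * Bernstein n k t)"

lemma bernstein_path_C01: "bernstein_path n a \<in> mspace C01"
proof -
  have "continuous_on {0..1} (\<lambda>t. \<Sum>k\<le>n. a k * Bernstein n k t)"
    unfolding Bernstein_def by (intro continuous_intros)
  also have "?this \<longleftrightarrow> continuous_on {0..1} (bernstein_path n a)"
    by (rule continuous_on_cong) (simp_all add: bernstein_path_def)
  finally have "continuous_on {0..1} (bernstein_path n a)" .
  then show ?thesis unfolding mem_C01 by (simp add: bernstein_path_def)
qed

text \<open>On \<open>nat \<Rightarrow> real\<close> the Borel sets of the product topology are the product \<open>\<sigma>\<close>-algebra, so a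
  continuous functional of finitely many values is measurable with respect to them.\<close>

lemma bernstein_path_measurable:
  assumes \<phi>: "continuous_map (mtopology_of C01) euclideanreal \<phi>"
  shows "(\<lambda>a. \<phi> (bernstein_path n a)) \<in> borel_measurable borel"
proof (rule borel_measurable_continuous_onI, unfold continuous_on_sequentially, intro ballI allI impI, elim conjE)
  fix u :: "nat \<Rightarrow> nat \<Rightarrow> real" and a assume u: "u \<longlonglongrightarrow> a"
  have coord: "(\<lambda>m. u m k) \<longlonglongrightarrow> a k" for k
  proof -
    have "isCont (\<lambda>a :: nat \<Rightarrow> real. a k) a"
      by (rule continuous_on_interior[OF continuous_on_product_coordinates]) simp
    from isCont_tendsto_compose[OF this u] show ?thesis .
  qed
  have "(\<lambda>m. \<Sum>k\<le>n. \<bar>u m k - a k\<bar>) \<longlonglongrightarrow> (\<Sum>k\<le>n. \<bar>a k - a k\<bar>)" by (intro tendsto_intros coord)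
  then have l: "(\<lambda>m. \<Sum>k\<le>n. \<bar>u m k - a k\<bar>) \<longlonglongrightarrow> 0" by simp
  have "uniform_limit {0..1} (\<lambda>m. bernstein_path n (u m)) (bernstein_path n a) sequentially"
    unfolding uniform_limit_iff
  proof (intro allI impI)
    fix e :: real assume "0 < e"
    then have "\<forall>\<^sub>F m in sequentially. (\<Sum>k\<le>n. \<bar>u m k - a k\<bar>) < e" using order_tendstoD(2)[OF l] by simp
    then show "\<forall>\<^sub>F m in sequentially. \<forall>t\<in>{0..1}. dist (bernstein_path n (u m) t) (bernstein_path n a t) < e"
    proof eventually_elim
      case (elim m)
      show ?case
      proof
        fix t :: real assume t: "t \<in> {0..1}"
        have B: "0 \<le> Bernstein n k t" "Bernstein n k t \<le> 1" if "k \<le> n" for k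
        proof -
          show "0 \<le> Bernstein n k t" using t by (intro Bernstein_nonneg) auto
          have "Bernstein n k t \<le> (\<Sum>k\<le>n. Bernstein n k t)"
            using t that by (intro member_le_sum Bernstein_nonneg) auto
          then show "Bernstein n k t \<le> 1" by simp
        qed
        have "dist (bernstein_path n (u m) t) (bernstein_path n a t) = \<bar>\<Sum>k\<le>n. (u m k - a k) * Bernstein n k t\<bar>"
          using t by (simp add: bernstein_path_def dist_real_def sum_subtractf left_diff_distrib)
        also have "\<dots> \<le> (\<Sum>k\<le>n. \<bar>(u m k - a k) * Bernstein n k t\<bar>)" by (rule sum_abs)
        also have "\<dots> \<le> (\<Sum>k\<le>n. \<bar>u m k - a k\<bar>)"
          using B by (intro sum_mono) (simp add: abs_mult mult_left_le)
        finally show "dist (bernstein_path n (u m) t) (bernstein_path n a t) < e" using elim by simp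
      qed
    qed
  qed
  from C01_tendsto[OF \<phi> bernstein_path_C01 bernstein_path_C01 this]
  show "((\<lambda>a. \<phi> (bernstein_path n a)) \<circ> u) \<longlonglongrightarrow> \<phi> (bernstein_path n a)" by (simp add: comp_def)
qed

lemma bernstein_path_tendsto:
  assumes \<phi>: "continuous_map (mtopology_of C01) euclideanreal \<phi>" and x: "x \<in> mspace C01"
    and a: "\<And>n k. k \<le> n \<Longrightarrow> a n k = x (real k / real n)"
  shows "(\<lambda>n. \<phi> (bernstein_path n (a n))) \<longlonglongrightarrow> \<phi> x"
proof (rule C01_tendsto[OF \<phi> bernstein_path_C01 x])
  have c: "continuous_on {0..1} x" using x by (simp add: mem_C01)
  show "uniform_limit {0..1} (\<lambda>n. bernstein_path n (a n)) x sequentially"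
    unfolding uniform_limit_iff
  proof (intro allI impI)
    fix e :: real assume "0 < e"
    from Bernstein_Weierstrass[OF c this] obtain N where
      N: "\<And>n t. N \<le> n \<Longrightarrow> t \<in> {0..1} \<Longrightarrow> \<bar>x t - (\<Sum>k\<le>n. x (k / n) * Bernstein n k t)\<bar> < e" by blast
    show "\<forall>\<^sub>F n in sequentially. \<forall>t\<in>{0..1}. dist (bernstein_path n (a n) t) (x t) < e"
      unfolding eventually_sequentially
    proof (intro exI[of _ N] allI impI ballI)
      fix n t assume "N \<le> n" and t: "t \<in> {0..1 :: real}"
      then show "dist (bernstein_path n (a n) t) (x t) < e"
        using N[of n t] by (simp add: bernstein_path_def a dist_real_def abs_minus_commute)
    qed
  qed
qed

lemma sample_path_C01:
  assumes "continuous_on {0..1} (\<lambda>t. X t \<omega>)"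
  shows "sample_path X \<omega> \<in> mspace C01"
proof -
  have "continuous_on {0..1} (sample_path X \<omega>) \<longleftrightarrow> continuous_on {0..1} (\<lambda>t. X t \<omega>)"
    by (rule continuous_on_cong) (simp_all add: sample_path_def)
  then show ?thesis using assms unfolding mem_C01 by (simp add: sample_path_def)
qed

lemma sample_path_measurable:
  assumes m: "\<And>t. t \<in> {0..1} \<Longrightarrow> X t \<in> borel_measurable M"
    and c: "\<And>\<omega>. \<omega> \<in> space M \<Longrightarrow> continuous_on {0..1} (\<lambda>t. X t \<omega>)"
  shows "sample_path X \<in> measurable M C01_cylinder"
  unfolding C01_cylinder_def
proof (rule measurable_restrict_space2)
  show "sample_path X \<in> space M \<rightarrow> mspace C01" using sample_path_C01[OF c] by auto
  show "sample_path X \<in> measurable M (Pi\<^sub>M {0..1} (\<lambda>_. borel))"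
    unfolding sample_path_def[abs_def] by (rule measurable_restrict) (rule m)
qed

abbreviation grid_values :: "nat \<Rightarrow> (real \<Rightarrow> real) \<Rightarrow> nat \<Rightarrow> real" where
  "grid_values n x \<equiv> \<lambda>k. if k \<le> n then x (real k / real n) else 0"

lemma grid_mem: "k \<le> n \<Longrightarrow> real k / real n \<in> {0..1}"
  by (cases "n = 0") (auto simp: field_simps)

text \<open>A continuous functional is a pointwise limit of functionals of finitely many values. This gives
  measurability with respect to the cylinder sets without appeal to separability of \<open>C01\<close>.\<close>

lemma functional_measurable:
  assumes \<phi>: "continuous_map (mtopology_of C01) euclideanreal \<phi>"
    and m: "\<And>t. t \<in> {0..1} \<Longrightarrow> X t \<in> borel_measurable M"
    and c: "\<And>\<omega>. \<omega> \<in> space M \<Longrightarrow> continuous_on {0..1} (\<lambda>t. X t \<omega>)"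
  shows "(\<lambda>\<omega>. \<phi> (bernstein_path n (grid_values n (\<lambda>t. X t \<omega>)))) \<in> borel_measurable M"
    and "(\<lambda>\<omega>. \<phi> (sample_path X \<omega>)) \<in> borel_measurable M"
    and "\<omega> \<in> space M \<Longrightarrow> (\<lambda>n. \<phi> (bernstein_path n (grid_values n (\<lambda>t. X t \<omega>)))) \<longlonglongrightarrow> \<phi> (sample_path X \<omega>)"
proof -
  show 1: "(\<lambda>\<omega>. \<phi> (bernstein_path n (grid_values n (\<lambda>t. X t \<omega>)))) \<in> borel_measurable M" for n
  proof (rule measurable_compose[OF _ bernstein_path_measurable[OF \<phi>]], rule measurable_coordinatewise_then_product)
    show "(\<lambda>\<omega>. if k \<le> n then X (real k / real n) \<omega> else 0) \<in> borel_measurable M" for k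
      using m[OF grid_mem[of k n]] by (cases "k \<le> n") auto
  qed
  show 2: "(\<lambda>n. \<phi> (bernstein_path n (grid_values n (\<lambda>t. X t \<omega>)))) \<longlonglongrightarrow> \<phi> (sample_path X \<omega>)"
    if "\<omega> \<in> space M" for \<omega>
    by (rule bernstein_path_tendsto[OF \<phi> sample_path_C01[where X=X, OF c[OF that]]])
       (use grid_mem in \<open>auto simp: sample_path_def\<close>)
  show "(\<lambda>\<omega>. \<phi> (sample_path X \<omega>)) \<in> borel_measurable M"
    by (rule borel_measurable_LIMSEQ_real[OF 2 1])
qed

text \<open>The Bernstein approximations have equal expectations by equality of the finite-dimensional laws,
  and dominated convergence transfers this to \<open>\<phi>\<close> itself.\<close>

lemma same_fdd_functional:
  assumes M: "prob_space M" and Q: "prob_space Q"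
    and \<phi>: "continuous_map (mtopology_of C01) euclideanreal \<phi>" and B: "\<And>x. x \<in> mspace C01 \<Longrightarrow> \<bar>\<phi> x\<bar> \<le> B"
    and mX: "\<And>t. t \<in> {0..1} \<Longrightarrow> X t \<in> borel_measurable M"
    and cX: "\<And>\<omega>. \<omega> \<in> space M \<Longrightarrow> continuous_on {0..1} (\<lambda>t. X t \<omega>)"
    and mY: "\<And>t. t \<in> {0..1} \<Longrightarrow> Y t \<in> borel_measurable Q"
    and cY: "\<And>\<omega>. \<omega> \<in> space Q \<Longrightarrow> continuous_on {0..1} (\<lambda>t. Y t \<omega>)"
    and fdd: "same_fdd Q Y M X"
  shows "(\<integral>\<omega>. \<phi> (sample_path Y \<omega>) \<partial>Q) = (\<integral>\<omega>. \<phi> (sample_path X \<omega>) \<partial>M)"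
proof -
  have lim: "(\<lambda>n. \<integral>\<omega>. \<phi> (bernstein_path n (grid_values n (\<lambda>t. Z t \<omega>))) \<partial>P) \<longlonglongrightarrow> (\<integral>\<omega>. \<phi> (sample_path Z \<omega>) \<partial>P)"
    if P: "prob_space P" and m: "\<And>t. t \<in> {0..1} \<Longrightarrow> Z t \<in> borel_measurable P"
      and c: "\<And>\<omega>. \<omega> \<in> space P \<Longrightarrow> continuous_on {0..1} (\<lambda>t. Z t \<omega>)" for P :: "'z measure" and Z
  proof -
    interpret prob_space P by fact
    show ?thesis
      by (rule integral_dominated_convergence[where w="\<lambda>_. B"])
         (use functional_measurable[OF \<phi> m c] B bernstein_path_C01 in auto)
  qed
  have eq: "(\<integral>\<omega>. \<phi> (bernstein_path n (grid_values n (\<lambda>t. Y t \<omega>))) \<partial>Q) =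
      (\<integral>\<omega>. \<phi> (bernstein_path n (grid_values n (\<lambda>t. X t \<omega>))) \<partial>M)" for n
  proof -
    define J where "J = (\<lambda>k. real k / real n) ` {..n}"
    have J: "finite J" "J \<subseteq> {0..1}" using grid_mem by (auto simp: J_def)
    have kJ: "k \<le> n \<Longrightarrow> real k / real n \<in> J" for k by (auto simp: J_def)
    let ?F = "\<lambda>z. \<phi> (bernstein_path n (grid_values n z))"
    have F: "?F \<in> borel_measurable (Pi\<^sub>M J (\<lambda>_. borel))"
    proof (rule measurable_compose[OF _ bernstein_path_measurable[OF \<phi>]], rule measurable_coordinatewise_then_product)
      show "(\<lambda>z. if k \<le> n then z (real k / real n) else 0) \<in> borel_measurable (Pi\<^sub>M J (\<lambda>_. borel))" for k
        using kJ[of k] by (cases "k \<le> n") auto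
    qed
    have red: "(\<integral>\<omega>. ?F (\<lambda>t. Z t \<omega>) \<partial>P) = (\<integral>z. ?F z \<partial>distr P (Pi\<^sub>M J (\<lambda>_. borel)) (\<lambda>\<omega>. \<lambda>t\<in>J. Z t \<omega>))"
      if m: "\<And>t. t \<in> {0..1} \<Longrightarrow> Z t \<in> borel_measurable P" for P :: "'z measure" and Z
    proof -
      have "(\<lambda>\<omega>. \<lambda>t\<in>J. Z t \<omega>) \<in> measurable P (Pi\<^sub>M J (\<lambda>_. borel))"
        by (rule measurable_restrict) (use m J in auto)
      from integral_distr[OF this F] show ?thesis using kJ by (simp cong: if_cong)
    qed
    have d: "distr Q (Pi\<^sub>M J (\<lambda>_. borel)) (\<lambda>\<omega>. \<lambda>t\<in>J. Y t \<omega>) = distr M (Pi\<^sub>M J (\<lambda>_. borel)) (\<lambda>\<omega>. \<lambda>t\<in>J. X t \<omega>)"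
      using fdd J unfolding same_fdd_def by blast
    show ?thesis
      by (rule trans[OF red[OF mY] trans[OF _ red[OF mX, symmetric]]]) (simp_all only: d)
  qed
  show ?thesis
    using lim[OF Q mY cY] lim[OF M mX cX] unfolding eq by (rule LIMSEQ_unique)
qed

lemma uniform_limit_functional:
  assumes Q: "prob_space Q"
    and \<phi>: "continuous_map (mtopology_of C01) euclideanreal \<phi>" and B: "\<And>x. x \<in> mspace C01 \<Longrightarrow> \<bar>\<phi> x\<bar> \<le> B"
    and mZ: "\<And>N t. t \<in> {0..1} \<Longrightarrow> Z N t \<in> borel_measurable Q"
    and cZ: "\<And>N \<omega>. \<omega> \<in> space Q \<Longrightarrow> continuous_on {0..1} (\<lambda>t. Z N t \<omega>)"
    and mY: "\<And>t. t \<in> {0..1} \<Longrightarrow> Y t \<in> borel_measurable Q"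
    and cY: "\<And>\<omega>. \<omega> \<in> space Q \<Longrightarrow> continuous_on {0..1} (\<lambda>t. Y t \<omega>)"
    and lim: "AE \<omega> in Q. uniform_limit {0..1} (\<lambda>N t. Z N t \<omega>) (\<lambda>t. Y t \<omega>) sequentially"
  shows "(\<lambda>N. \<integral>\<omega>. \<phi> (sample_path (Z N) \<omega>) \<partial>Q) \<longlonglongrightarrow> (\<integral>\<omega>. \<phi> (sample_path Y \<omega>) \<partial>Q)"
proof -
  interpret prob_space Q by fact
  show ?thesis
  proof (rule integral_dominated_convergence[where w="\<lambda>_. B"])
    show "(\<lambda>\<omega>. \<phi> (sample_path Y \<omega>)) \<in> borel_measurable Q" by (rule functional_measurable(2)[OF \<phi> mY cY])
    show "(\<lambda>\<omega>. \<phi> (sample_path (Z N) \<omega>)) \<in> borel_measurable Q" for N by (rule functional_measurable(2)[OF \<phi> mZ cZ])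
    show "AE \<omega> in Q. (\<lambda>N. \<phi> (sample_path (Z N) \<omega>)) \<longlonglongrightarrow> \<phi> (sample_path Y \<omega>)"
      using lim AE_space
    proof eventually_elim
      case (elim \<omega>)
      have "uniform_limit {0..1} (\<lambda>N. sample_path (Z N) \<omega>) (sample_path Y \<omega>) sequentially"
        using elim(1) unfolding uniform_limit_iff sample_path_def by simp
      then show ?case
        by (intro C01_tendsto[OF \<phi>] sample_path_C01 cZ cY elim(2))
    qed
    show "AE \<omega> in Q. norm (\<phi> (sample_path (Z N) \<omega>)) \<le> B" for N
      using AE_space
    proof eventually_elim
      case (elim \<omega>)
      show ?case using B[OF sample_path_C01[where X="Z N", OF cZ[OF elim]]] by simp
    qed
  qed simp
qed

section \<open>Conditioning on the dyadic grid\<close>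

text \<open>The law is that of a multiple of a standard normal variable, and integrability depends on the law
  only.\<close>

lemma gaussian_family_integrable:
  assumes M: "prob_space M" and Y: "gaussian_family M {t} Y C" and C: "0 \<le> C t t"
  shows "integrable M (Y t)"
proof -
  let ?P = "std_normal_distribution"
  interpret P: real_distribution ?P by (rule real_dist_normal_dist)
  let ?Z = "\<lambda>_ x :: real. sqrt (C t t) * x"
  have "gaussian_family ?P {t} ?Z C"
    unfolding gaussian_family_def
  proof (intro conjI ballI allI)
    fix c :: "'b \<Rightarrow> real"
    have "(CLINT x|?P. iexp (\<Sum>j\<in>{t}. c j * ?Z j x)) = char ?P (c t * sqrt (C t t))"
      by (simp add: char_def mult.assoc)
    then show "(CLINT x|?P. iexp (\<Sum>j\<in>{t}. c j * ?Z j x)) =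
       complex_of_real (exp (- (\<Sum>i\<in>{t}. \<Sum>j\<in>{t}. c i * c j * C i j) / 2))"
      using C by (simp add: char_std_normal_distribution power_mult_distrib power2_eq_square)
  qed simp
  from gaussian_family_distr_eq1[OF M P.prob_space_axioms Y this]
  have d: "distr M borel (Y t) = distr ?P borel (?Z t)" .
  have "integrable ?P (\<lambda>x. sqrt (C t t) * x)"
    using integrable_std_normal_distribution_moment[of 1] by simp
  then have "integrable (distr ?P borel (?Z t)) (\<lambda>x. x)" by (subst integrable_distr_eq) auto
  then have "integrable (distr M borel (Y t)) (\<lambda>x. x)" by (simp only: d)
  then show ?thesis
    using gaussian_familyD(1)[OF Y, of t] by (subst (asm) integrable_distr_eq) auto
qed

lemma space_sigma_generated: "space (sigma_generated M Y K) = space M"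
  by (simp add: sigma_generated_def space_measure_of_conv)

lemma sigma_generated_measurable:
  assumes "k \<in> K" shows "Y k \<in> borel_measurable (sigma_generated M Y K)"
proof (rule measurableI)
  fix A :: "real set" assume "A \<in> sets borel"
  then show "Y k -` A \<inter> space (sigma_generated M Y K) \<in> sets (sigma_generated M Y K)"
    unfolding space_sigma_generated using assms unfolding sigma_generated_def
    by (subst sets_measure_of) (auto intro!: sigma_sets.Basic)
qed simp

lemma sigma_generated_subalgebra:
  assumes "\<And>k. k \<in> K \<Longrightarrow> Y k \<in> borel_measurable M"
  shows "subalgebra M (sigma_generated M Y K)"
proof -
  have "sets (sigma_generated M Y K) \<subseteq> sets M"
    unfolding sigma_generated_def
    by (subst sets_measure_of) (use assms in \<open>auto intro!: sets.sigma_sets_subset measurable_sets\<close>)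
  then show ?thesis unfolding subalgebra_def by (simp add: space_sigma_generated)
qed

lemma sigma_generated_sets:
  assumes "A \<in> sets (sigma_generated M Y K)"
  shows "\<exists>B\<in>sets (Pi\<^sub>M K (\<lambda>_. borel)). A = {x\<in>space M. (\<lambda>k\<in>K. Y k x) \<in> B}"
proof -
  let ?v = "\<lambda>x. \<lambda>k\<in>K. Y k x"
  have v: "?v \<in> space M \<rightarrow> space (Pi\<^sub>M K (\<lambda>_. borel))" by (auto simp: space_PiM)
  let ?V = "vimage_algebra (space M) ?v (Pi\<^sub>M K (\<lambda>_. borel))"
  have "sets (sigma_generated M Y K) \<subseteq> sets ?V"
    unfolding sigma_generated_def
  proof (subst sets_measure_of)
    let ?G = "\<Union>i\<in>K. {Y i -` A \<inter> space M |A. A \<in> sets (borel :: real measure)}"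
    have "?G \<subseteq> sets ?V"
    proof (rule subsetI, elim UN_E CollectE exE conjE)
      fix E k and A :: "real set" assume k: "k \<in> K" and E: "E = Y k -` A \<inter> space M" and A: "A \<in> sets borel"
      have "(\<lambda>z. z k) -` A \<inter> space (Pi\<^sub>M K (\<lambda>_. borel)) \<in> sets (Pi\<^sub>M K (\<lambda>_. borel :: real measure))"
        using k A by (intro measurable_sets[OF measurable_component_singleton]) auto
      then have "?v -` ((\<lambda>z. z k) -` A \<inter> space (Pi\<^sub>M K (\<lambda>_. borel))) \<inter> space M \<in> sets ?V"
        by (rule in_vimage_algebra)
      also have "?v -` ((\<lambda>z. z k) -` A \<inter> space (Pi\<^sub>M K (\<lambda>_. borel))) \<inter> space M = Y k -` A \<inter> space M"
        using k by (auto simp: space_PiM)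
      finally show "E \<in> sets ?V" by (simp only: E)
    qed
    from sets.sigma_sets_subset[OF this] show "sigma_sets (space M) ?G \<subseteq> sets ?V"
      by (simp only: space_vimage_algebra)
  qed auto
  with assms have "A \<in> sets ?V" by auto
  then obtain B where "B \<in> sets (Pi\<^sub>M K (\<lambda>_. borel))" "A = ?v -` B \<inter> space M"
    unfolding sets_vimage_algebra2[OF v] by auto
  then show ?thesis by auto
qed

text \<open>Symmetry replaces independence: if \<open>R\<close> is uncorrelated with all \<open>Y k\<close>, then changing \<open>R\<close> into \<open>- R\<close>
  preserves the covariance and hence the joint law, so the integral of \<open>R\<close> over an event determined by
  \<open>Y\<close> equals its own negative. The index \<open>None\<close> stands for \<open>R\<close>.\<close>

lemma gaussian_orthogonal_integral_zero:
  fixes R :: "'a \<Rightarrow> real" and Y :: "'i \<Rightarrow> 'a \<Rightarrow> real"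
  assumes M: "prob_space M" and K: "finite K"
    and G: "gaussian_family M (insert None (Some ` K)) (case_option R Y) B"
    and orth: "\<And>k. k \<in> K \<Longrightarrow> B None (Some k) = 0 \<and> B (Some k) None = 0"
    and A: "A \<in> sets (sigma_generated M Y K)"
  shows "(LINT x|M. R x * indicator A x) = 0"
proof -
  let ?J = "insert None (Some ` K)"
  let ?P = "Pi\<^sub>M ?J (\<lambda>_. borel :: real measure)"
  define s :: "'i option \<Rightarrow> real" where "s a = (if a = None then -1 else 1)" for a
  let ?Z = "case_option R Y"
  let ?Z' = "\<lambda>a x. s a * ?Z a x"
  have G': "gaussian_family M ?J ?Z' B"
    by (rule gaussian_family_cov_cong[OF gaussian_family_scale[OF G, of s]]) (auto simp: s_def orth)
  have d: "distr M ?P (\<lambda>x. \<lambda>a\<in>?J. ?Z a x) = distr M ?P (\<lambda>x. \<lambda>a\<in>?J. ?Z' a x)"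
    by (rule gaussian_family_distr_eq[OF M M _ G G']) (use K in simp)
  obtain S where S: "S \<in> sets (Pi\<^sub>M K (\<lambda>_. borel))" "A = {x\<in>space M. (\<lambda>k\<in>K. Y k x) \<in> S}"
    using sigma_generated_sets[OF A] by blast
  define F :: "('i option \<Rightarrow> real) \<Rightarrow> real" where "F z = z None * indicator S (\<lambda>k\<in>K. z (Some k))" for z
  have F: "F \<in> borel_measurable ?P"
  proof -
    have "(\<lambda>z. \<lambda>k\<in>K. z (Some k)) \<in> measurable ?P (Pi\<^sub>M K (\<lambda>_. borel))"
      by (rule measurable_restrict) (rule measurable_component_singleton, simp)
    from measurable_compose[OF this borel_measurable_indicator[OF S(1)]]
    have "(\<lambda>z. indicator S (\<lambda>k\<in>K. z (Some k)) :: real) \<in> borel_measurable ?P" .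
    moreover have "(\<lambda>z. z None) \<in> borel_measurable ?P" by (rule measurable_component_singleton) simp
    ultimately show ?thesis unfolding F_def by (intro borel_measurable_times)
  qed
  have m: "(\<lambda>x. \<lambda>a\<in>?J. ?Z a x) \<in> measurable M ?P" "(\<lambda>x. \<lambda>a\<in>?J. ?Z' a x) \<in> measurable M ?P"
    by (rule measurable_restrict, erule gaussian_familyD(1)[OF G])
       (rule measurable_restrict, erule gaussian_familyD(1)[OF G'])
  have "(LINT x|M. F (\<lambda>a\<in>?J. ?Z a x)) = (LINT x|M. F (\<lambda>a\<in>?J. ?Z' a x))"
    using integral_distr[OF m(1) F] integral_distr[OF m(2) F] d by simp
  moreover have "(LINT x|M. F (\<lambda>a\<in>?J. ?Z a x)) = (LINT x|M. R x * indicator A x)"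
    by (intro Bochner_Integration.integral_cong refl) (auto simp: F_def S(2) indicator_def cong: restrict_cong)
  moreover have "(LINT x|M. F (\<lambda>a\<in>?J. ?Z' a x)) = (LINT x|M. - (R x * indicator A x))"
    by (intro Bochner_Integration.integral_cong refl) (auto simp: F_def S(2) s_def indicator_def cong: restrict_cong)
  ultimately show ?thesis by simp
qed

context time_change
begin

text \<open>On a cell \<open>[l, r]\<close> of the grid the conditional expectation is \<open>L\<close>, the process \<open>X / g\<close> interpolated
  linearly in the clock and multiplied by \<open>g t\<close>: the residual \<open>X t - L\<close> is uncorrelated with all grid
  values. The variance of \<open>L\<close> is the diagonal value of the kernel.\<close>

lemma conditional_expectation_law:
  fixes N :: nat
  assumes M: "prob_space M"
    and G: "\<And>J. finite J \<Longrightarrow> J \<subseteq> {0..1} \<Longrightarrow> gaussian_family M J X (\<lambda>s t. g s * g t * h (min s t))"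
    and g: "\<And>t. t \<in> {0..1} \<Longrightarrow> g t \<noteq> 0"
    and t: "t \<in> {0..1}"
  defines "\<F> \<equiv> sigma_generated M (\<lambda>k::nat. X (real k / 2 ^ N)) {0..2 ^ N}"
  shows "gaussian_family M {t} (\<lambda>_. real_cond_exp M \<F> (X t)) (\<lambda>_ _. g t * g t * kernel N t t)"
proof -
  interpret prob_space M by fact
  obtain j where j: "j < (2::nat) ^ N" and tc: "t \<in> {real j / 2 ^ N..(real j + 1) / 2 ^ N}"
    by (rule dyadic_cell[OF t])
  define l r where "l = real j / 2 ^ N" and "r = real (Suc j) / 2 ^ N"
  have r': "r = (real j + 1) / 2 ^ N" by (simp add: r_def add.commute)
  define K where "K = {0..(2::nat) ^ N}"
  define p where "p k = real k / 2 ^ N" for k :: nat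
  have p: "p k \<in> {0..1}" if "k \<in> K" for k
  proof -
    have "real k \<le> real (2 ^ N)" using that unfolding K_def by (simp only: of_nat_le_iff atLeastAtMost_iff)
    then show ?thesis by (simp add: p_def field_simps)
  qed
  have jK: "j \<in> K" "Suc j \<in> K" and pj: "p j = l" "p (Suc j) = r" using j by (auto simp: K_def p_def l_def r_def)
  have lr: "0 \<le> l" "l \<le> t" "t \<le> r" "r \<le> 1" "l < r"
    using p[OF jK(1)] p[OF jK(2)] tc pj by (auto simp: l_def r' divide_strict_right_mono)
  have gl: "g l \<noteq> 0" "g r \<noteq> 0" using g p jK pj by metis+
  define T where "T = insert t (p ` K)"
  have T: "finite T" "T \<subseteq> {0..1}" using p t by (auto simp: T_def K_def)
  have inT: "t \<in> T" "l \<in> T" "r \<in> T" "\<And>k. k \<in> K \<Longrightarrow> p k \<in> T"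
    using jK pj by (auto simp: T_def)
  define \<alpha> where "\<alpha> = (h t - h l) / (h r - h l)"
  have hlr: "h l < h r" using h_less lr by simp
  define L where "L x = g t * ((1 - \<alpha>) / g l) * X l x + g t * (\<alpha> / g r) * X r x" for x
  \<comment> \<open>the coefficients of \<open>L\<close> as a combination of the variables \<open>X u\<close>, \<open>u \<in> T\<close>; \<open>t\<close> may coincide with a grid point\<close>
  define a where "a u = (if u = l then g t * ((1 - \<alpha>) / g l) else 0) + (if u = r then g t * (\<alpha> / g r) else 0)" for u
  have sum_a: "(\<Sum>u\<in>T. a u * F u) = g t * ((1 - \<alpha>) / g l) * F l + g t * (\<alpha> / g r) * F r" for F :: "real \<Rightarrow> real"
  proof -
    have "(\<Sum>u\<in>T. a u * F u) = (\<Sum>u\<in>T. if u = l then g t * ((1 - \<alpha>) / g l) * F u else 0) + (\<Sum>u\<in>T. if u = r then g t * (\<alpha> / g r) * F u else 0)"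
      unfolding sum.distrib[symmetric] by (intro sum.cong refl) (auto simp: a_def ring_distribs)
    then show ?thesis using T inT by simp
  qed
  have sum_1: "(\<Sum>u\<in>T. (if u = v then 1 else 0) * F u) = F v" if "v \<in> T" for v and F :: "real \<Rightarrow> real"
  proof -
    have "(\<Sum>u\<in>T. (if u = v then 1 else 0) * F u) = (\<Sum>u\<in>T. if u = v then F u else 0)"
      by (intro sum.cong refl) auto
    then show ?thesis using T that by simp
  qed
  let ?C = "\<lambda>s u. g s * g u * h (min s u)"
  have lin: "(\<Sum>u\<in>T. a u * ?C u v) = g t * g v * ((1 - \<alpha>) * h (min l v) + \<alpha> * h (min r v))" for v
    unfolding sum_a using gl by (simp add: field_simps)
  have GL: "gaussian_family M {t} (\<lambda>_. L) (\<lambda>_ _. g t * g t * kernel N t t)"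
  proof -
    have "gaussian_family M {t} (\<lambda>_ x. \<Sum>u\<in>T. a u * X u x) (\<lambda>_ _. \<Sum>u\<in>T. \<Sum>v\<in>T. a u * a v * ?C u v)"
      by (rule gaussian_family_linear[OF G[OF T] T(1)]) simp
    also have "(\<lambda>_ x. \<Sum>u\<in>T. a u * X u x) = (\<lambda>_. L)"
      by (intro ext) (simp add: sum_a L_def)
    also have "(\<Sum>u\<in>T. \<Sum>v\<in>T. a u * a v * ?C u v) = g t * g t * kernel N t t"
    proof -
      have "(\<Sum>u\<in>T. \<Sum>v\<in>T. a u * a v * ?C u v) = (\<Sum>v\<in>T. a v * (\<Sum>u\<in>T. a u * ?C u v))"
        by (subst sum.swap) (simp add: sum_distrib_left ac_simps)
      also have "\<dots> = g t * ((1 - \<alpha>) / g l) * (g t * g l * ((1 - \<alpha>) * h l + \<alpha> * h l)) + g t * (\<alpha> / g r) * (g t * g r * ((1 - \<alpha>) * h l + \<alpha> * h r))"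
        unfolding lin sum_a using lr by (simp add: min_def)
      also have "\<dots> = g t * g t * (h l + \<alpha> * (\<alpha> * (h r - h l)))"
        using gl by (simp add: field_simps)
      also have "\<alpha> * (\<alpha> * (h r - h l)) = (h t - h l) * (h t - h l) / (h r - h l)"
        using hlr by (simp add: \<alpha>_def)
      also have "h l + (h t - h l) * (h t - h l) / (h r - h l) = kernel N t t"
        using kernel_cell[OF j tc tc] by (simp add: l_def r')
      finally show ?thesis .
    qed
    finally show ?thesis .
  qed
  have Xm: "X u \<in> borel_measurable M" if "u \<in> {0..1}" for u
    using gaussian_familyD(1)[OF G[of "{u}"], of u] that by simp
  have Xi: "integrable M (X u)" if u: "u \<in> {0..1}" for u
    by (rule gaussian_family_integrable[OF M G])
       (use u h_le[of 0 u] h_zero in \<open>auto intro!: mult_nonneg_nonneg\<close>)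
  have Li: "integrable M L"
    unfolding L_def using Xi lr by (intro Bochner_Integration.integrable_add integrable_mult_right) auto
  define A where "A b u = (case b of None \<Rightarrow> (if u = t then 1 else 0) - a u | Some k \<Rightarrow> (if u = p k then 1 else 0))" for b u
  define B where "B b c = (\<Sum>u\<in>T. \<Sum>v\<in>T. A b u * A c v * ?C u v)" for b c
  have fam: "gaussian_family M (insert None (Some ` K)) (case_option (\<lambda>x. X t x - L x) (\<lambda>k. X (p k))) B"
  proof -
    have "gaussian_family M (insert None (Some ` K)) (\<lambda>b x. \<Sum>u\<in>T. A b u * X u x) B"
      unfolding B_def by (rule gaussian_family_linear[OF G[OF T] T(1)]) (simp add: K_def)
    then show ?thesis
    proof (rule gaussian_family_AE_cong)
      fix b assume b: "b \<in> insert None (Some ` K)"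
      show "case_option (\<lambda>x. X t x - L x) (\<lambda>k. X (p k)) b \<in> borel_measurable M"
        using b p Xm[OF t] Xm borel_measurable_integrable[OF Li] by auto
      have "(\<Sum>u\<in>T. A b u * X u x) = case_option (\<lambda>x. X t x - L x) (\<lambda>k. X (p k)) b x" for x
      proof (cases b)
        case None
        then show ?thesis by (simp add: A_def left_diff_distrib sum_subtractf sum_a sum_1 inT L_def)
      next
        case (Some k)
        then show ?thesis using b inT by (auto simp: A_def sum_1)
      qed
      then show "AE x in M. (\<Sum>u\<in>T. A b u * X u x) = case_option (\<lambda>x. X t x - L x) (\<lambda>k. X (p k)) b x" by simp
    qed (simp add: K_def)
  qed
  have half: "(\<Sum>u\<in>T. A None u * ?C u (p k)) = 0" if k: "k \<in> K" for k
  proof -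
    \<comment> \<open>no grid point lies inside the cell of \<open>t\<close>\<close>
    have "p k \<le> l \<or> r \<le> p k"
      unfolding p_def l_def r_def by (cases "k \<le> j") (auto intro!: divide_right_mono)
    then have "(1 - \<alpha>) * h (min l (p k)) + \<alpha> * h (min r (p k)) = h (min t (p k))"
    proof
      assume "p k \<le> l"
      then have "min l (p k) = p k" "min r (p k) = p k" "min t (p k) = p k" using lr by simp_all
      then show ?thesis by (simp add: algebra_simps)
    next
      assume *: "r \<le> p k"
      have "(1 - \<alpha>) * h l + \<alpha> * h r = h l + \<alpha> * (h r - h l)" by (simp add: algebra_simps)
      also have "\<dots> = h t" using hlr by (simp add: \<alpha>_def)
      finally show ?thesis using * lr by (simp add: min_def)
    qed
    then show ?thesis
      unfolding A_def option.case left_diff_distrib sum_subtractf lin sum_1[OF inT(1)] by simp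
  qed
  have orth: "B None (Some k) = 0 \<and> B (Some k) None = 0" if k: "k \<in> K" for k
  proof -
    have "B None (Some k) = (\<Sum>v\<in>T. (if v = p k then 1 else 0) * (\<Sum>u\<in>T. A None u * ?C u v))"
      unfolding B_def by (subst sum.swap) (simp add: A_def sum_distrib_left ac_simps)
    also have "\<dots> = 0" using sum_1[OF inT(4)[OF k], of "\<lambda>v. \<Sum>u\<in>T. A None u * ?C u v"] half[OF k] by simp
    finally have 1: "B None (Some k) = 0" .
    have "B (Some k) None = B None (Some k)"
      unfolding B_def by (subst sum.swap) (simp add: ac_simps min.commute)
    with 1 show ?thesis by simp
  qed
  have F: "\<F> = sigma_generated M (\<lambda>k. X (p k)) K" by (simp add: \<F>_def K_def p_def)
  have sub: "subalgebra M \<F>"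
    unfolding F by (rule sigma_generated_subalgebra) (use p Xm in auto)
  interpret finite_measure_subalgebra M \<F> by unfold_locales (rule sub)
  have "AE x in M. real_cond_exp M \<F> (X t) x = L x"
  proof (rule real_cond_exp_charact)
    show "integrable M (X t)" "integrable M L" using Xi t Li by auto
    show "L \<in> borel_measurable \<F>"
    proof -
      have "X l \<in> borel_measurable \<F>" "X r \<in> borel_measurable \<F>"
        using sigma_generated_measurable[of j K "\<lambda>k. X (p k)" M] sigma_generated_measurable[of "Suc j" K "\<lambda>k. X (p k)" M] jK
        unfolding F by (simp_all add: pj)
      then show ?thesis unfolding L_def by (intro borel_measurable_add borel_measurable_times borel_measurable_const)
    qed
    fix S assume S: "S \<in> sets \<F>"
    then have SM: "S \<in> sets M" using sub unfolding subalgebra_def by auto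
    have "(LINT x|M. (X t x - L x) * indicator S x) = 0"
      by (rule gaussian_orthogonal_integral_zero[OF M _ fam orth S[unfolded F]]) (auto simp: K_def)
    moreover have "integrable M (\<lambda>x. X t x * indicator S x)" "integrable M (\<lambda>x. L x * indicator S x)"
      using integrable_real_mult_indicator[OF SM] Xi[OF t] Li by simp_all
    ultimately have "(LINT x|M. X t x * indicator S x) = (LINT x|M. L x * indicator S x)"
      by (simp add: left_diff_distrib)
    then show "(LINT x:S|M. X t x) = (LINT x:S|M. L x)"
      unfolding set_lebesgue_integral_def by (simp add: mult.commute)
  qed
  then show ?thesis
    by (intro gaussian_family_AE_cong[OF GL]) (auto intro: borel_measurable_cond_exp2)
qed

end

section \<open>The expansion theorem\<close>

theorem mainTheorem1:
  fixes M :: "'a measure" and F :: "real \<Rightarrow> 'a measure"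
    and X W :: "real \<Rightarrow> 'a \<Rightarrow> real"
    and f g :: "real \<Rightarrow> real"
    and Q :: "'b measure" and \<xi> :: "nat \<Rightarrow> nat \<Rightarrow> 'b \<Rightarrow> real"
  assumes M: "prob_space M"
    and filtration: "filtration01 M F"
    and adapted: "adapted01 F X"
    and X_paths: "\<forall>\<omega>\<in>space M. continuous_on {0..1} (\<lambda>t. X t \<omega>)"
    and f: "continuous_on {0..1} f" "\<forall>t\<in>{0..1}. f t \<noteq> 0"
    and g: "continuous_on {0..1} g" "\<forall>t\<in>{0..1}. g t \<noteq> 0"
    and W: "wiener_process01 M W"
    and X_eq: "\<forall>t\<in>{0..1}. \<exists>I. is_wiener_integral M W f t I \<and> (AE \<omega> in M. X t \<omega> = g t * I \<omega>)"
    and Q: "prob_space Q"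
    and \<xi>_normal: "\<forall>(n, k)\<in>dyadic_index. distributed Q lborel (\<xi> n k) (normal_density 0 1)"
    and \<xi>_indep: "prob_space.indep_vars Q (\<lambda>_. borel) (\<lambda>(n, k). \<xi> n k) dyadic_index"
  shows "\<exists>\<Psi> :: nat \<Rightarrow> nat \<Rightarrow> real \<Rightarrow> real.
    (\<forall>(n, k)\<in>dyadic_index. continuous_on {0..1} (\<Psi> n k) \<and>
       (\<forall>t\<in>{0..1}. \<Psi> n k t = explicit_Psi f g n k t)) \<and>
    (\<forall>(n, k)\<in>dyadic_index. closure {t\<in>{0..1}. \<Psi> n k t \<noteq> 0} \<subseteq> dyadic_support n k) \<and>
    (\<forall>N. \<forall>t\<in>{0..1}.
       distr Q borel (partial_expansion \<Psi> \<xi> N t) =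
       distr M borel
         (real_cond_exp M (sigma_generated M (\<lambda>k::nat. X (real k / 2 ^ N)) {0..2 ^ N}) (X t))) \<and>
    (\<exists>Xbar :: real \<Rightarrow> 'b \<Rightarrow> real.
       (\<forall>t\<in>{0..1}. Xbar t \<in> borel_measurable Q) \<and>
       (\<forall>\<omega>\<in>space Q. continuous_on {0..1} (\<lambda>t. Xbar t \<omega>)) \<and>
       (AE \<omega> in Q. \<forall>t\<in>{0..1}. (\<lambda>N. partial_expansion \<Psi> \<xi> N t \<omega>) \<longlonglongrightarrow> Xbar t \<omega>) \<and>
       same_fdd Q Xbar M X) \<and>
    converges_in_distribution_C01 Q (partial_expansion \<Psi> \<xi>) M X"
proof -
  obtain C where C: "time_change (energy f) C" using energy_time_change[OF f] by blast
  interpret time_change "energy f" C by (rule C)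
  interpret Q: prob_space Q by (rule Q)
  interpret gaussian_expansion Q \<xi> "energy f" C g
    by unfold_locales (use \<xi>_normal \<xi>_indep g in auto)
  define \<Psi>' where "\<Psi>' n k t = g t * schauder n k t" for n k t
  have \<Psi>': "\<Psi>' = \<Psi>" by (intro ext) (simp add: \<Psi>'_def)
  have Xm: "X t \<in> borel_measurable M" if "t \<in> {0..1}" for t
  proof -
    have "X t \<in> borel_measurable (F t)" "subalgebra M (F t)"
      using adapted filtration that unfolding adapted01_def filtration01_def by auto
    then show ?thesis by (rule measurable_from_subalg[rotated])
  qed
  have Xc: "continuous_on {0..1} (\<lambda>t. X t \<omega>)" if "\<omega> \<in> space M" for \<omega> using X_paths that by blast
  obtain I where I: "\<And>t. t \<in> {0..1} \<Longrightarrow> is_wiener_integral M W f t (I t)"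
    "\<And>t. t \<in> {0..1} \<Longrightarrow> AE \<omega> in M. X t \<omega> = g t * I t \<omega>"
    using bchoice[OF X_eq] by blast
  have XG: "gaussian_family M J X (\<lambda>s t. g s * g t * energy f (min s t))" if J: "finite J" "J \<subseteq> {0..1}" for J
  proof (rule gaussian_family_AE_cong[OF gaussian_family_scale J(1)])
    show "gaussian_family M J I (\<lambda>s t. energy f (min s t))"
      by (rule wiener_integral_gaussian[OF M W f(1) J I(1)]) (use J in auto)
    show "X t \<in> borel_measurable M" if "t \<in> J" for t using Xm J that by auto
    show "AE \<omega> in M. g t * I t \<omega> = X t \<omega>" if "t \<in> J" for t
    proof -
      have "t \<in> {0..1}" using J that by auto
      from I(2)[OF this] show ?thesis by eventually_elim simp
    qed
  qed
  have "\<exists>Xbar. (\<forall>t\<in>{0..1}. Xbar t \<in> borel_measurable Q) \<and> (\<forall>\<omega>. continuous_on {0..1} (\<lambda>t. Xbar t \<omega>)) \<and>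
    (AE \<omega> in Q. uniform_limit {0..1} (\<lambda>N t. partial_expansion \<Psi> \<xi> N t \<omega>) (\<lambda>t. Xbar t \<omega>) sequentially)"
    by (rule expansion_converges) blast
  then obtain Xbar where Xbar: "\<And>t. t \<in> {0..1} \<Longrightarrow> Xbar t \<in> borel_measurable Q"
      "\<And>\<omega>. continuous_on {0..1} (\<lambda>t. Xbar t \<omega>)"
    and lim: "AE \<omega> in Q. uniform_limit {0..1} (\<lambda>N t. partial_expansion \<Psi> \<xi> N t \<omega>) (\<lambda>t. Xbar t \<omega>) sequentially"
    by blast
  have fdd: "same_fdd Q Xbar M X"
    unfolding same_fdd_def
    using gaussian_family_distr_eq[OF Q M _ limit_gaussian[OF _ _ Xbar(1) lim] XG] by blast
  show ?thesis
  proof (intro exI[of _ \<Psi>'] conjI)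
    show "\<forall>(n, k)\<in>dyadic_index. continuous_on {0..1} (\<Psi>' n k) \<and>
       (\<forall>t\<in>{0..1}. \<Psi>' n k t = explicit_Psi f g n k t)"
      unfolding \<Psi>'_def using explicit_Psi_eq[OF C]
      by (auto intro!: continuous_on_mult g schauder_continuous)
    show "\<forall>(n, k)\<in>dyadic_index. closure {t\<in>{0..1}. \<Psi>' n k t \<noteq> 0} \<subseteq> dyadic_support n k"
    proof (safe)
      fix n k x assume i: "(n, k) \<in> dyadic_index" and x: "x \<in> closure {t\<in>{0..1}. \<Psi>' n k t \<noteq> 0}"
      have "{t\<in>{0..1}. \<Psi>' n k t \<noteq> 0} \<subseteq> dyadic_support n k"
      proof
        fix t assume t: "t \<in> {t\<in>{0..1}. \<Psi>' n k t \<noteq> 0}"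
        then show "t \<in> dyadic_support n k"
          using schauder_pieces(1,2)[OF i, of t] by (cases "n = 0") (force simp: dyadic_support_def \<Psi>'_def)+
      qed
      then have "closure {t\<in>{0..1}. \<Psi>' n k t \<noteq> 0} \<subseteq> dyadic_support n k"
        by (rule closure_minimal) (simp add: dyadic_support_def)
      with x show "x \<in> dyadic_support n k" by blast
    qed
    show "\<forall>N. \<forall>t\<in>{0..1}. distr Q borel (partial_expansion \<Psi>' \<xi> N t) =
       distr M borel (real_cond_exp M (sigma_generated M (\<lambda>k::nat. X (real k / 2 ^ N)) {0..2 ^ N}) (X t))"
    proof (intro allI ballI)
      fix N t assume t: "t \<in> {0..1 :: real}"
      have "gaussian_family Q {t} (partial_expansion \<Psi>' \<xi> N) (\<lambda>_ _. g t * g t * kernel N t t)"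
        unfolding \<Psi>' by (rule gaussian_family_cov_cong[OF expansion_gaussian]) auto
      from gaussian_family_distr_eq1[OF Q M this conditional_expectation_law[OF M XG _ t]] g(2)
      show "distr Q borel (partial_expansion \<Psi>' \<xi> N t) =
         distr M borel (real_cond_exp M (sigma_generated M (\<lambda>k::nat. X (real k / 2 ^ N)) {0..2 ^ N}) (X t))"
        by blast
    qed
    show "\<exists>Xbar. (\<forall>t\<in>{0..1}. Xbar t \<in> borel_measurable Q) \<and>
       (\<forall>\<omega>\<in>space Q. continuous_on {0..1} (\<lambda>t. Xbar t \<omega>)) \<and>
       (AE \<omega> in Q. \<forall>t\<in>{0..1}. (\<lambda>N. partial_expansion \<Psi>' \<xi> N t \<omega>) \<longlonglongrightarrow> Xbar t \<omega>) \<and>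
       same_fdd Q Xbar M X"
    proof (intro exI[of _ Xbar] conjI ballI)
      show "AE \<omega> in Q. \<forall>t\<in>{0..1}. (\<lambda>N. partial_expansion \<Psi>' \<xi> N t \<omega>) \<longlonglongrightarrow> Xbar t \<omega>"
        using lim unfolding \<Psi>'
        by eventually_elim (intro ballI tendsto_uniform_limitI)
    qed (use Xbar fdd in auto)
    show "converges_in_distribution_C01 Q (partial_expansion \<Psi>' \<xi>) M X"
      unfolding converges_in_distribution_C01_def
    proof (intro conjI allI impI)
      show "sample_path (partial_expansion \<Psi>' \<xi> N) \<in> measurable Q C01_cylinder" for N
        unfolding \<Psi>' by (intro sample_path_measurable expansion_measurable expansion_continuous)
      show "sample_path X \<in> measurable M C01_cylinder"
        by (intro sample_path_measurable Xm Xc)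
      fix \<phi> :: "(real \<Rightarrow> real) \<Rightarrow> real"
      assume \<phi>: "continuous_map (mtopology_of C01) euclideanreal \<phi> \<and> bounded (\<phi> ` mspace C01)"
      then obtain B where B: "\<And>x. x \<in> mspace C01 \<Longrightarrow> \<bar>\<phi> x\<bar> \<le> B" unfolding bounded_iff by auto
      have "(\<lambda>N. \<integral>\<omega>. \<phi> (sample_path (partial_expansion \<Psi> \<xi> N) \<omega>) \<partial>Q) \<longlonglongrightarrow> (\<integral>\<omega>. \<phi> (sample_path Xbar \<omega>) \<partial>Q)"
        by (rule uniform_limit_functional[OF Q _ B _ _ _ _ lim])
           (use \<phi> Xbar expansion_measurable expansion_continuous in auto)
      also have "(\<integral>\<omega>. \<phi> (sample_path Xbar \<omega>) \<partial>Q) = (\<integral>\<omega>. \<phi> (sample_path X \<omega>) \<partial>M)"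
        by (rule same_fdd_functional[OF M Q _ B Xm Xc _ _ fdd]) (use \<phi> Xbar in auto)
      finally show "(\<lambda>N. \<integral>\<omega>. \<phi> (sample_path (partial_expansion \<Psi>' \<xi> N) \<omega>) \<partial>Q) \<longlonglongrightarrow> (\<integral>\<omega>. \<phi> (sample_path X \<omega>) \<partial>M)"
        unfolding \<Psi>' .
    qed
  qed
qed

end
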